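(* Let $d\ge2$, $1\le i\le d-1$ and $I=\Delta\setminus\{\alpha_i\}$. Consider the morphism $$\rho_I':\Omega^{d-1}\to\Omega^{i-1}\times\mathbb G_m\times\Omega^{d-1-i},$$ $$(y_1,\ldots,y_{d-1})\mapsto\Big(\big(\tfrac{a_{1,d-i}}{(y_1\cdots y_{i-1})^{q^{d-i}}},\ldots,\tfrac{a_{i-1,d-i}}{y_{i-1}^{q^{d-i}}}\big),\ v_{d-i}^{-1},\ \big(\tfrac1{y_{i+1}\cdots y_{d-1}},\ldots,\tfrac1{y_{d-1}}\big)\Big).$$ Then, by the same formula, $\rho'_I$ extends to a morphism $\overline\rho_I:\Omega^{d-1,I}\to\Omega^{i-1}\times\mathbb A^1\times\Omega^{d-1-i}$. Moreover: (a) The restriction of $\overline\rho_I$ to $C_I$ is a radicial morphism, given by $$C_I=\Omega^{i-1}\times\{0\}\times\Omega^{d-1-i}\to\Omega^{i-1}\times\{0\}\times\Omega^{d-1-i},$$ $$\big((y_1,\ldots,y_{i-1}),0,(y_{i+1},\ldots,y_{d-1})\big)\mapsto\Big(\big((\tfrac1{y_1\cdots y_{i-1}})^{q^{d-i}},(\tfrac1{y_2\cdots y_{i-1}})^{q^{d-i}},\ldots,(\tfrac1{y_{i-1}})^{q^{d-i}}\big),0,\big(\tfrac1{y_{i+1}\cdots y_{d-1}},\tfrac1{y_{i+2}\cdots y_{d-1}},\ldots,\tfrac1{y_{d-1}}\big)\Big).$$ (b) $\overline\rho_I$ is surjective and induces an isomorphism $U_I\backslash\Omega^{d-1,I}\xrightarrow{\sim}\Omega^{i-1}\times\mathbb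 A^1\times\Omega^{d-1-i}$, where $U_I\backslash\Omega^{d-1,I}$ is the quotient of the affine $\mathbb F_q$-variety $\Omega^{d-1,I}$ by the finite group $U_I$.
   Context: $q$ is a power of a prime $p$. For $n\ge1$, $\Omega^{n-1}=\Omega^{n-1}_{\mathbb F_q}$ is the complement in $\mathbb P^{n-1}_{\mathbb F_q}$ (coordinates $[X_0:\cdots:X_{n-1}]$) of all $\mathbb F_q$-rational hyperplanes. In the target of $\rho_I'$ the factors $\Omega^{i-1}$ and $\Omega^{d-1-i}$ carry the affine coordinates $(X_0/X_{n-1},\ldots,X_{n-2}/X_{n-1})$ ($n=i$, resp. $n=d-i$). On the source, $y_k=X_k/X_{k-1}$ for $1\le k\le d-1$. The groups: $\mathbf G=\mathrm{GL}_d$, $F:(a_{ij})\mapsto(a_{ij}^q)$, $\mathbf B$ upper triangular, $\Delta=\{\alpha_1,\ldots,\alpha_{d-1}\}$ simple roots with $s_{\alpha_k}=(k,k+1)$. For $I=\Delta\setminus\{\alpha_i\}$, $\mathbf P_I$ is the stabilizer of the standard $i$-dimensional subspace $\mathfrak D_i=\{X_i=\cdots=X_{d-1}=0\}$, $\mathbf U_I$ its unipotent radical and $U_I=\mathbf U_I^F$. $\overline\Omega^{d-1}$ is the compactification of $\Omega^{d-1}$ consisting of tuples $(g_1\mathbf B,\ldots,g_d\mathbf B)\in(\mathbf G/\mathbf B)^d$ with $g_d\mathbf B=F(g_1)\mathbf B$ and $g_k^{-1}g_{k+1}\in\mathbf Bs_{\alpha_k}\mathbf B\cup\mathbf B$ for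 $1\le k\le d-1$; $\Omega^{d-1}$ is the open part where $g_k^{-1}g_{k+1}\in\mathbf Bs_{\alpha_k}\mathbf B$ for all $k$, via $(g_k\mathbf B)\mapsto$ the line of the flag $g_1\mathbf B$. $C_I\subset\overline\Omega^{d-1}$ is the locally closed subvariety where $g_i^{-1}g_{i+1}\in\mathbf B$, $g_k^{-1}g_{k+1}\in\mathbf Bs_{\alpha_k}\mathbf B$ for $k\ne i$, and $g_1\mathbf Bg_1^{-1}\subset\mathbf P_I$. Put $\Omega^{d-1,I}:=\Omega^{d-1}\sqcup C_I$, open in $\overline\Omega^{d-1}$. The group $\mathrm{GL}_d(\mathbb F_q)$ acts by left multiplication and $U_I$ preserves $\Omega^{d-1,I}$. The functions $y_1,\ldots,y_{d-1}$ extend to $\Omega^{d-1,I}$ and identify it with an affine open subvariety of $\mathbb A^{d-1}$; under this identification $C_I$ is the locus $y_i=0$, identified with $\Omega^{i-1}\times\{0\}\times\Omega^{d-1-i}$ via $([1:y_1:y_1y_2:\cdots:y_1\cdots y_{i-1}],\,0,\,[1:y_{i+1}:\cdots:y_{i+1}\cdots y_{d-1}])$. The elements $a_{jk}\in\mathbb F_q(y_1,\ldots,y_{d-1})$ are defined by $a_{j0}=1$, $a_{j1}=\dfrac{1-(y_j\cdots y_{d-1})^{q-1}}{1-y_{d-1}^{q-1}}$ for $1\le j\le d-2$, and for $k\ge2$, $1\le j\le d-k-1$, $$a_{jk}=\frac{a_{j,k-1}^q-(y_j\cdots y_{d-k})^{q^k-q^{k-1}}a_{j,k-1}}{a_{d-k,k-1}^q-y_{d-k}^{q^k-q^{k-1}}a_{d-k,k-1}},$$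 and $v_{d-i}=\dfrac{a_{i,d-1-i}^q-y_i^{q^{d-i}-q^{d-1-i}}a_{i,d-1-i}}{y_i^{q^{d-i}}}$. *)

theory Defs
  imports
    "HOL-Library.Poly_Mapping"
    "HOL-Computational_Algebra.Polynomial"
    "HOL-Computational_Algebra.Fraction_Field"
    "HOL-Algebra.Ideal"
    "HOL-Algebra.Group_Action"
    "Jordan_Normal_Form.Gauss_Jordan_Elimination"
begin

text \<open>
  Conventions.  \<open>'k\<close> is an algebraically closed field of characteristic \<open>p\<close>, and \<open>q\<close> is a power of
  \<open>p\<close>; the field with \<open>q\<close> elements is the subfield of solutions of \<open>x ^ q = x\<close>.  A variety over it
  is given by its set of \<open>'k\<close>-points together with the algebra of its regular functions that are
  defined over the field with \<open>q\<close> elements.  Affine space of dimension \<open>n\<close> consists of the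
  functions \<open>nat \<Rightarrow> 'k\<close> that are extensional on \<open>{1..n}\<close>.
\<close>

definition Fq :: "nat \<Rightarrow> 'k::field set"
  where "Fq q = {x. x ^ q = x}"

section \<open>Polynomials and rational functions\<close>

type_synonym 'k mpoly = "(nat \<Rightarrow>\<^sub>0 nat) \<Rightarrow>\<^sub>0 'k"
type_synonym 'k ratfun = "'k mpoly fract"

definition peval :: "'k::field mpoly \<Rightarrow> (nat \<Rightarrow> 'k) \<Rightarrow> 'k"
  where "peval g x =
    (\<Sum>m\<in>Poly_Mapping.keys g. Poly_Mapping.lookup g m *
      (\<Prod>k\<in>Poly_Mapping.keys m. x k ^ Poly_Mapping.lookup m k))"

text \<open>Polynomials in the variables \<open>1, \<dots>, n\<close> over the field with \<open>q\<close> elements.\<close>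

definition Fq_polys :: "nat \<Rightarrow> nat \<Rightarrow> 'k::field mpoly set"
  where "Fq_polys q n =
    {g. (\<forall>m. Poly_Mapping.lookup g m \<in> Fq q) \<and>
        (\<forall>m\<in>Poly_Mapping.keys g. Poly_Mapping.keys m \<subseteq> {1..n})}"

definition ratvar :: "nat \<Rightarrow> 'k::field ratfun"
  where "ratvar k = Fraction_Field.Fract (Poly_Mapping.single (Poly_Mapping.single k 1) 1) 1"

definition regular_at :: "nat \<Rightarrow> nat \<Rightarrow> 'k::field ratfun \<Rightarrow> (nat \<Rightarrow> 'k) \<Rightarrow> bool"
  where "regular_at q n r x \<longleftrightarrow>
    (\<exists>g\<in>Fq_polys q n. \<exists>h\<in>Fq_polys q n. r = Fraction_Field.Fract g h \<and> peval h x \<noteq> 0)"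

text \<open>Meaningful only where \<open>regular_at\<close> holds.\<close>

definition value_at :: "nat \<Rightarrow> nat \<Rightarrow> 'k::field ratfun \<Rightarrow> (nat \<Rightarrow> 'k) \<Rightarrow> 'k"
  where "value_at q n r x =
    (THE c. \<exists>g\<in>Fq_polys q n. \<exists>h\<in>Fq_polys q n.
      r = Fraction_Field.Fract g h \<and> peval h x \<noteq> 0 \<and> c = peval g x / peval h x)"

section \<open>Varieties over the field with \<open>q\<close> elements\<close>

record ('x, 'k) fq_variety =
  points :: "'x set"
  regular :: "('x \<Rightarrow> 'k) set"

text \<open>A locally closed subset of affine \<open>n\<close>-space, defined over the field with \<open>q\<close> elements, with
  its reduced structure: regular functions are locally quotients of polynomials.\<close>

definition subvariety_of_affine ::
    "nat \<Rightarrow> nat \<Rightarrow> (nat \<Rightarrow> 'k::field) set \<Rightarrow> (nat \<Rightarrow> 'k, 'k) fq_variety"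
  where "subvariety_of_affine q n S =
    \<lparr>points = S,
     regular = {f \<in> extensional S. \<forall>x\<in>S. \<exists>g\<in>Fq_polys q n. \<exists>h\<in>Fq_polys q n. peval h x \<noteq> 0 \<and>
       (\<forall>z\<in>S. peval h z \<noteq> 0 \<longrightarrow> f z = peval g z / peval h z)}\<rparr>"

text \<open>The structure on \<open>S\<close> for which an injective map \<open>\<phi>\<close> into affine \<open>n\<close>-space is an isomorphism
  onto its image.\<close>

definition variety_via ::
    "nat \<Rightarrow> nat \<Rightarrow> ('x \<Rightarrow> nat \<Rightarrow> 'k::field) \<Rightarrow> 'x set \<Rightarrow> ('x, 'k) fq_variety"
  where "variety_via q n \<phi> S =
    \<lparr>points = S,
     regular = (\<lambda>f. \<lambda>s\<in>S. f (\<phi> s)) ` regular (subvariety_of_affine q n (\<phi> ` S))\<rparr>"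

definition pullback ::
    "('x, 'k) fq_variety \<Rightarrow> ('x \<Rightarrow> 'y) \<Rightarrow> ('y \<Rightarrow> 'k) \<Rightarrow> 'x \<Rightarrow> 'k"
  where "pullback V f g = (\<lambda>x\<in>points V. g (f x))"

text \<open>This describes the morphisms of varieties whenever the target is affine, as are all the
  targets below.\<close>

definition variety_hom ::
    "('x, 'k) fq_variety \<Rightarrow> ('y, 'k) fq_variety \<Rightarrow> ('x \<Rightarrow> 'y) set"
  where "variety_hom V W =
    {f \<in> points V \<rightarrow>\<^sub>E points W. \<forall>g\<in>regular W. pullback V f g \<in> regular V}"

definition isomorphism ::
    "('x, 'k) fq_variety \<Rightarrow> ('y, 'k) fq_variety \<Rightarrow> ('x \<Rightarrow> 'y) \<Rightarrow> bool"
  where "isomorphism V W f \<longleftrightarrow> f \<in> variety_hom V W \<and>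
    (\<exists>g\<in>variety_hom W V. (\<forall>x\<in>points V. g (f x) = x) \<and> (\<forall>y\<in>points W. f (g y) = y))"

text \<open>Over the algebraically closed field \<open>'k\<close>, surjectivity can be read off on points.\<close>

definition surjective_morphism ::
    "('x, 'k) fq_variety \<Rightarrow> ('y, 'k) fq_variety \<Rightarrow> ('x \<Rightarrow> 'y) \<Rightarrow> bool"
  where "surjective_morphism V W f \<longleftrightarrow> f ` points V = points W"

definition coordinate_ring :: "('x, 'k::field) fq_variety \<Rightarrow> ('x \<Rightarrow> 'k) ring"
  where "coordinate_ring V =
    \<lparr>carrier = regular V,
     monoid.mult = (\<lambda>f g. \<lambda>x\<in>points V. f x * g x),
     monoid.one = (\<lambda>x\<in>points V. 1),
     ring.zero = (\<lambda>x\<in>points V. 0),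
     ring.add = (\<lambda>f g. \<lambda>x\<in>points V. f x + g x)\<rparr>"

definition Spec :: "('x, 'k::field) fq_variety \<Rightarrow> ('x \<Rightarrow> 'k) set set"
  where "Spec V = {P. primeideal P (coordinate_ring V)}"

definition Spec_map ::
    "('x, 'k::field) fq_variety \<Rightarrow> ('y, 'k) fq_variety \<Rightarrow> ('x \<Rightarrow> 'y) \<Rightarrow> ('x \<Rightarrow> 'k) set \<Rightarrow> ('y \<Rightarrow> 'k) set"
  where "Spec_map V W f P = {g \<in> regular W. pullback V f g \<in> P}"

text \<open>Let \<open>\<kappa>(P)\<close> be the fraction field of \<open>coordinate_ring V\<close> modulo \<open>P\<close>, and \<open>Q = Spec_map V W f P\<close>.
  The extension \<open>\<kappa>(P) / \<kappa>(Q)\<close> is purely inseparable iff every \<open>b / c\<close> in \<open>\<kappa>(P)\<close> satisfies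
  \<open>(b / c) ^ (p ^ m) = a / s\<close> for some \<open>m\<close> and some \<open>a / s\<close> in \<open>\<kappa>(Q)\<close>, where \<open>p\<close> is the
  characteristic; the last line states this with denominators cleared.\<close>

definition residue_purely_inseparable ::
    "('x, 'k::field) fq_variety \<Rightarrow> ('y, 'k) fq_variety \<Rightarrow> ('x \<Rightarrow> 'y) \<Rightarrow> ('x \<Rightarrow> 'k) set \<Rightarrow> bool"
  where "residue_purely_inseparable V W f P \<longleftrightarrow>
    (\<forall>b\<in>regular V. \<forall>c\<in>regular V - P. \<exists>m::nat.
      \<exists>a\<in>regular W. \<exists>s\<in>regular W - Spec_map V W f P.
        (\<lambda>x\<in>points V. s (f x) * b x ^ (CHAR('k) ^ m) - a (f x) * c x ^ (CHAR('k) ^ m)) \<in> P)"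

text \<open>A morphism of schemes is radicial if it is injective and induces purely inseparable extensions
  of residue fields; this is the condition for the affine schemes of \<open>coordinate_ring V\<close> and
  \<open>coordinate_ring W\<close>.\<close>

definition radicial ::
    "('x, 'k::field) fq_variety \<Rightarrow> ('y, 'k) fq_variety \<Rightarrow> ('x \<Rightarrow> 'y) \<Rightarrow> bool"
  where "radicial V W f \<longleftrightarrow>
    inj_on (Spec_map V W f) (Spec V) \<and> (\<forall>P\<in>Spec V. residue_purely_inseparable V W f P)"

text \<open>The quotient of an affine variety by a finite group of automorphisms: the points are the orbits
  and the algebra of regular functions is the algebra of invariants.\<close>

definition quotient_variety ::
    "('g, 'b) monoid_scheme \<Rightarrow> ('g \<Rightarrow> 'x \<Rightarrow> 'x) \<Rightarrow> ('x, 'k) fq_variety \<Rightarrow> ('x set, 'k) fq_variety"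
  where "quotient_variety U act V =
    \<lparr>points = orbits U (points V) act,
     regular = {f \<in> extensional (orbits U (points V) act).
       (\<lambda>x\<in>points V. f (orbit U act x)) \<in> regular V}\<rparr>"

section \<open>The general linear group and flags\<close>

text \<open>Matrix and vector indices start from 0, so that row \<open>k\<close> belongs to the coordinate \<open>X\<^sub>k\<close>.\<close>

definition GL :: "nat \<Rightarrow> 'k::field mat monoid"
  where "GL d = units_of (ring_mat TYPE('k) d ())"

definition frob :: "nat \<Rightarrow> 'k::field mat \<Rightarrow> 'k mat"
  where "frob q = map_mat (\<lambda>a. a ^ q)"

definition borel :: "nat \<Rightarrow> 'k::field mat set"
  where "borel d = {b \<in> carrier (GL d). upper_triangular b}"

definition bruhat_cell :: "nat \<Rightarrow> nat \<Rightarrow> 'k::field mat set"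
  where "bruhat_cell d k =
    borel d <#>\<^bsub>GL d\<^esub> {swaprows_mat d (k - 1) k} <#>\<^bsub>GL d\<^esub> borel d"

definition std_subspace :: "nat \<Rightarrow> nat \<Rightarrow> 'k::field vec set"
  where "std_subspace d i = {v \<in> carrier_vec d. \<forall>k\<in>{i..<d}. v $ k = 0}"

definition parabolic :: "nat \<Rightarrow> nat \<Rightarrow> 'k::field mat set"
  where "parabolic d i =
    {g \<in> carrier (GL d). (\<lambda>v. g *\<^sub>v v) ` std_subspace d i = std_subspace d i}"

text \<open>The unipotent radical of the parabolic subgroup consists of its elements that act trivially on
  the standard subspace and on the quotient by it.\<close>

definition unipotent_radical :: "nat \<Rightarrow> nat \<Rightarrow> 'k::field mat set"
  where "unipotent_radical d i =
    {u \<in> parabolic d i.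
      (\<forall>v\<in>std_subspace d i. u *\<^sub>v v = v) \<and>
      (\<forall>v\<in>carrier_vec d. u *\<^sub>v v - v \<in> std_subspace d i)}"

definition unipotent_group :: "nat \<Rightarrow> nat \<Rightarrow> nat \<Rightarrow> 'k::field mat monoid"
  where "unipotent_group q d i =
    (GL d)\<lparr>carrier := {u \<in> unipotent_radical d i. frob q u = u}\<rparr>"

text \<open>A tuple of flags is a function on \<open>{1..d}\<close> whose values are left cosets of the Borel subgroup.\<close>

type_synonym 'k flag_tuple = "nat \<Rightarrow> 'k mat set"

definition represents :: "nat \<Rightarrow> nat \<Rightarrow> (nat \<Rightarrow> 'k::field mat) \<Rightarrow> 'k flag_tuple \<Rightarrow> bool"
  where "represents q d g c \<longleftrightarrow>
    c \<in> extensional {1..d} \<and>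
    (\<forall>k\<in>{1..d}. g k \<in> carrier (GL d) \<and> c k = g k <#\<^bsub>GL d\<^esub> borel d) \<and>
    c d = frob q (g 1) <#\<^bsub>GL d\<^esub> borel d"

definition rel_pos :: "nat \<Rightarrow> (nat \<Rightarrow> 'k::field mat) \<Rightarrow> nat \<Rightarrow> 'k mat"
  where "rel_pos d g k = inv\<^bsub>GL d\<^esub> (g k) \<otimes>\<^bsub>GL d\<^esub> g (k + 1)"

definition Omega_bar :: "nat \<Rightarrow> nat \<Rightarrow> 'k::field flag_tuple set"
  where "Omega_bar q d =
    {c. \<exists>g. represents q d g c \<and> (\<forall>k\<in>{1..d - 1}. rel_pos d g k \<in> bruhat_cell d k \<union> borel d)}"

definition Omega :: "nat \<Rightarrow> nat \<Rightarrow> 'k::field flag_tuple set"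
  where "Omega q d =
    {c \<in> Omega_bar q d. \<exists>g. represents q d g c \<and> (\<forall>k\<in>{1..d - 1}. rel_pos d g k \<in> bruhat_cell d k)}"

definition C_I :: "nat \<Rightarrow> nat \<Rightarrow> nat \<Rightarrow> 'k::field flag_tuple set"
  where "C_I q d i =
    {c \<in> Omega_bar q d. \<exists>g. represents q d g c \<and>
       rel_pos d g i \<in> borel d \<and>
       (\<forall>k\<in>{1..d - 1} - {i}. rel_pos d g k \<in> bruhat_cell d k) \<and>
       g 1 <#\<^bsub>GL d\<^esub> borel d #>\<^bsub>GL d\<^esub> inv\<^bsub>GL d\<^esub> (g 1) \<subseteq> parabolic d i}"

definition Omega_I :: "nat \<Rightarrow> nat \<Rightarrow> nat \<Rightarrow> 'k::field flag_tuple set"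
  where "Omega_I q d i = Omega q d \<union> C_I q d i"

definition flag_action :: "nat \<Rightarrow> 'k::field mat \<Rightarrow> 'k flag_tuple \<Rightarrow> 'k flag_tuple"
  where "flag_action d u c = (\<lambda>k\<in>{1..d}. u <#\<^bsub>GL d\<^esub> c k)"

text \<open>The functions \<open>y\<^sub>k\<close>.  Any representative \<open>g\<close> of the first flag gives the same values.  On \<open>Omega\<close>
  we have \<open>y\<^sub>k = X\<^sub>k / X\<^sub>k\<^sub>-\<^sub>1\<close> for the line \<open>V\<^sub>1\<close> of the first flag, spanned by column 0 of \<open>g\<close>.  On \<open>C_I\<close>
  the \<open>i\<close>-dimensional member \<open>V\<^sub>i\<close> of the first flag is the standard subspace, where
  \<open>X\<^sub>i = \<dots> = X\<^sub>d\<^sub>-\<^sub>1 = 0\<close>.  The line \<open>V\<^sub>1\<close> lies in it and still gives \<open>y\<^sub>k\<close> for \<open>k \<le> i\<close>, with \<open>y\<^sub>i = 0\<close>; for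
  \<open>k > i\<close> the extension of \<open>y\<^sub>k\<close> is \<open>X\<^sub>k / X\<^sub>k\<^sub>-\<^sub>1\<close> on the line \<open>V\<^sub>i\<^sub>+\<^sub>1 / V\<^sub>i\<close>, spanned by column \<open>i\<close> of \<open>g\<close>.
  Indeed, let \<open>\<Delta>\<^sub>k\<close> be the minor of the first \<open>i + 1\<close> columns of \<open>g\<close> in the rows \<open>0, \<dots>, i - 1, k\<close>.
  On \<open>C_I\<close> the regular function \<open>\<Delta>\<^sub>k / \<Delta>\<^sub>k\<^sub>-\<^sub>1\<close> is the ratio in column \<open>i\<close>; on \<open>Omega\<close> the minors are
  Moore determinants, and \<open>\<Delta>\<^sub>k / \<Delta>\<^sub>k\<^sub>-\<^sub>1\<close> is \<open>X\<^sub>k / X\<^sub>k\<^sub>-\<^sub>1\<close> times the product of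
  \<open>(X\<^sub>k - w) / (X\<^sub>k\<^sub>-\<^sub>1 - w)\<close> over the nonzero \<open>w\<close> in the span of \<open>X\<^sub>0, \<dots>, X\<^sub>i\<^sub>-\<^sub>1\<close> over the field with \<open>q\<close>
  elements, a product that tends to 1 at \<open>C_I\<close>.\<close>

definition ycoords :: "nat \<Rightarrow> nat \<Rightarrow> nat \<Rightarrow> 'k::field flag_tuple \<Rightarrow> nat \<Rightarrow> 'k"
  where "ycoords q d i c =
    (let g = (SOME g. g \<in> c 1) in
     (\<lambda>k\<in>{1..d - 1}. if c \<in> C_I q d i \<and> k > i then g $$ (k, i) / g $$ (k - 1, i)
                    else g $$ (k, 0) / g $$ (k - 1, 0)))"

definition Omega_variety :: "nat \<Rightarrow> nat \<Rightarrow> nat \<Rightarrow> ('k::field flag_tuple, 'k) fq_variety"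
  where "Omega_variety q d i = variety_via q (d - 1) (ycoords q d i) (Omega q d)"

definition Omega_I_variety :: "nat \<Rightarrow> nat \<Rightarrow> nat \<Rightarrow> ('k::field flag_tuple, 'k) fq_variety"
  where "Omega_I_variety q d i = variety_via q (d - 1) (ycoords q d i) (Omega_I q d i)"

definition C_I_variety :: "nat \<Rightarrow> nat \<Rightarrow> nat \<Rightarrow> ('k::field flag_tuple, 'k) fq_variety"
  where "C_I_variety q d i = variety_via q (d - 1) (ycoords q d i) (C_I q d i)"

section \<open>The target\<close>

text \<open>Homogeneous coordinates \<open>X\<^sub>0, \<dots>, X\<^sub>n\<^sub>-\<^sub>1\<close> of a point outside all rational hyperplanes.\<close>

definition off_hyperplanes :: "nat \<Rightarrow> nat \<Rightarrow> (nat \<Rightarrow> 'k::field) \<Rightarrow> bool"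
  where "off_hyperplanes q n X \<longleftrightarrow>
    (\<forall>a. (\<forall>j<n. a j \<in> Fq q) \<longrightarrow> (\<exists>j<n. a j \<noteq> 0) \<longrightarrow> (\<Sum>j<n. a j * X j) \<noteq> 0)"

text \<open>The product of the complement in dimension \<open>i - 1\<close>, a subset \<open>T\<close> of the affine line and the
  complement in dimension \<open>d - 1 - i\<close>, in the affine coordinates \<open>X\<^sub>j / X\<^sub>n\<^sub>-\<^sub>1\<close> on the outer factors.\<close>

definition target_points :: "nat \<Rightarrow> nat \<Rightarrow> nat \<Rightarrow> 'k::field set \<Rightarrow> (nat \<Rightarrow> 'k) set"
  where "target_points q d i T =
    {z \<in> extensional {1..d - 1}.
       off_hyperplanes q i (\<lambda>j. if j = i - 1 then 1 else z (j + 1)) \<and>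
       z i \<in> T \<and>
       off_hyperplanes q (d - i) (\<lambda>j. if j = d - i - 1 then 1 else z (i + 1 + j))}"

definition target :: "nat \<Rightarrow> nat \<Rightarrow> nat \<Rightarrow> 'k::field set \<Rightarrow> (nat \<Rightarrow> 'k, 'k) fq_variety"
  where "target q d i T = subvariety_of_affine q (d - 1) (target_points q d i T)"

section \<open>The map\<close>

fun a_elt :: "nat \<Rightarrow> nat \<Rightarrow> (nat \<Rightarrow> 'l::field) \<Rightarrow> nat \<Rightarrow> nat \<Rightarrow> 'l"
  where
    "a_elt q d y j 0 = 1"
  | "a_elt q d y j (Suc 0) = (1 - (\<Prod>l=j..d - 1. y l) ^ (q - 1)) / (1 - y (d - 1) ^ (q - 1))"
  | "a_elt q d y j (Suc (Suc k)) =
      (let K = k + 2; e = q ^ K - q ^ (K - 1) in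
        (a_elt q d y j (Suc k) ^ q - (\<Prod>l=j..d - K. y l) ^ e * a_elt q d y j (Suc k)) /
        (a_elt q d y (d - K) (Suc k) ^ q - y (d - K) ^ e * a_elt q d y (d - K) (Suc k)))"

text \<open>The element \<open>v\<close> with index \<open>d - i\<close>.\<close>

definition v_elt :: "nat \<Rightarrow> nat \<Rightarrow> (nat \<Rightarrow> 'l::field) \<Rightarrow> nat \<Rightarrow> 'l"
  where "v_elt q d y i =
    (a_elt q d y i (d - 1 - i) ^ q
       - y i ^ (q ^ (d - i) - q ^ (d - 1 - i)) * a_elt q d y i (d - 1 - i)) / y i ^ (q ^ (d - i))"

definition rho_component :: "nat \<Rightarrow> nat \<Rightarrow> nat \<Rightarrow> nat \<Rightarrow> 'k::field ratfun"
  where "rho_component q d i j =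
    (if j < i then a_elt q d ratvar j (d - i) / (\<Prod>l=j..i - 1. ratvar l) ^ (q ^ (d - i))
     else if j = i then inverse (v_elt q d ratvar i)
     else 1 / (\<Prod>l=j..d - 1. ratvar l))"

definition rho_on :: "nat \<Rightarrow> nat \<Rightarrow> nat \<Rightarrow> 'k::field flag_tuple set \<Rightarrow> 'k flag_tuple \<Rightarrow> nat \<Rightarrow> 'k"
  where "rho_on q d i S =
    (\<lambda>c\<in>S. \<lambda>j\<in>{1..d - 1}. value_at q (d - 1) (rho_component q d i j) (ycoords q d i c))"

definition rho :: "nat \<Rightarrow> nat \<Rightarrow> nat \<Rightarrow> 'k::field flag_tuple \<Rightarrow> nat \<Rightarrow> 'k"
  where "rho q d i = rho_on q d i (Omega q d)"

definition rho_bar :: "nat \<Rightarrow> nat \<Rightarrow> nat \<Rightarrow> 'k::field flag_tuple \<Rightarrow> nat \<Rightarrow> 'k"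
  where "rho_bar q d i = rho_on q d i (Omega_I q d i)"

end

theory Submission
  imports Defs "Jordan_Normal_Form.Determinant" "Jordan_Normal_Form.Column_Operations"
begin

text \<open>
  Let \<open>X 0, \<dots>, X (d - 1)\<close> be homogeneous coordinates, \<open>m = d - i\<close> and \<open>N = q ^ m\<close>.  The group
  \<open>U\<close> adds to each of the first \<open>i\<close> coordinates a combination of the last \<open>m\<close> ones over the field
  with \<open>q\<close> elements.  The natural invariants are therefore the values
  at \<open>X 0, \<dots>, X (i - 1)\<close> of the additive polynomial of degree \<open>N\<close> whose zeros are the combinations
  of \<open>X i, \<dots>, X (d - 1)\<close>.  The functions \<open>a\<^sub>j\<^sub>k\<close> are, up to powers of coordinates, ratios of values of such polynomials
  (\<open>a_elt_value\<close>), because each step of their recursion is the step \<open>H \<mapsto> H ^ q - D ^ (q - 1) H\<close>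
  that adds one more vector to the kernel (\<open>lpoly\<close>, \<open>lpoly_kernel\<close>).  Hence the components of
  the map are quotients of these invariants (\<open>rho_component_value\<close>).  Written with denominators
  that are units on the whole source, boundary included, they define the extension, and on the
  boundary, where \<open>X (d - 1) / X (i - 1)\<close> vanishes, the polynomial degenerates to
  \<open>\<xi> ^ N\<close>: this is the formula of (a).

  On points, (b) is linear algebra over the finite field.  The values of the map determine the values
  of the polynomial, hence the point up to its kernel, so the fibres are the orbits of \<open>U\<close>
  (\<open>rmap_act\<close>, \<open>rmap_fibre\<close>); the map is surjective since additive polynomials are
  (\<open>rmap_surjective\<close>).

  On functions, it must be shown that an invariant regular function \<open>f\<close> descends to the target.  The
  coordinates of the source satisfy monic equations of degree \<open>N\<close> over the functions pulled back
  from the target, so that they generate a ring that is spanned over these by monomials with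
  exponents below \<open>N\<close> (\<open>tower\<close>).  Off the boundary, \<open>U\<close> moves each coordinate
  separately through \<open>N\<close> different values; an invariant element of the ring is a polynomial of
  degree below \<open>N\<close> in that coordinate with \<open>N\<close> equal values, so it does not involve it
  (\<open>invariant_off_boundary\<close>).  Thus it agrees with a pulled back function off the boundary, and
  everywhere because the complement of the boundary is dense (\<open>density\<close>).  A general \<open>f\<close> is only
  locally a quotient of elements of the ring; taking coefficients of \<open>\<Prod> (1 + h (A x) t)\<close> over the
  group yields invariant denominators (\<open>invariant_denominator\<close>), and \<open>f\<close> descends
  (\<open>invariant_descends\<close>).

  On the boundary the map raises the first coordinates to the power \<open>N\<close> and fixes the last ones, so
  that some other map composed with it is the Frobenius map.  The power \<open>N\<close> of every regular
  function is therefore pulled back, which gives radiciality (\<open>boundary_radicial\<close>).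

  All this takes place in coordinates.  To pass to tuples of flags, note that consecutive flags of a
  tuple differ in at most one subspace; hence a tuple is determined by its first flag
  (\<open>gallery_unique\<close>), each subspace of which is mapped by the Frobenius map into the next one.  On
  \<open>Omega\<close> this flag is spanned by the Frobenius images of its line, on \<open>C_I\<close> by those of a line in
  the standard subspace and of a line in the quotient (\<open>flag_of_eqI\<close>), and the lines that occur
  are those outside all rational hyperplanes: their Moore determinant does not vanish
  (\<open>moore_independent\<close>), and a rational hyperplane containing the line of a tuple would contain
  each subspace of its first flag (\<open>row_value_up\<close>).  This identifies the tuples with the points of \<open>source\<close> (\<open>Omega_eq\<close>,
  \<open>C_I_eq\<close>), compatibly with the action of \<open>U\<close> (\<open>action_flag_of\<close>).
\<close>

section \<open>Evaluation of polynomials\<close>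

definition monomial_eval :: "(nat \<Rightarrow>\<^sub>0 nat) \<Rightarrow> (nat \<Rightarrow> 'k::field) \<Rightarrow> 'k"
  where "monomial_eval m x = (\<Prod>k\<in>Poly_Mapping.keys m. x k ^ Poly_Mapping.lookup m k)"

lemma monomial_eval_superset:
  assumes "finite A" "Poly_Mapping.keys m \<subseteq> A"
  shows "monomial_eval m x = (\<Prod>k\<in>A. x k ^ Poly_Mapping.lookup m k)"
  unfolding monomial_eval_def
  by (rule prod.mono_neutral_left) (use assms in \<open>auto simp: in_keys_iff\<close>)

lemma monomial_eval_add: "monomial_eval (m + n) x = monomial_eval m x * monomial_eval n x"
proof -
  let ?A = "Poly_Mapping.keys m \<union> Poly_Mapping.keys n"
  have "monomial_eval (m + n) x = (\<Prod>k\<in>?A. x k ^ Poly_Mapping.lookup (m + n) k)"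
    by (rule monomial_eval_superset) (use keys_add[of m n] in auto)
  also have "\<dots> = (\<Prod>k\<in>?A. x k ^ Poly_Mapping.lookup m k) * (\<Prod>k\<in>?A. x k ^ Poly_Mapping.lookup n k)"
    by (simp add: lookup_add power_add prod.distrib)
  also have "\<dots> = monomial_eval m x * monomial_eval n x"
    by (subst (1 2) monomial_eval_superset[of ?A]) auto
  finally show ?thesis .
qed

lemma peval_superset:
  assumes "finite A" "Poly_Mapping.keys g \<subseteq> A"
  shows "peval g x = (\<Sum>m\<in>A. Poly_Mapping.lookup g m * monomial_eval m x)"
  unfolding peval_def monomial_eval_def
  by (rule sum.mono_neutral_left) (use assms in \<open>auto simp: in_keys_iff\<close>)

lemma peval_add: "peval (g + h) x = peval g x + peval h x"
proof -
  let ?A = "Poly_Mapping.keys g \<union> Poly_Mapping.keys h"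
  have "peval (g + h) x = (\<Sum>m\<in>?A. Poly_Mapping.lookup (g + h) m * monomial_eval m x)"
    by (rule peval_superset) (use keys_add[of g h] in auto)
  also have "\<dots> = (\<Sum>m\<in>?A. Poly_Mapping.lookup g m * monomial_eval m x)
      + (\<Sum>m\<in>?A. Poly_Mapping.lookup h m * monomial_eval m x)"
    by (simp add: lookup_add distrib_right sum.distrib)
  also have "\<dots> = peval g x + peval h x"
    by (subst (1 2) peval_superset[of ?A]) auto
  finally show ?thesis .
qed

lemma peval_zero [simp]: "peval 0 x = 0"
  by (simp add: peval_def)

lemma peval_single: "peval (Poly_Mapping.single m a) x = a * monomial_eval m x"
  by (subst peval_superset[of "{m}"]) auto

lemma peval_sum: "peval (sum g A) x = (\<Sum>a\<in>A. peval (g a) x)"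
  by (induction A rule: infinite_finite_induct) (auto simp: peval_add)

lemma poly_mapping_sum_singles:
  fixes g :: "'a \<Rightarrow>\<^sub>0 'b::comm_monoid_add"
  shows "g = (\<Sum>m\<in>Poly_Mapping.keys g. Poly_Mapping.single m (Poly_Mapping.lookup g m))"
proof (rule poly_mapping_eqI)
  fix k
  have "Poly_Mapping.lookup (\<Sum>m\<in>Poly_Mapping.keys g. Poly_Mapping.single m (Poly_Mapping.lookup g m)) k
    = (\<Sum>m\<in>Poly_Mapping.keys g. if k = m then Poly_Mapping.lookup g m else 0)"
    unfolding lookup_sum by (rule sum.cong) (auto simp: lookup_single)
  also have "\<dots> = Poly_Mapping.lookup g k"
    by (auto simp: in_keys_iff)
  finally show "Poly_Mapping.lookup g k = Poly_Mapping.lookup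
    (\<Sum>m\<in>Poly_Mapping.keys g. Poly_Mapping.single m (Poly_Mapping.lookup g m)) k" ..
qed

lemma mpoly_mult_as_sum:
  fixes g h :: "'k::field mpoly"
  shows "g * h = (\<Sum>m\<in>Poly_Mapping.keys g. \<Sum>n\<in>Poly_Mapping.keys h.
    Poly_Mapping.single (m + n) (Poly_Mapping.lookup g m * Poly_Mapping.lookup h n))"
proof -
  have "g * h = (\<Sum>m\<in>Poly_Mapping.keys g. Poly_Mapping.single m (Poly_Mapping.lookup g m))
     * (\<Sum>n\<in>Poly_Mapping.keys h. Poly_Mapping.single n (Poly_Mapping.lookup h n))"
    using poly_mapping_sum_singles[of g] poly_mapping_sum_singles[of h] by simp
  then show ?thesis
    by (simp add: sum_product mult_single)
qed

lemma peval_mult: "peval (g * h) x = peval g x * peval h x"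
  unfolding mpoly_mult_as_sum peval_sum peval_single monomial_eval_add
  unfolding peval_def monomial_eval_def[symmetric]
  by (simp add: sum_product algebra_simps)

lemma peval_var: "peval (Poly_Mapping.single (Poly_Mapping.single k 1) 1) x = x k"
  by (simp add: peval_single monomial_eval_def)

lemma peval_const: "peval (Poly_Mapping.single 0 c) x = c"
  by (simp add: peval_single monomial_eval_def)

lemma peval_one [simp]: "peval 1 x = 1"
  using peval_const[of 1 x] by simp

text \<open>Restricting a polynomial to a line parallel to an axis reduces density to the fact that a
  polynomial in one variable has finitely many roots.\<close>

lemma peval_line:
  fixes g :: "'k::field mpoly"
  shows "\<exists>P. \<forall>s. peval g (x(i := s)) = poly P s"
proof -
  define P where "P = (\<Sum>m\<in>Poly_Mapping.keys g. Polynomial.smult (Poly_Mapping.lookup g m)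
     (\<Prod>k\<in>Poly_Mapping.keys m. (if k = i then [:0, 1:] else [:x k:]) ^ Poly_Mapping.lookup m k))"
  have "peval g (x(i := s)) = poly P s" for s
    unfolding peval_def P_def poly_sum poly_smult poly_prod poly_power
    by (intro sum.cong prod.cong arg_cong2[where f = "(*)"] arg_cong2[where f = "(^)"] refl) auto
  then show ?thesis by blast
qed

section \<open>The finite field and its Frobenius map\<close>

text \<open>\<open>K\<close> only serves to fix the type of the field.\<close>

locale frobenius =
  fixes q e :: nat and K :: "'k::alg_closed_field itself"
  assumes prime_char: "prime CHAR('k)" and q_eq: "q = CHAR('k) ^ e" and e_pos: "e \<ge> 1"
begin

lemma q_gt_1: "q > 1"
  using prime_char q_eq e_pos by (metis One_nat_def Suc_le_lessD one_less_power prime_gt_1_nat)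

lemma q_pos [simp]: "q > 0" and q_not_1 [simp]: "q \<noteq> Suc 0"
  using q_gt_1 by auto

lemma q_pow_pos [simp]: "q ^ n > 0"
  by simp

lemma q_pow_eq: "q ^ n = CHAR('k) ^ (e * n)"
  by (simp add: q_eq power_mult)

lemma frob_add: "((x::'k) + y) ^ (q ^ n) = x ^ (q ^ n) + y ^ (q ^ n)"
  using freshmans_dream'[OF prime_char q_pow_eq] .

lemma frob_zero [simp]: "(0::'k) ^ (q ^ n) = 0"
  by (simp add: power_0_left)

lemma frob_uminus: "(- (x::'k)) ^ (q ^ n) = - (x ^ (q ^ n))"
proof -
  have "(- x) ^ (q ^ n) + x ^ (q ^ n) = 0"
    using frob_add[of "- x" x n] by simp
  then show ?thesis by (simp add: eq_neg_iff_add_eq_0)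
qed

lemma frob_diff: "((x::'k) - y) ^ (q ^ n) = x ^ (q ^ n) - y ^ (q ^ n)"
  using frob_add[of x "- y" n] by (simp add: frob_uminus)

lemma frob_sum: "(sum f A :: 'k) ^ (q ^ n) = (\<Sum>a\<in>A. f a ^ (q ^ n))"
  using freshmans_dream_sum'[OF prime_char q_pow_eq] .

lemma frob_inj: "(x::'k) ^ (q ^ n) = y ^ (q ^ n) \<longleftrightarrow> x = y"
  using frob_diff[of x y n] by auto

lemmas frob1_add = frob_add[of _ _ 1, simplified]
  and frob1_diff = frob_diff[of _ _ 1, simplified]
  and frob1_sum = frob_sum[of _ _ 1, simplified]
  and frob1_uminus = frob_uminus[of _ 1, simplified]

lemma frob_root: "\<exists>y::'k. y ^ (q ^ n) = x"
  by (rule nth_root_exists) simp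

lemma Fq_0 [simp]: "(0::'k) \<in> Fq q" and Fq_1 [simp]: "(1::'k) \<in> Fq q"
  by (auto simp: Fq_def)

lemma Fq_add: "(x::'k) \<in> Fq q \<Longrightarrow> y \<in> Fq q \<Longrightarrow> x + y \<in> Fq q"
  and Fq_diff: "(x::'k) \<in> Fq q \<Longrightarrow> y \<in> Fq q \<Longrightarrow> x - y \<in> Fq q"
  and Fq_uminus: "(x::'k) \<in> Fq q \<Longrightarrow> - x \<in> Fq q"
  and Fq_mult: "(x::'k) \<in> Fq q \<Longrightarrow> y \<in> Fq q \<Longrightarrow> x * y \<in> Fq q"
  by (auto simp: Fq_def frob1_add frob1_diff frob1_uminus power_mult_distrib)

lemma Fq_sum: "(\<And>a. a \<in> A \<Longrightarrow> (f a :: 'k) \<in> Fq q) \<Longrightarrow> sum f A \<in> Fq q"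
  by (induction A rule: infinite_finite_induct) (auto simp: Fq_add)

lemma Fq_frob: "(x::'k) \<in> Fq q \<Longrightarrow> x ^ (q ^ n) = x"
  by (induction n) (auto simp: Fq_def power_mult)

lemma finite_Fq: "finite (Fq q :: 'k set)"
proof -
  have "{x::'k. poly (monom 1 q - monom 1 1) x = 0} = Fq q"
    by (auto simp: Fq_def poly_monom)
  moreover have "(monom 1 q - monom 1 1 :: 'k poly) \<noteq> 0"
    using q_gt_1 by (auto simp: monom_eq_iff')
  ultimately show ?thesis
    using poly_roots_finite by metis
qed

text \<open>The roots of \<open>x ^ q - x\<close> are simple because the derivative is \<open>- 1\<close>.\<close>

lemma card_Fq: "card (Fq q :: 'k set) = q"
proof -
  let ?P = "monom 1 q - monom 1 1 :: 'k poly"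
  have deg: "degree ?P = q"
    using degree_add_eq_left[of "- monom 1 1 :: 'k poly" "monom 1 q"] q_gt_1
    by (simp add: degree_monom_eq)
  have nz: "?P \<noteq> 0"
    using deg q_gt_1 by auto
  have "of_nat q = (0::'k)"
    using e_pos by (auto simp: q_eq of_nat_eq_0_iff_char_dvd)
  then have der: "pderiv ?P = [:-1:]"
    by (simp add: pderiv_diff pderiv_monom monom_0 one_pCons)
  obtain A where A: "size A = degree ?P" "?P = Polynomial.smult (lead_coeff ?P) (\<Prod>x\<in>#A. [:-x, 1:])"
    using alg_closed_imp_factorization[OF nz] by auto
  have roots: "set_mset A = Fq q"
  proof -
    have "poly ?P x = lead_coeff ?P * (\<Prod>a\<in>#A. x - a)" for x
      by (subst A(2)) (simp add: poly_prod_mset)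
    moreover have "lead_coeff ?P \<noteq> 0"
      using nz by (simp only: leading_coeff_0_iff not_False_eq_True)
    ultimately have "poly ?P x = 0 \<longleftrightarrow> x \<in># A" for x
      by (auto simp: prod_mset_zero_iff)
    then show ?thesis
      by (auto simp: Fq_def poly_monom)
  qed
  have simple: "count A x \<le> 1" for x
  proof (rule ccontr)
    assume "\<not> count A x \<le> 1"
    then have "count {#x, x#} y \<le> count A y" for y by auto
    then have "{#x, x#} \<subseteq># A" by (simp add: subseteq_mset_def)
    then obtain B where "A = {#x, x#} + B" by (metis subset_mset.le_iff_add)
    then have "[:-x, 1:] ^ 2 dvd ?P"
      by (subst A(2), intro dvd_smult)
        (simp add: power2_eq_square mult.assoc[symmetric] del: mult_pCons_left mult_pCons_right)
    then obtain R where "?P = [:-x, 1:] ^ 2 * R" by (elim dvdE)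
    then have "poly (pderiv ?P) x = 0"
      by (simp only: pderiv_mult poly_add poly_mult power2_eq_square) simp
    then show False unfolding der by simp
  qed
  have "count A x = count (mset_set (set_mset A)) x" for x
    using simple[of x] count_greater_zero_iff[of A x]
    by (cases "x \<in># A") (auto simp: not_in_iff simp del: count_greater_zero_iff)
  then have "A = mset_set (set_mset A)"
    by (rule multiset_eqI)
  then have "size A = card (set_mset A)"
    by (metis size_mset_set)
  then show ?thesis
    using A(1) deg roots by simp
qed

section \<open>Polynomials over the finite field\<close>

lemma Fq_polys_add: "(g::'k mpoly) \<in> Fq_polys q n \<Longrightarrow> h \<in> Fq_polys q n \<Longrightarrow> g + h \<in> Fq_polys q n"
  unfolding Fq_polys_def by (auto simp: lookup_add Fq_add simp del: atLeastAtMost_iff dest!: subsetD[OF keys_add])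

lemma Fq_polys_zero: "(0::'k mpoly) \<in> Fq_polys q n"
  by (auto simp: Fq_polys_def)

lemma Fq_polys_sum: "(\<And>a. a \<in> A \<Longrightarrow> (g a::'k mpoly) \<in> Fq_polys q n) \<Longrightarrow> sum g A \<in> Fq_polys q n"
  by (induction A rule: infinite_finite_induct) (auto simp: Fq_polys_add Fq_polys_zero)

lemma Fq_polys_single:
  "(c::'k) \<in> Fq q \<Longrightarrow> Poly_Mapping.keys m \<subseteq> {1..n} \<Longrightarrow> Poly_Mapping.single m c \<in> Fq_polys q n"
  by (auto simp: Fq_polys_def lookup_single when_def)

lemma Fq_polys_mult: "(g::'k mpoly) \<in> Fq_polys q n \<Longrightarrow> h \<in> Fq_polys q n \<Longrightarrow> g * h \<in> Fq_polys q n"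
  unfolding mpoly_mult_as_sum
proof (intro Fq_polys_sum Fq_polys_single)
  fix m n'
  assume "g \<in> Fq_polys q n" "h \<in> Fq_polys q n" "m \<in> Poly_Mapping.keys g" "n' \<in> Poly_Mapping.keys h"
  then show "Poly_Mapping.lookup g m * Poly_Mapping.lookup h n' \<in> Fq q"
    "Poly_Mapping.keys (m + n') \<subseteq> {1..n}"
    using keys_add[of m n'] unfolding Fq_polys_def by (auto intro!: Fq_mult) (force dest!: subsetD bspec)+
qed

lemma Fq_polys_const: "(c::'k) \<in> Fq q \<Longrightarrow> Poly_Mapping.single 0 c \<in> Fq_polys q n"
  by (rule Fq_polys_single) auto

lemma Fq_polys_one: "(1::'k mpoly) \<in> Fq_polys q n"
  using Fq_polys_const[of 1] by simp

lemma Fq_polys_var: "k \<in> {1..n} \<Longrightarrow> Poly_Mapping.single (Poly_Mapping.single k 1) (1::'k) \<in> Fq_polys q n"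
  by (rule Fq_polys_single) auto

lemma Fq_polys_uminus: "(g::'k mpoly) \<in> Fq_polys q n \<Longrightarrow> - g \<in> Fq_polys q n"
proof -
  assume "g \<in> Fq_polys q n"
  then have "Poly_Mapping.single 0 (- 1) * g \<in> Fq_polys q n"
    by (intro Fq_polys_mult Fq_polys_const) (auto simp: Fq_uminus)
  moreover have "Poly_Mapping.single 0 (- 1) * g = - g"
    by (simp add: single_uminus)
  ultimately show ?thesis by simp
qed

lemma peval_uminus: "peval (- g) x = - peval g (x :: nat \<Rightarrow> 'k)"
  using peval_add[of g "- g" x] by (simp add: eq_neg_iff_add_eq_0 add.commute)

lemma peval_cong:
  assumes "(g::'k mpoly) \<in> Fq_polys q n" "\<And>k. k \<in> {1..n} \<Longrightarrow> x k = y k"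
  shows "peval g x = peval g y"
proof -
  have "(\<Prod>k\<in>Poly_Mapping.keys m. x k ^ Poly_Mapping.lookup m k)
      = (\<Prod>k\<in>Poly_Mapping.keys m. y k ^ Poly_Mapping.lookup m k)" if "m \<in> Poly_Mapping.keys g" for m
    by (rule prod.cong) (use assms that in \<open>auto simp: Fq_polys_def dest!: bspec\<close>)
  then show ?thesis
    by (simp add: peval_def)
qed

text \<open>The Frobenius map is additive and fixes the coefficients.\<close>

lemma peval_frob:
  assumes "(g::'k mpoly) \<in> Fq_polys q n"
  shows "peval g x ^ (q ^ l) = peval g (\<lambda>k. x k ^ (q ^ l))"
proof -
  have c: "Poly_Mapping.lookup g m ^ (q ^ l) = Poly_Mapping.lookup g m" for m
    using assms by (intro Fq_frob) (auto simp: Fq_polys_def)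
  have "(\<Prod>k\<in>A. x k ^ f k) ^ (q ^ l) = (\<Prod>k\<in>A. (x k ^ (q ^ l)) ^ f k)" for A f
    unfolding prod_power_distrib by (intro prod.cong refl) (metis power_mult mult.commute)
  then show ?thesis
    unfolding peval_def frob_sum power_mult_distrib c by simp
qed

end

section \<open>Regular functions\<close>

text \<open>A predicate on arbitrary functions is easier to handle than the set of extensional functions
  in the definition of a subvariety.\<close>

definition regular_on :: "nat \<Rightarrow> nat \<Rightarrow> (nat \<Rightarrow> 'k::field) set \<Rightarrow> ((nat \<Rightarrow> 'k) \<Rightarrow> 'k) \<Rightarrow> bool"
  where "regular_on q n S f \<longleftrightarrow>
    (\<forall>x\<in>S. \<exists>g\<in>Fq_polys q n. \<exists>h\<in>Fq_polys q n. peval h x \<noteq> 0 \<and>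
       (\<forall>z\<in>S. peval h z \<noteq> 0 \<longrightarrow> f z = peval g z / peval h z))"

lemma regular_subvariety_iff:
  "f \<in> regular (subvariety_of_affine q n S) \<longleftrightarrow> f \<in> extensional S \<and> regular_on q n S f"
  by (simp add: subvariety_of_affine_def regular_on_def)

lemma points_subvariety [simp]: "points (subvariety_of_affine q n S) = S"
  by (simp add: subvariety_of_affine_def)

lemma regular_on_cong:
  assumes "\<And>x. x \<in> S \<Longrightarrow> f x = g x"
  shows "regular_on q n S f \<longleftrightarrow> regular_on q n S g"
  unfolding regular_on_def using assms by simp

lemma regular_on_subset: "regular_on q n S f \<Longrightarrow> S' \<subseteq> S \<Longrightarrow> regular_on q n S' f"
  unfolding regular_on_def by (meson subsetD)

context frobenius
begin

lemma regular_on_peval: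
  assumes "(g::'k mpoly) \<in> Fq_polys q n"
  shows "regular_on q n S (peval g)"
  unfolding regular_on_def
  by (intro ballI bexI[of _ g] bexI[of _ 1]) (use assms in \<open>auto simp: Fq_polys_one\<close>)

lemma regular_on_const: "(c::'k) \<in> Fq q \<Longrightarrow> regular_on q n S (\<lambda>_. c)"
proof -
  assume "c \<in> Fq q"
  moreover have "peval (Poly_Mapping.single 0 c) = (\<lambda>_. c)"
    by (rule ext) (rule peval_const)
  ultimately show ?thesis
    using regular_on_peval[OF Fq_polys_const[of c]] by metis
qed

lemma regular_on_coord: "k \<in> {1..n} \<Longrightarrow> regular_on q n S (\<lambda>x. x k :: 'k)"
proof -
  assume "k \<in> {1..n}"
  moreover have "peval (Poly_Mapping.single (Poly_Mapping.single k 1) 1) = (\<lambda>x. x k :: 'k)"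
    by (rule ext) (rule peval_var)
  ultimately show ?thesis
    using regular_on_peval[OF Fq_polys_var[of k]] by metis
qed

text \<open>Regularity is a local condition for which local quotients of regular functions may replace local
  quotients of polynomials; writing the quotient as \<open>f z * H z = G z\<close> avoids division.\<close>

lemma regular_on_local_quotient:
  fixes f :: "(nat \<Rightarrow> 'k) \<Rightarrow> 'k"
  assumes "\<And>x. x \<in> S \<Longrightarrow> \<exists>G H. regular_on q n S G \<and> regular_on q n S H \<and> H x \<noteq> 0 \<and>
    (\<forall>z\<in>S. H z \<noteq> 0 \<longrightarrow> f z * H z = G z)"
  shows "regular_on q n S f"
  unfolding regular_on_def
proof
  fix x assume x: "x \<in> S"
  obtain G H where GH: "regular_on q n S G" "regular_on q n S H" "H x \<noteq> 0"
    "\<And>z. z \<in> S \<Longrightarrow> H z \<noteq> 0 \<Longrightarrow> f z * H z = G z"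
    using assms[OF x] by auto
  obtain g1 h1 where 1: "g1 \<in> Fq_polys q n" "h1 \<in> Fq_polys q n" "peval h1 x \<noteq> 0"
    "\<And>z. z \<in> S \<Longrightarrow> peval h1 z \<noteq> 0 \<Longrightarrow> G z = peval g1 z / peval h1 z"
    using GH(1) x unfolding regular_on_def by blast
  obtain g2 h2 where 2: "g2 \<in> Fq_polys q n" "h2 \<in> Fq_polys q n" "peval h2 x \<noteq> 0"
    "\<And>z. z \<in> S \<Longrightarrow> peval h2 z \<noteq> 0 \<Longrightarrow> H z = peval g2 z / peval h2 z"
    using GH(2) x unfolding regular_on_def by blast
  have "peval g2 x \<noteq> 0"
    using GH(3) 2(3) 2(4)[OF x] by auto
  show "\<exists>g\<in>Fq_polys q n. \<exists>h\<in>Fq_polys q n. peval h x \<noteq> 0 \<and>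
       (\<forall>z\<in>S. peval h z \<noteq> 0 \<longrightarrow> f z = peval g z / peval h z)"
  proof (rule bexI[of _ "g1 * h2 * h2"], rule bexI[of _ "h1 * h2 * g2"], intro conjI ballI impI)
    show "peval (h1 * h2 * g2) x \<noteq> 0"
      using 1 2 \<open>peval g2 x \<noteq> 0\<close> by (simp add: peval_mult)
    fix z assume z: "z \<in> S" "peval (h1 * h2 * g2) z \<noteq> 0"
    then have nz: "peval h1 z \<noteq> 0" "peval h2 z \<noteq> 0" "peval g2 z \<noteq> 0"
      by (auto simp: peval_mult)
    then have Hz: "H z = peval g2 z / peval h2 z" and Gz: "G z = peval g1 z / peval h1 z"
      using 1(4) 2(4) z by auto
    moreover from Hz nz have "H z \<noteq> 0" by simp
    then have "f z * H z = G z"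
      using GH(4) z by simp
    ultimately have "f z * (peval g2 z / peval h2 z) = peval g1 z / peval h1 z"
      by simp
    with nz show "f z = peval (g1 * h2 * h2) z / peval (h1 * h2 * g2) z"
      using nz by (simp add: peval_mult field_simps)
  qed (use 1 2 in \<open>auto intro: Fq_polys_mult\<close>)
qed

lemma regular_on_add_mult:
  fixes f1 f2 :: "(nat \<Rightarrow> 'k) \<Rightarrow> 'k"
  assumes "regular_on q n S f1" "regular_on q n S f2"
  shows "regular_on q n S (\<lambda>x. f1 x + f2 x)" "regular_on q n S (\<lambda>x. f1 x * f2 x)"
proof -
  { fix x assume x: "x \<in> S"
    obtain g1 h1 where 1: "g1 \<in> Fq_polys q n" "h1 \<in> Fq_polys q n" "peval h1 x \<noteq> 0"
      "\<And>z. z \<in> S \<Longrightarrow> peval h1 z \<noteq> 0 \<Longrightarrow> f1 z = peval g1 z / peval h1 z"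
      using assms(1) x unfolding regular_on_def by blast
    obtain g2 h2 where 2: "g2 \<in> Fq_polys q n" "h2 \<in> Fq_polys q n" "peval h2 x \<noteq> 0"
      "\<And>z. z \<in> S \<Longrightarrow> peval h2 z \<noteq> 0 \<Longrightarrow> f2 z = peval g2 z / peval h2 z"
      using assms(2) x unfolding regular_on_def by blast
    have nz: "peval h1 z \<noteq> 0" "peval h2 z \<noteq> 0" if "peval (h1 * h2) z \<noteq> 0" for z
      using that by (auto simp: peval_mult)
    have a: "\<exists>G H. regular_on q n S G \<and> regular_on q n S H \<and> H x \<noteq> 0 \<and>
        (\<forall>z\<in>S. H z \<noteq> 0 \<longrightarrow> (f1 z + f2 z) * H z = G z)"
      using 1 2 by (intro exI[of _ "peval (g1 * h2 + g2 * h1)"] exI[of _ "peval (h1 * h2)"])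
        (auto simp: peval_mult peval_add field_simps intro!: regular_on_peval Fq_polys_add Fq_polys_mult)
    have b: "\<exists>G H. regular_on q n S G \<and> regular_on q n S H \<and> H x \<noteq> 0 \<and>
        (\<forall>z\<in>S. H z \<noteq> 0 \<longrightarrow> (f1 z * f2 z) * H z = G z)"
      using 1 2 by (intro exI[of _ "peval (g1 * g2)"] exI[of _ "peval (h1 * h2)"])
        (auto simp: peval_mult peval_add field_simps intro!: regular_on_peval Fq_polys_add Fq_polys_mult)
    note a b }
  note ab = this
  show "regular_on q n S (\<lambda>x. f1 x + f2 x)" "regular_on q n S (\<lambda>x. f1 x * f2 x)"
    using ab by (auto intro!: regular_on_local_quotient)
qed

lemmas regular_on_add = regular_on_add_mult(1) and regular_on_mult = regular_on_add_mult(2)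

lemma regular_on_uminus: "regular_on q n S f \<Longrightarrow> regular_on q n S (\<lambda>x. - f x :: 'k)"
  using regular_on_mult[OF regular_on_const[of "- 1"], of n S f] by (simp add: Fq_uminus)

lemma regular_on_diff: "regular_on q n S f \<Longrightarrow> regular_on q n S g \<Longrightarrow> regular_on q n S (\<lambda>x. f x - g x :: 'k)"
  using regular_on_add[OF _ regular_on_uminus, of n S f g] by simp

lemma regular_on_power: "regular_on q n S f \<Longrightarrow> regular_on q n S (\<lambda>x. f x ^ l :: 'k)"
  by (induction l) (auto simp: regular_on_const regular_on_mult)

lemma regular_on_sum:
  "(\<And>a. a \<in> A \<Longrightarrow> regular_on q n S (f a)) \<Longrightarrow> regular_on q n S (\<lambda>x. \<Sum>a\<in>A. f a x :: 'k)"
  by (induction A rule: infinite_finite_induct) (auto simp: regular_on_const regular_on_add)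

lemma regular_on_prod:
  "(\<And>a. a \<in> A \<Longrightarrow> regular_on q n S (f a)) \<Longrightarrow> regular_on q n S (\<lambda>x. \<Prod>a\<in>A. f a x :: 'k)"
  by (induction A rule: infinite_finite_induct) (auto simp: regular_on_const regular_on_mult)

lemma regular_on_divide:
  assumes "regular_on q n S f" "regular_on q n S g" "\<And>x. x \<in> S \<Longrightarrow> g x \<noteq> 0"
  shows "regular_on q n S (\<lambda>x. f x / g x :: 'k)"
proof (rule regular_on_local_quotient)
  fix x assume x: "x \<in> S"
  show "\<exists>G H. regular_on q n S G \<and> regular_on q n S H \<and> H x \<noteq> 0 \<and>
    (\<forall>z\<in>S. H z \<noteq> 0 \<longrightarrow> (f z / g z) * H z = G z)"
    using assms x by (intro exI[of _ f] exI[of _ g]) auto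
qed

lemma regular_on_compose_peval:
  assumes "(g::'k mpoly) \<in> Fq_polys q n'" "\<And>k. k \<in> {1..n'} \<Longrightarrow> regular_on q n S (\<lambda>x. \<phi> x k)"
  shows "regular_on q n S (\<lambda>x. peval g (\<phi> x))"
proof -
  have c: "Poly_Mapping.lookup g m \<in> Fq q" for m
    using assms by (auto simp: Fq_polys_def)
  have "k \<in> {1..n'}" if "m \<in> Poly_Mapping.keys g" "k \<in> Poly_Mapping.keys m" for k m
    using assms(1) that by (auto simp: Fq_polys_def dest!: bspec)
  then show ?thesis
    unfolding peval_def
    by (intro regular_on_sum regular_on_mult regular_on_const regular_on_prod regular_on_power assms(2) c)
qed

lemma regular_on_compose:
  fixes \<phi> :: "(nat \<Rightarrow> 'k) \<Rightarrow> nat \<Rightarrow> 'k"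
  assumes f: "regular_on q n' S' f" and \<phi>: "\<And>x. x \<in> S \<Longrightarrow> \<phi> x \<in> S'"
    and reg: "\<And>k. k \<in> {1..n'} \<Longrightarrow> regular_on q n S (\<lambda>x. \<phi> x k)"
  shows "regular_on q n S (\<lambda>x. f (\<phi> x))"
proof (rule regular_on_local_quotient)
  fix x assume x: "x \<in> S"
  obtain g h where gh: "g \<in> Fq_polys q n'" "h \<in> Fq_polys q n'" "peval h (\<phi> x) \<noteq> 0"
      "\<And>z. z \<in> S' \<Longrightarrow> peval h z \<noteq> 0 \<Longrightarrow> f z = peval g z / peval h z"
    using f \<phi>[OF x] unfolding regular_on_def by blast
  show "\<exists>G H. regular_on q n S G \<and> regular_on q n S H \<and> H x \<noteq> 0 \<and>
    (\<forall>z\<in>S. H z \<noteq> 0 \<longrightarrow> f (\<phi> z) * H z = G z)"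
    using gh \<phi> reg
    by (intro exI[of _ "\<lambda>x. peval g (\<phi> x)"] exI[of _ "\<lambda>x. peval h (\<phi> x)"])
      (auto intro: regular_on_compose_peval)
qed

text \<open>The local quotients have coefficients in the finite field, so \<open>peval_frob\<close> applies.  This
  produces the \<open>N\<close>-th powers of functions on the boundary.\<close>

lemma regular_on_frob:
  assumes "regular_on q n S f" "x \<in> S" "y \<in> S" "\<And>k. k \<in> {1..n} \<Longrightarrow> y k = x k ^ (q ^ l)"
  shows "f y = (f x :: 'k) ^ (q ^ l)"
proof -
  obtain g h where gh: "g \<in> Fq_polys q n" "h \<in> Fq_polys q n" "peval h x \<noteq> 0"
      "\<And>z. z \<in> S \<Longrightarrow> peval h z \<noteq> 0 \<Longrightarrow> f z = peval g z / peval h z"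
    using assms unfolding regular_on_def by blast
  have ev: "peval r y = peval r x ^ (q ^ l)" if "r \<in> Fq_polys q n" for r
    using peval_cong[OF that, of y "\<lambda>k. x k ^ (q ^ l)"] assms(4) peval_frob[OF that] by simp
  have "peval h y \<noteq> 0"
    using ev[OF gh(2)] gh(3) by simp
  then show ?thesis
    using gh(3) gh(4)[OF assms(2)] gh(4)[OF assms(3)] ev gh(1,2) by (simp add: power_divide)
qed

section \<open>Values of rational functions\<close>

text \<open>A relation is closed under the field operations whenever the values permit, which the
  description operator in \<open>value_at\<close> and the predicate \<open>regular_at\<close> make awkward to express.\<close>

definition takes_value :: "nat \<Rightarrow> 'k ratfun \<Rightarrow> (nat \<Rightarrow> 'k) \<Rightarrow> 'k \<Rightarrow> bool"
  where "takes_value n r x c \<longleftrightarrow> (\<exists>g\<in>Fq_polys q n. \<exists>h\<in>Fq_polys q n.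
      r = Fraction_Field.Fract g h \<and> peval h x \<noteq> 0 \<and> c = peval g x / peval h x)"

lemma takes_valueI:
  "g \<in> Fq_polys q n \<Longrightarrow> h \<in> Fq_polys q n \<Longrightarrow> r = Fraction_Field.Fract g h \<Longrightarrow> peval h x \<noteq> 0 \<Longrightarrow>
    c = peval g x / peval h x \<Longrightarrow> takes_value n r x c"
  unfolding takes_value_def by blast

lemma takes_value_imp_regular_at: "takes_value n r x c \<Longrightarrow> regular_at q n r x"
  unfolding takes_value_def regular_at_def by blast

lemma takes_value_unique:
  assumes "takes_value n r x c" "takes_value n r x c'"
  shows "c = c'"
proof -
  obtain g h where 1: "r = Fraction_Field.Fract g h" "peval h x \<noteq> 0" "c = peval g x / peval h x"
    using assms(1) unfolding takes_value_def by blast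
  obtain g' h' where 2: "r = Fraction_Field.Fract g' h'" "peval h' x \<noteq> 0" "c' = peval g' x / peval h' x"
    using assms(2) unfolding takes_value_def by blast
  have "h \<noteq> 0" "h' \<noteq> 0"
    using 1 2 by auto
  then have "g * h' = g' * h"
    using 1(1) 2(1) by (simp add: eq_fract)
  then have "peval g x * peval h' x = peval g' x * peval h x"
    by (metis peval_mult)
  then show ?thesis
    using 1 2 by (simp add: frac_eq_eq)
qed

lemma value_at_eq: "takes_value n r x c \<Longrightarrow> value_at q n r x = c"
  unfolding value_at_def takes_value_def[symmetric]
  by (rule the_equality) (auto dest: takes_value_unique)

lemma takes_value_divide:
  assumes "takes_value n r x c" "takes_value n s x d" "d \<noteq> 0"
  shows "takes_value n (r / s) x (c / d)"
proof -
  obtain g h where 1: "g \<in> Fq_polys q n" "h \<in> Fq_polys q n"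
      "r = Fraction_Field.Fract g h" "peval h x \<noteq> 0" "c = peval g x / peval h x"
    using assms(1) unfolding takes_value_def by blast
  obtain g' h' where 2: "g' \<in> Fq_polys q n" "h' \<in> Fq_polys q n"
      "s = Fraction_Field.Fract g' h'" "peval h' x \<noteq> 0" "d = peval g' x / peval h' x"
    using assms(2) unfolding takes_value_def by blast
  show ?thesis
    by (rule takes_valueI[of "g * h'" _ "h * g'"])
      (use 1 2 assms(3) in \<open>auto simp: peval_mult Fq_polys_mult\<close>)
qed

lemma takes_value_mult:
  assumes "takes_value n r x c" "takes_value n s x d"
  shows "takes_value n (r * s) x (c * d)"
proof -
  obtain g h where 1: "g \<in> Fq_polys q n" "h \<in> Fq_polys q n"
      "r = Fraction_Field.Fract g h" "peval h x \<noteq> 0" "c = peval g x / peval h x"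
    using assms(1) unfolding takes_value_def by blast
  obtain g' h' where 2: "g' \<in> Fq_polys q n" "h' \<in> Fq_polys q n"
      "s = Fraction_Field.Fract g' h'" "peval h' x \<noteq> 0" "d = peval g' x / peval h' x"
    using assms(2) unfolding takes_value_def by blast
  show ?thesis
    by (rule takes_valueI[of "g * g'" _ "h * h'"])
      (use 1 2 in \<open>auto simp: peval_mult Fq_polys_mult\<close>)
qed

lemma takes_value_diff:
  assumes "takes_value n r x c" "takes_value n s x d"
  shows "takes_value n (r - s) x (c - d)"
proof -
  obtain g h where 1: "g \<in> Fq_polys q n" "h \<in> Fq_polys q n"
      "r = Fraction_Field.Fract g h" "peval h x \<noteq> 0" "c = peval g x / peval h x"
    using assms(1) unfolding takes_value_def by blast
  obtain g' h' where 2: "g' \<in> Fq_polys q n" "h' \<in> Fq_polys q n"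
      "s = Fraction_Field.Fract g' h'" "peval h' x \<noteq> 0" "d = peval g' x / peval h' x"
    using assms(2) unfolding takes_value_def by blast
  have "h \<noteq> 0" "h' \<noteq> 0"
    using 1 2 by auto
  then have r: "r - s = Fraction_Field.Fract (g * h' + - (g' * h)) (h * h')"
    unfolding 1 2 by (simp add: mult.commute)
  have v: "c - d = peval (g * h' + - (g' * h)) x / peval (h * h') x"
    unfolding 1(5) 2(5) using 1(4) 2(4)
    by (simp add: peval_mult peval_add peval_uminus diff_frac_eq mult.commute del: add_uminus_conv_diff)
  have nz: "peval (h * h') x \<noteq> 0"
    using 1(4) 2(4) by (simp add: peval_mult)
  show ?thesis
    by (rule takes_valueI[OF _ _ r nz v])
      (intro Fq_polys_add Fq_polys_mult Fq_polys_uminus 1(1,2) 2(1,2))+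
qed

lemma takes_value_one: "takes_value n 1 x 1"
  by (rule takes_valueI[of 1 _ 1]) (auto simp: Fq_polys_one One_fract_def)

lemma takes_value_power: "takes_value n r x c \<Longrightarrow> takes_value n (r ^ l) x (c ^ l)"
  by (induction l) (auto simp: takes_value_one takes_value_mult)

lemma takes_value_prod:
  "(\<And>a. a \<in> A \<Longrightarrow> takes_value n (r a) x (c a)) \<Longrightarrow> takes_value n (\<Prod>a\<in>A. r a) x (\<Prod>a\<in>A. c a)"
  by (induction A rule: infinite_finite_induct) (auto simp: takes_value_one takes_value_mult)

lemma takes_value_ratvar: "k \<in> {1..n} \<Longrightarrow> takes_value n (ratvar k) x (x k)"
  unfolding ratvar_def
  by (rule takes_valueI[OF Fq_polys_var Fq_polys_one refl]) (simp_all only: peval_var peval_one, simp_all)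

end

section \<open>Linear polynomials with prescribed kernel\<close>

text \<open>For \<open>\<eta> = 1\<close> this is the monic additive polynomial in \<open>\<xi>\<close> whose zeros are the linear
  combinations of \<open>W (d - k), \<dots>, W (d - 1)\<close> over the field with \<open>q\<close> elements; the variable \<open>\<eta>\<close>
  makes it homogeneous of degree \<open>q ^ k\<close>.\<close>

fun lpoly :: "nat \<Rightarrow> nat \<Rightarrow> (nat \<Rightarrow> 'k::field) \<Rightarrow> nat \<Rightarrow> 'k \<Rightarrow> 'k \<Rightarrow> 'k"
  where
    "lpoly q d W 0 \<xi> \<eta> = \<xi>"
  | "lpoly q d W (Suc k) \<xi> \<eta> = lpoly q d W k \<xi> \<eta> ^ q
      - lpoly q d W k (W (d - Suc k)) 1 ^ (q - 1) * \<eta> ^ (q ^ Suc k - q ^ k) * lpoly q d W k \<xi> \<eta>"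

lemma lpoly_cong:
  assumes "\<And>l. l \<in> {d - k..<d} \<Longrightarrow> W l = W' l" "k \<le> d"
  shows "lpoly q d W k \<xi> \<eta> = lpoly q d W' k \<xi> \<eta>"
  using assms
proof (induction k arbitrary: \<xi> \<eta>)
  case (Suc k)
  have "lpoly q d W k \<xi> \<eta> = lpoly q d W' k \<xi> \<eta>" for \<xi> \<eta>
    using Suc.prems by (intro Suc.IH) auto
  moreover have "W (d - Suc k) = W' (d - Suc k)"
    using Suc.prems by auto
  ultimately show ?case by simp
qed simp

context frobenius
begin

lemma q_pow_split: "q ^ Suc k = (q ^ Suc k - q ^ k) + q ^ k"
  using q_gt_1 by simp

lemma q_pow_diff_pos: "q ^ Suc k - q ^ k > 0"
  using q_gt_1 by simp

lemma power_q_split: "(x::'k) ^ q = x ^ (q - 1) * x"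
  using q_gt_1 by (metis Suc_diff_1 q_pos power_Suc2)

lemma lpoly_zero [simp]: "lpoly q d W k (0::'k) \<eta> = 0"
  by (induction k) auto

lemma lpoly_add: "lpoly q d W k (x + y) \<eta> = lpoly q d W k (x::'k) \<eta> + lpoly q d W k y \<eta>"
  by (induction k) (auto simp: frob1_add algebra_simps)

lemma lpoly_scale: "(a::'k) \<in> Fq q \<Longrightarrow> lpoly q d W k (a * x) \<eta> = a * lpoly q d W k x \<eta>"
  by (induction k) (auto simp: power_mult_distrib Fq_def algebra_simps)

lemma lpoly_diff: "lpoly q d W k (x - y) \<eta> = lpoly q d W k (x::'k) \<eta> - lpoly q d W k y \<eta>"
  using lpoly_add[of d W k x "- 1 * y"] lpoly_scale[of "- 1" d W k y] by (simp add: Fq_uminus)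

lemma lpoly_sum:
  "(\<And>l. l \<in> A \<Longrightarrow> a l \<in> Fq q) \<Longrightarrow>
    lpoly q d W k (\<Sum>l\<in>A. a l * x l) \<eta> = (\<Sum>l\<in>A. a l * lpoly q d W k (x l :: 'k) \<eta>)"
  by (induction A rule: infinite_finite_induct) (auto simp: lpoly_add lpoly_scale)

lemma lpoly_homogeneous:
  "lpoly q d W k (c * \<xi>) (c * \<eta>) = c ^ (q ^ k) * lpoly q d W k (\<xi>::'k) \<eta>"
proof (induction k)
  case (Suc k)
  have "c ^ (q ^ Suc k) = c ^ (q ^ Suc k - q ^ k) * c ^ (q ^ k)"
    using q_pow_split[of k] by (metis power_add)
  moreover have "(c ^ (q ^ k)) ^ q = c ^ (q ^ Suc k)"
    by (simp add: power_mult[symmetric] mult.commute)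
  ultimately show ?case
    unfolding lpoly.simps Suc.IH by (simp add: power_mult_distrib algebra_simps del: power_Suc)
qed simp

lemma lpoly_at_0: "lpoly q d W k (\<xi>::'k) 0 = \<xi> ^ (q ^ k)"
proof (induction k)
  case (Suc k)
  then show ?case
    using q_pow_diff_pos[of k] by (simp add: power_0_left power_mult[symmetric] mult.commute)
qed simp

text \<open>Each step of the recursion is the map \<open>H \<mapsto> H ^ q - D ^ (q - 1) H\<close>, whose zeros are the
  multiples of \<open>D\<close>.\<close>

lemma lpoly_Suc:
  "lpoly q d W (Suc k) \<xi> \<eta> = lpoly q d W k \<xi> \<eta> ^ q
     - lpoly q d W k (\<eta> * W (d - Suc k)) (\<eta>::'k) ^ (q - 1) * lpoly q d W k \<xi> \<eta>"
proof -
  have "lpoly q d W k (\<eta> * W (d - Suc k)) \<eta> = \<eta> ^ (q ^ k) * lpoly q d W k (W (d - Suc k)) 1"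
    using lpoly_homogeneous[of d W k \<eta> "W (d - Suc k)" 1] by simp
  moreover have "(\<eta> ^ (q ^ k)) ^ (q - 1) = \<eta> ^ (q ^ Suc k - q ^ k)"
    by (simp add: power_mult[symmetric] algebra_simps)
  ultimately show ?thesis
    by (simp add: power_mult_distrib del: power_Suc)
qed

lemma artin_schreier_zero:
  "(H::'k) ^ q - D ^ (q - 1) * H = 0 \<longleftrightarrow> (\<exists>a\<in>Fq q. H = a * D)"
proof
  assume eq: "H ^ q - D ^ (q - 1) * H = 0"
  show "\<exists>a\<in>Fq q. H = a * D"
  proof (cases "D = 0")
    case True
    then have "H = 0"
      using eq q_gt_1 by (auto simp: power_0_left)
    then show ?thesis by (intro bexI[of _ 0]) auto
  next
    case False
    have "H ^ q = D ^ (q - 1) * H"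
      using eq by simp
    then have "H ^ q * D = D ^ q * H"
      by (simp add: power_q_split[of D] algebra_simps)
    then have "(H / D) ^ q = H / D"
      using False by (simp add: power_divide frac_eq_eq)
    then show ?thesis
      using False by (intro bexI[of _ "H / D"]) (auto simp: Fq_def)
  qed
next
  assume "\<exists>a\<in>Fq q. H = a * D"
  then obtain a where "a ^ q = a" "H = a * D" by (auto simp: Fq_def)
  then show "H ^ q - D ^ (q - 1) * H = 0"
    using power_q_split[of D] by (simp add: power_mult_distrib)
qed

text \<open>The value \<open>H\<close> of the previous polynomial at \<open>\<xi>\<close> is a multiple \<open>c D\<close> of its value \<open>D\<close> at the new
  vector exactly if \<open>\<xi>\<close> minus \<open>c\<close> times that vector lies in the previous kernel.\<close>

lemma lpoly_kernel:
  assumes "k \<le> d"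
  shows "lpoly q d W k (\<xi>::'k) \<eta> = 0 \<longleftrightarrow>
    (\<exists>a. (\<forall>l. a l \<in> Fq q) \<and> \<xi> = \<eta> * (\<Sum>l\<in>{d - k..<d}. a l * W l))"
  using assms
proof (induction k arbitrary: \<xi>)
  case 0
  then show ?case by (auto intro: exI[of _ "\<lambda>_. 0"])
next
  case (Suc k)
  have split: "(\<Sum>l\<in>{d - Suc k..<d}. a l * W l) = a (d - Suc k) * W (d - Suc k) + (\<Sum>l\<in>{d - k..<d}. a l * W l)"
    for a :: "nat \<Rightarrow> 'k"
  proof -
    have "{d - Suc k..<d} = insert (d - Suc k) {d - k..<d}"
      using Suc.prems by auto
    then show ?thesis using Suc.prems by simp
  qed
  have "lpoly q d W (Suc k) \<xi> \<eta> = 0 \<longleftrightarrow>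
      (\<exists>c\<in>Fq q. lpoly q d W k (\<xi> - c * (\<eta> * W (d - Suc k))) \<eta> = 0)"
    unfolding lpoly_Suc artin_schreier_zero by (auto simp: lpoly_diff lpoly_scale)
  also have "\<dots> \<longleftrightarrow> (\<exists>c\<in>Fq q. \<exists>a. (\<forall>l. a l \<in> Fq q) \<and>
      \<xi> - c * (\<eta> * W (d - Suc k)) = \<eta> * (\<Sum>l\<in>{d - k..<d}. a l * W l))"
    using Suc by simp
  also have "\<dots> \<longleftrightarrow> (\<exists>a. (\<forall>l. a l \<in> Fq q) \<and> \<xi> = \<eta> * (\<Sum>l\<in>{d - Suc k..<d}. a l * W l))"
  proof
    assume "\<exists>c\<in>Fq q. \<exists>a. (\<forall>l. a l \<in> Fq q) \<and>
      \<xi> - c * (\<eta> * W (d - Suc k)) = \<eta> * (\<Sum>l\<in>{d - k..<d}. a l * W l)"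
    then obtain c a where ca: "c \<in> Fq q" "\<forall>l. a l \<in> Fq q"
      "\<xi> - c * (\<eta> * W (d - Suc k)) = \<eta> * (\<Sum>l\<in>{d - k..<d}. a l * W l)" by blast
    have "(\<Sum>l\<in>{d - k..<d}. (a(d - Suc k := c)) l * W l) = (\<Sum>l\<in>{d - k..<d}. a l * W l)"
      using Suc.prems by (intro sum.cong) auto
    moreover have "\<xi> = c * (\<eta> * W (d - Suc k)) + \<eta> * (\<Sum>l\<in>{d - k..<d}. a l * W l)"
      using ca(3) by (simp add: algebra_simps)
    ultimately show "\<exists>a. (\<forall>l. a l \<in> Fq q) \<and> \<xi> = \<eta> * (\<Sum>l\<in>{d - Suc k..<d}. a l * W l)"
      using ca(1,2) unfolding split
      by (intro exI[of _ "a(d - Suc k := c)"]) (simp add: algebra_simps)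
  next
    assume "\<exists>a. (\<forall>l. a l \<in> Fq q) \<and> \<xi> = \<eta> * (\<Sum>l\<in>{d - Suc k..<d}. a l * W l)"
    then obtain a where "\<forall>l. a l \<in> Fq q" "\<xi> = \<eta> * (\<Sum>l\<in>{d - Suc k..<d}. a l * W l)" by blast
    then show "\<exists>c\<in>Fq q. \<exists>a. (\<forall>l. a l \<in> Fq q) \<and>
      \<xi> - c * (\<eta> * W (d - Suc k)) = \<eta> * (\<Sum>l\<in>{d - k..<d}. a l * W l)"
      unfolding split by (intro bexI[of _ "a (d - Suc k)"] exI[of _ a]) (auto simp: algebra_simps)
  qed
  finally show ?case .
qed

text \<open>Each step of the recursion solves an equation of degree \<open>q\<close>, for every \<open>\<eta>\<close> including 0.\<close>

lemma lpoly_surjective: "\<exists>\<xi>::'k. lpoly q d W k \<xi> \<eta> = s"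
proof (induction k arbitrary: s)
  case (Suc k)
  define c where "c = lpoly q d W k (W (d - Suc k)) 1 ^ (q - 1) * \<eta> ^ (q ^ Suc k - q ^ k)"
  define P where "P = monom 1 q + (- monom c 1 - [:s:])"
  have "degree (monom c 1) < q" "degree [:s:] < q"
    using q_gt_1 by (auto intro: le_less_trans[OF degree_monom_le])
  then have "degree P = q"
    unfolding P_def using degree_add_eq_left[of "- monom c 1 - [:s:]" "monom 1 q"]
      degree_diff_less[of "- monom c 1" q "[:s:]"] by (simp add: degree_monom_eq)
  then obtain H where "poly P H = 0"
    using alg_closed_imp_poly_has_root[of P] q_gt_1 by auto
  then have H: "H ^ q - c * H = s"
    by (simp add: P_def poly_monom algebra_simps)
  obtain \<xi> where "lpoly q d W k \<xi> \<eta> = H"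
    using Suc.IH by blast
  then have "lpoly q d W (Suc k) \<xi> \<eta> = s"
    using H by (simp add: c_def)
  then show ?case by blast
qed simp

section \<open>The recursion in the definition of the map\<close>

text \<open>With \<open>\<theta> j = X (d - 1) / X (j - 1)\<close>, the value of the linear polynomial at \<open>X (j - 1)\<close>, divided
  by the power \<open>q ^ k\<close> of \<open>X (j - 1)\<close>, is the value at \<open>\<xi> = 1\<close>, \<open>\<eta> = \<theta> j\<close>.  In these terms the
  numerators of the recursion for \<open>a\<^sub>j\<^sub>k\<close> are the next polynomials up to a factor that does not depend
  on \<open>j\<close> and cancels in the quotient.\<close>

lemma a_elt_step:
  fixes y W \<theta> :: "nat \<Rightarrow> 'k"
  assumes \<theta>: "\<And>j. \<theta> j = (\<Prod>l=j..d - 1. y l)" and W: "W (d - Suc k) * \<theta> (d - k) = 1"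
    and j: "1 \<le> j" "j \<le> d - Suc k" and k: "Suc k \<le> d" "0 < d - Suc k"
    and a: "a = lpoly q d W k 1 (\<theta> j) / lpoly q d W k 1 (\<theta> (d - k))"
    and nz: "lpoly q d W k 1 (\<theta> (d - k)) \<noteq> 0"
  shows "a ^ q - (\<Prod>l=j..d - Suc k. y l) ^ (q ^ Suc k - q ^ k) * a =
     lpoly q d W (Suc k) 1 (\<theta> j) / lpoly q d W k 1 (\<theta> (d - k)) ^ q"
proof -
  define C H A P where "C = lpoly q d W k 1 (\<theta> (d - k))" and "H = lpoly q d W k 1 (\<theta> j)"
    and "A = lpoly q d W k (W (d - Suc k)) 1" and "P = (\<Prod>l=j..d - Suc k. y l)"
  have "P * \<theta> (d - k) = \<theta> j"
  proof (cases "k = 0")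
    case True
    then have "\<theta> (d - k) = 1"
      using k unfolding \<theta> by simp
    then show ?thesis
      using True by (simp add: P_def \<theta>)
  next
    case False
    have "{j..d - 1} = {j..d - Suc k} \<union> {d - k..d - 1}" "{j..d - Suc k} \<inter> {d - k..d - 1} = {}"
      using j k False by auto
    then show ?thesis
      unfolding P_def \<theta> by (simp add: prod.union_disjoint)
  qed
  then have P: "P = \<theta> j * W (d - Suc k)"
    using W by (metis mult.assoc mult.commute mult.right_neutral)
  define w where "w = W (d - Suc k)"
  have C: "w ^ (q ^ k) * C = A"
    unfolding C_def A_def w_def[symmetric]
    using lpoly_homogeneous[of d W k w 1 "\<theta> (d - k)"] W by (simp add: w_def)
  have "(q ^ Suc k - q ^ k) = q ^ k * (q - 1)"
    by (simp add: algebra_simps)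
  then have "w ^ (q ^ Suc k - q ^ k) * C ^ (q - 1) = A ^ (q - 1)"
    unfolding C[symmetric] by (simp add: power_mult power_mult_distrib del: power_Suc)
  then have P': "P ^ (q ^ Suc k - q ^ k) * C ^ (q - 1) = A ^ (q - 1) * \<theta> j ^ (q ^ Suc k - q ^ k)"
    unfolding P w_def[symmetric] power_mult_distrib by (simp add: algebra_simps del: power_Suc)
  have Cq: "C ^ q = C ^ (q - 1) * C"
    by (rule power_q_split)
  have nz': "C \<noteq> 0" using nz by (simp add: C_def)
  have "(P ^ (q ^ Suc k - q ^ k) * (H / C)) * C ^ q = P ^ (q ^ Suc k - q ^ k) * C ^ (q - 1) * H"
    using nz' unfolding Cq by (simp del: power_Suc)
  then have "((H / C) ^ q - P ^ (q ^ Suc k - q ^ k) * (H / C)) * C ^ q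
      = H ^ q - P ^ (q ^ Suc k - q ^ k) * C ^ (q - 1) * H"
    using nz' by (simp add: left_diff_distrib power_divide del: power_Suc)
  also have "\<dots> = lpoly q d W (Suc k) 1 (\<theta> j)"
    unfolding P' by (simp add: H_def A_def)
  finally show ?thesis
    unfolding a C_def[symmetric] H_def[symmetric] P_def[symmetric] using nz'
    by (simp add: eq_divide_eq)
qed

lemma a_elt_value:
  fixes y W \<theta> :: "nat \<Rightarrow> 'k"
  assumes \<theta>: "\<And>j. \<theta> j = (\<Prod>l=j..d - 1. y l)"
    and W: "\<And>l. d - m \<le> l \<Longrightarrow> l < d \<Longrightarrow> W l * \<theta> (Suc l) = 1" and m: "m < d"
    and nz: "\<And>k. k \<le> m \<Longrightarrow> lpoly q d W k 1 (\<theta> (d - k)) \<noteq> 0"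
  shows "k \<le> m \<Longrightarrow> 1 \<le> j \<Longrightarrow> j \<le> d - k \<Longrightarrow> takes_value (d - 1) (a_elt q d ratvar j k) y
    (lpoly q d W k 1 (\<theta> j) / lpoly q d W k 1 (\<theta> (d - k)))"
proof (induction k arbitrary: j)
  case 0
  then show ?case
    by (simp add: takes_value_one)
next
  case (Suc k)
  define D where "D = lpoly q d W k 1 (\<theta> (d - k))"
  have D: "D \<noteq> 0"
    using nz[of k] Suc.prems by (simp add: D_def)
  have Wk: "W (d - Suc k) * \<theta> (d - k) = 1"
    using W[of "d - Suc k"] Suc.prems m by (simp add: Suc_diff_Suc)
  have num: "takes_value (d - 1)
      (a_elt q d ratvar j k ^ q - (\<Prod>l=j..d - Suc k. ratvar l) ^ (q ^ Suc k - q ^ k) * a_elt q d ratvar j k) y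
      (lpoly q d W (Suc k) 1 (\<theta> j) / D ^ q)" if j: "1 \<le> j" "j \<le> d - Suc k" for j
  proof -
    have "takes_value (d - 1) (a_elt q d ratvar j k) y (lpoly q d W k 1 (\<theta> j) / D)"
      unfolding D_def by (rule Suc.IH) (use j Suc.prems in auto)
    moreover have "takes_value (d - 1) (\<Prod>l=j..d - Suc k. ratvar l) y (\<Prod>l=j..d - Suc k. y l)"
      by (rule takes_value_prod, rule takes_value_ratvar) (use j in auto)
    ultimately have "takes_value (d - 1)
      (a_elt q d ratvar j k ^ q - (\<Prod>l=j..d - Suc k. ratvar l) ^ (q ^ Suc k - q ^ k) * a_elt q d ratvar j k) y
      ((lpoly q d W k 1 (\<theta> j) / D) ^ q -
        (\<Prod>l=j..d - Suc k. y l) ^ (q ^ Suc k - q ^ k) * (lpoly q d W k 1 (\<theta> j) / D))"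
      by (intro takes_value_diff takes_value_mult takes_value_power)
    also have "(lpoly q d W k 1 (\<theta> j) / D) ^ q -
        (\<Prod>l=j..d - Suc k. y l) ^ (q ^ Suc k - q ^ k) * (lpoly q d W k 1 (\<theta> j) / D)
      = lpoly q d W (Suc k) 1 (\<theta> j) / D ^ q"
      unfolding D_def
      by (rule a_elt_step[where y = y and W = W and \<theta> = \<theta>], rule \<theta>, rule Wk)
        (use j Suc.prems m D in \<open>auto simp: D_def\<close>)
    finally show ?thesis .
  qed
  have nz': "lpoly q d W (Suc k) 1 (\<theta> (d - Suc k)) \<noteq> 0"
    using nz[OF Suc.prems(1)] .
  have "takes_value (d - 1) ((a_elt q d ratvar j k ^ q
        - (\<Prod>l=j..d - Suc k. ratvar l) ^ (q ^ Suc k - q ^ k) * a_elt q d ratvar j k)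
      / (a_elt q d ratvar (d - Suc k) k ^ q
        - (\<Prod>l=d - Suc k..d - Suc k. ratvar l) ^ (q ^ Suc k - q ^ k) * a_elt q d ratvar (d - Suc k) k)) y
      ((lpoly q d W (Suc k) 1 (\<theta> j) / D ^ q) / (lpoly q d W (Suc k) 1 (\<theta> (d - Suc k)) / D ^ q))"
    by (intro takes_value_divide num) (use Suc.prems m D nz' in auto)
  also have "(lpoly q d W (Suc k) 1 (\<theta> j) / D ^ q) / (lpoly q d W (Suc k) 1 (\<theta> (d - Suc k)) / D ^ q)
      = lpoly q d W (Suc k) 1 (\<theta> j) / lpoly q d W (Suc k) 1 (\<theta> (d - Suc k))"
    using D by simp
  finally show ?case
    by (cases k) (simp_all add: Let_def)
qed

end

section \<open>Coordinates adapted to the parabolic subgroup\<close>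

lemma prod_telescope:
  fixes f :: "nat \<Rightarrow> 'a::field"
  assumes "a \<le> b" "\<And>l. l \<in> {a..b} \<Longrightarrow> f l \<noteq> 0"
  shows "(\<Prod>l=a..<b. f (Suc l) / f l) = f b / f a"
  using assms
proof (induction b)
  case (Suc b)
  show ?case
  proof (cases "a = Suc b")
    case False
    then have "a \<le> b" using Suc.prems by simp
    then show ?thesis
      using Suc.IH Suc.prems by simp
  qed (use Suc.prems in simp)
qed simp

text \<open>With homogeneous coordinates \<open>X 0, \<dots>, X (d - 1)\<close>, the coordinates of a point \<open>x\<close> below are
  \<open>x j = X (j - 1) / X (i - 1)\<close> for \<open>j < i\<close>, \<open>x i = X (d - 1) / X (i - 1)\<close> and
  \<open>x j = X (j - 1) / X (d - 1)\<close> for \<open>j > i\<close>.  The boundary is the locus \<open>x i = 0\<close>.  The following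
  two functions supply the missing ratios that are equal to 1.\<close>

definition xi_coord :: "nat \<Rightarrow> (nat \<Rightarrow> 'k::field) \<Rightarrow> nat \<Rightarrow> 'k"
  where "xi_coord i x j = (if j = i then 1 else x j)"

definition w_coord :: "nat \<Rightarrow> (nat \<Rightarrow> 'k::field) \<Rightarrow> nat \<Rightarrow> 'k"
  where "w_coord d x l = (if Suc l = d then 1 else x (Suc l))"

locale rho_setup = frobenius q e K for q e and K :: "'k::alg_closed_field itself" +
  fixes d i :: nat
  assumes d_ge_2: "d \<ge> 2" and i_ge_1: "1 \<le> i" and i_le: "i \<le> d - 1"
begin

text \<open>\<open>lp x\<close> is the polynomial whose zeros (for \<open>\<eta> = 1\<close>) are all combinations of
  \<open>W x i, \<dots>, W x (d - 1)\<close>; for independent \<open>W x\<close> there are \<open>N\<close> of them.\<close>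

abbreviation "m \<equiv> d - i"
abbreviation "N \<equiv> q ^ m"
abbreviation (input) "W x \<equiv> w_coord d (x :: nat \<Rightarrow> 'k)"
abbreviation (input) "\<Xi> x \<equiv> xi_coord i (x :: nat \<Rightarrow> 'k)"
abbreviation (input) "lp x \<equiv> lpoly q d (w_coord d (x :: nat \<Rightarrow> 'k)) m"

text \<open>Off the boundary, the next two conditions together say that \<open>X 0, \<dots>, X (d - 1)\<close> are linearly
  independent over the finite field.  On the boundary the right-hand side in the second one
  vanishes, and they are the conditions for the two factors of \<open>C_I\<close>.\<close>

definition w_independent :: "(nat \<Rightarrow> 'k) \<Rightarrow> bool"
  where "w_independent x \<longleftrightarrow>
    (\<forall>a. (\<forall>l. a l \<in> Fq q) \<longrightarrow> (\<Sum>l=i..<d. a l * W x l) = 0 \<longrightarrow> (\<forall>l\<in>{i..<d}. a l = 0))"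

definition xi_independent :: "(nat \<Rightarrow> 'k) \<Rightarrow> bool"
  where "xi_independent x \<longleftrightarrow>
    (\<forall>a b. (\<forall>l. a l \<in> Fq q) \<longrightarrow> (\<forall>l. b l \<in> Fq q) \<longrightarrow>
      (\<Sum>j=1..i. a j * \<Xi> x j) = x i * (\<Sum>l=i..<d. b l * W x l) \<longrightarrow> (\<forall>j\<in>{1..i}. a j = 0))"

definition source :: "(nat \<Rightarrow> 'k) set"
  where "source = {x \<in> extensional {1..d - 1}. w_independent x \<and> xi_independent x}"

definition to_y :: "(nat \<Rightarrow> 'k) \<Rightarrow> nat \<Rightarrow> 'k"
  where "to_y x = (\<lambda>k\<in>{1..d - 1}. if k < i then \<Xi> x (Suc k) / \<Xi> x k
     else if k = i then x i * W x i else W x k / W x (k - 1))"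

definition from_y :: "(nat \<Rightarrow> 'k) \<Rightarrow> nat \<Rightarrow> 'k"
  where "from_y y = (\<lambda>j\<in>{1..d - 1}. if j < i then 1 / (\<Prod>l=j..i - 1. y l)
     else if j = i then (\<Prod>l=i..d - 1. y l) else 1 / (\<Prod>l=j..d - 1. y l))"

text \<open>The factor \<open>kappa x\<close> is a unit coming from the normalisation of \<open>v\<^sub>d\<^sub>-\<^sub>i\<close>; it depends on the
  last coordinates only.\<close>

definition kappa :: "(nat \<Rightarrow> 'k) \<Rightarrow> 'k"
  where "kappa x = lpoly q d (W x) (m - 1) (W x i) 1 ^ q"

text \<open>The map of the theorem in adapted coordinates.  The denominators do not vanish on \<open>source\<close>
  (\<open>lp_1_nonzero\<close>), so that the same formula serves on the boundary.\<close>

definition rmap :: "(nat \<Rightarrow> 'k) \<Rightarrow> nat \<Rightarrow> 'k"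
  where "rmap x = (\<lambda>j\<in>{1..d - 1}. if j < i then lp x (x j) (x i) / lp x 1 (x i)
     else if j = i then kappa x * x i ^ N / lp x 1 (x i) else x j)"

lemma i_bounds: "1 \<le> i" "i < d" "d - m = i" "m \<ge> 1" "m \<le> d" "m < d" "d - Suc (m - 1) = i" "Suc (m - 1) = m"
  "d - (m - 1) = Suc i" "i \<in> {1..d - 1}" "i \<le> d" "0 < i"
  using d_ge_2 i_ge_1 i_le by auto

lemma w_independentD:
  assumes "w_independent x" "\<And>l. a l \<in> Fq q" "(\<Sum>l=i..<d. a l * W x l) = 0" "l \<in> {i..<d}"
  shows "a l = 0"
  using assms unfolding w_independent_def by blast

lemma xi_independentD:
  assumes "xi_independent x" "\<And>l. a l \<in> Fq q" "\<And>l. b l \<in> Fq q"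
    "(\<Sum>j=1..i. a j * \<Xi> x j) = x i * (\<Sum>l=i..<d. b l * W x l)" "j \<in> {1..i}"
  shows "a j = 0"
  using assms unfolding xi_independent_def by blast

lemma w_nonzero:
  assumes "w_independent x" "l \<in> {i..<d}"
  shows "W x l \<noteq> 0"
proof
  assume "W x l = 0"
  then have "(\<Sum>k=i..<d. (if k = l then 1 else 0) * W x k) = 0"
    by (intro sum.neutral) auto
  note z = this
  have "(if l = l then 1 else 0) = (0::'k)"
    by (rule w_independentD[OF assms(1) _ z assms(2)]) simp
  then show False by simp
qed

lemma xi_nonzero:
  assumes "xi_independent x" "j \<in> {1..i}"
  shows "\<Xi> x j \<noteq> 0"
proof
  assume "\<Xi> x j = 0"
  then have "(\<Sum>k=1..i. (if k = j then 1 else 0) * \<Xi> x k) = 0"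
    by (intro sum.neutral) auto
  then have "(\<Sum>k=1..i. (if k = j then 1 else 0) * \<Xi> x k) = x i * (\<Sum>l=i..<d. 0 * W x l)"
    by simp
  note z = this
  have "(if j = j then 1 else 0) = (0::'k)"
    by (rule xi_independentD[OF assms(1) _ _ z assms(2)]) simp_all
  then show False by simp
qed

lemma lp_kernel:
  "lp x \<xi> \<eta> = 0 \<longleftrightarrow> (\<exists>a. (\<forall>l. a l \<in> Fq q) \<and> \<xi> = \<eta> * (\<Sum>l=i..<d. a l * W x l))"
  using lpoly_kernel[of m d "W x" \<xi> \<eta>] i_bounds by simp

text \<open>A zero would express \<open>\<Xi> x i = 1\<close> as \<open>x i\<close> times a combination of the \<open>W x l\<close>, which
  \<open>xi_independent\<close> excludes.\<close>

lemma lp_1_nonzero: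
  assumes "xi_independent x"
  shows "lp x 1 (x i) \<noteq> 0"
proof
  assume "lp x 1 (x i) = 0"
  then obtain b where b: "\<forall>l. b l \<in> Fq q" "1 = x i * (\<Sum>l=i..<d. b l * W x l)"
    unfolding lp_kernel by auto
  have "(\<Sum>j=1..i. (if j = i then 1 else 0) * \<Xi> x j) = 1"
    using i_ge_1 by (simp add: if_distrib[of "\<lambda>c. c * _"] sum.delta xi_coord_def cong: if_cong)
  then have "(\<Sum>j=1..i. (if j = i then 1 else 0) * \<Xi> x j) = x i * (\<Sum>l=i..<d. b l * W x l)"
    using b(2) by simp
  note z = this
  have "(if i = i then 1 else 0) = (0::'k)"
    by (rule xi_independentD[OF assms _ _ z]) (use i_ge_1 b(1) in simp_all)
  then show False by simp
qed

lemma lpoly_w_nonzero: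
  assumes w: "w_independent x" and k: "k < m"
  shows "lpoly q d (W x) k (W x (d - Suc k)) 1 \<noteq> 0"
proof
  assume "lpoly q d (W x) k (W x (d - Suc k)) 1 = 0"
  then obtain a where a: "\<forall>l. a l \<in> Fq q" "W x (d - Suc k) = (\<Sum>l=d - k..<d. a l * W x l)"
    using lpoly_kernel[of k d "W x" "W x (d - Suc k)" 1] k by auto
  define b where "b = (\<lambda>l. if l = d - Suc k then 1 else if l \<in> {d - k..<d} then - a l else 0)"
  have "{i..<d} = insert (d - Suc k) ({i..<d - Suc k} \<union> {d - k..<d})"
    using k i_bounds by auto
  moreover have "(\<Sum>l\<in>{i..<d - Suc k}. b l * W x l) = 0"
    unfolding b_def by (intro sum.neutral) auto
  moreover have "(\<Sum>l\<in>{d - k..<d}. b l * W x l) = - (\<Sum>l=d - k..<d. a l * W x l)"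
    unfolding b_def sum_negf[symmetric] using k by (intro sum.cong) auto
  ultimately have "(\<Sum>l=i..<d. b l * W x l) = 0"
    using k a(2) by (subst \<open>{i..<d} = _\<close>) (auto simp: sum.union_disjoint b_def)
  moreover have "b l \<in> Fq q" for l
    using a(1) by (auto simp: b_def Fq_uminus)
  ultimately have "b (d - Suc k) = 0"
    using w_independentD[OF w, of b "d - Suc k"] k i_bounds by simp
  then show False by (simp add: b_def)
qed

lemma kappa_nonzero: "w_independent x \<Longrightarrow> kappa x \<noteq> 0"
  using lpoly_w_nonzero[of x "m - 1"] i_bounds by (simp add: kappa_def)

lemma source_facts:
  assumes "x \<in> source"
  shows "w_independent x" "xi_independent x" "x \<in> extensional {1..d - 1}"
  using assms by (auto simp: source_def)

lemma theta_w:
  assumes "x \<in> source" "j \<in> {Suc i..d}"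
  shows "(\<Prod>l=j..d - 1. to_y x l) = 1 / W x (j - 1)"
proof -
  have "(\<Prod>l=j..d - 1. to_y x l) = (\<Prod>l=j - 1..<d - 1. to_y x (Suc l))"
    using assms i_bounds by (subst prod.shift_bounds_Suc_ivl[symmetric]) (simp add: atLeastLessThanSuc_atLeastAtMost[symmetric])
  also have "\<dots> = (\<Prod>l=j - 1..<d - 1. W x (Suc l) / W x l)"
    using assms i_bounds by (intro prod.cong) (auto simp: to_y_def)
  also have "\<dots> = W x (d - 1) / W x (j - 1)"
    by (intro prod_telescope w_nonzero[OF source_facts(1)[OF assms(1)]]) (use assms(2) i_bounds in auto)
  finally show ?thesis
    using d_ge_2 by (simp add: w_coord_def)
qed

lemma prod_xi:
  assumes "x \<in> source" "j \<in> {1..i}"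
  shows "(\<Prod>l=j..<i. to_y x l) = 1 / \<Xi> x j"
proof -
  have "(\<Prod>l=j..<i. to_y x l) = (\<Prod>l=j..<i. \<Xi> x (Suc l) / \<Xi> x l)"
    using assms i_bounds by (intro prod.cong) (auto simp: to_y_def)
  also have "\<dots> = \<Xi> x i / \<Xi> x j"
    using assms xi_nonzero[OF source_facts(2)[OF assms(1)]] by (intro prod_telescope) auto
  finally show ?thesis
    by (simp add: xi_coord_def)
qed

lemma theta_xi:
  assumes "x \<in> source" "j \<in> {1..i}"
  shows "(\<Prod>l=j..d - 1. to_y x l) = x i / \<Xi> x j"
proof -
  have "{j..d - 1} = {j..<i} \<union> insert i {Suc i..d - 1}" "{j..<i} \<inter> insert i {Suc i..d - 1} = {}"
    using assms(2) i_bounds by auto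
  then have "(\<Prod>l=j..d - 1. to_y x l) = (\<Prod>l=j..<i. to_y x l) * (to_y x i * (\<Prod>l=Suc i..d - 1. to_y x l))"
    by (simp add: prod.union_disjoint)
  also have "\<dots> = x i / \<Xi> x j"
    using assms i_bounds theta_w[OF assms(1), of "Suc i"] prod_xi[OF assms]
      w_nonzero[OF source_facts(1)[OF assms(1)], of i] by (simp add: to_y_def)
  finally show ?thesis .
qed

lemma from_to_y:
  assumes "x \<in> source"
  shows "from_y (to_y x) = x"
proof (rule extensionalityI[of _ "{1..d - 1}"])
  fix j assume j: "j \<in> {1..d - 1}"
  have *: "{j..i - 1} = {j..<i}" using i_ge_1 by auto
  consider "j < i" | "j = i" | "j > i" by linarith
  then show "from_y (to_y x) j = x j"
  proof cases
    case 1
    then show ?thesis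
      using j prod_xi[OF assms, of j] * by (simp add: from_y_def xi_coord_def)
  next
    case 2
    then show ?thesis
      using j theta_xi[OF assms, of j] by (simp add: from_y_def xi_coord_def)
  next
    case 3
    then show ?thesis
      using j theta_w[OF assms, of j] by (auto simp: from_y_def w_coord_def)
  qed
qed (use source_facts(3)[OF assms] in \<open>simp_all add: from_y_def\<close>)

lemma lp_nonzero_theta:
  assumes x: "x \<in> source" and k: "k \<le> m"
  shows "lpoly q d (W x) k 1 (\<Prod>l=d - k..d - 1. to_y x l) \<noteq> 0"
proof (cases "k = m")
  case True
  then show ?thesis
    using i_bounds theta_xi[OF x, of i] lp_1_nonzero[OF source_facts(2)[OF x]] by (simp add: xi_coord_def)
next
  case False
  with k have k: "k < m" by simp
  show ?thesis
  proof (cases "k = 0")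
    case False
    define w where "w = W x (d - Suc k)"
    have w: "w \<noteq> 0"
      unfolding w_def using k i_bounds by (intro w_nonzero source_facts[OF x]) auto
    have "(\<Prod>l=d - k..d - 1. to_y x l) = 1 / w"
      using theta_w[OF x, of "d - k"] k i_bounds False by (simp add: w_def)
    moreover have "lpoly q d (W x) k w 1 \<noteq> 0"
      unfolding w_def by (rule lpoly_w_nonzero[OF source_facts(1)[OF x] k])
    moreover have "lpoly q d (W x) k (w * 1) (w * (1 / w)) = w ^ (q ^ k) * lpoly q d (W x) k 1 (1 / w)"
      by (rule lpoly_homogeneous)
    ultimately show ?thesis
      using w by auto
  qed simp
qed

text \<open>The components of the map in the adapted coordinates: the first ones are values of the linear
  polynomial with kernel spanned by \<open>X i, \<dots>, X (d - 1)\<close>.\<close>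

lemma rho_component_value:
  assumes x: "x \<in> source" and j: "j \<in> {1..d - 1}"
  shows "takes_value (d - 1) (rho_component q d i j) (to_y x) (rmap x j)"
proof -
  define \<theta> where "\<theta> = (\<lambda>j. \<Prod>l=j..d - 1. to_y x l)"
  have \<theta>i: "\<theta> i = x i"
    using theta_xi[OF x, of i] i_bounds by (simp add: \<theta>_def xi_coord_def)
  have W\<theta>: "W x l * \<theta> (Suc l) = 1" if "l \<in> {i..<d}" for l
    using theta_w[OF x, of "Suc l"] that w_nonzero[OF source_facts(1)[OF x], of l] by (simp add: \<theta>_def)
  have aval: "takes_value (d - 1) (a_elt q d ratvar j k) (to_y x)
      (lpoly q d (W x) k 1 (\<theta> j) / lpoly q d (W x) k 1 (\<theta> (d - k)))"
    if "k \<le> m" "1 \<le> j" "j \<le> d - k" for j k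
    by (rule a_elt_value[where m = m])
      (use that i_bounds W\<theta> lp_nonzero_theta[OF x] in \<open>auto simp: \<theta>_def\<close>)
  consider "j < i" | "j = i" | "j > i" by linarith
  then show ?thesis
  proof cases
    case 1
    have *: "{j..i - 1} = {j..<i}" using i_ge_1 by auto
    have P: "(\<Prod>l=j..i - 1. to_y x l) = 1 / x j" "x j \<noteq> 0"
      using prod_xi[OF x, of j] xi_nonzero[OF source_facts(2)[OF x], of j] 1 j * by (auto simp: xi_coord_def)
    have \<theta>j: "\<theta> j = x i / x j"
      using theta_xi[OF x, of j] 1 j by (simp add: \<theta>_def xi_coord_def)
    have "takes_value (d - 1) (a_elt q d ratvar j m / (\<Prod>l=j..i - 1. ratvar l) ^ N) (to_y x)
      ((lp x 1 (\<theta> j) / lp x 1 (\<theta> (d - m))) / (\<Prod>l=j..i - 1. to_y x l) ^ N)"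
      using 1 j i_bounds P
      by (intro takes_value_divide takes_value_power takes_value_prod takes_value_ratvar aval) auto
    also have "(lp x 1 (\<theta> j) / lp x 1 (\<theta> (d - m))) / (\<Prod>l=j..i - 1. to_y x l) ^ N
        = x j ^ N * lp x 1 (\<theta> j) / lp x 1 (x i)"
      using P i_bounds \<theta>i by (simp add: power_divide)
    also have "x j ^ N * lp x 1 (\<theta> j) = lp x (x j) (x i)"
      using lpoly_homogeneous[of d "W x" m "x j" 1 "\<theta> j"] \<theta>j P by simp
    finally show ?thesis
      using 1 j by (simp add: rho_component_def rmap_def)
  next
    case 2
    define C where "C = lpoly q d (W x) (m - 1) 1 (\<theta> (Suc i))"
    have Wi: "W x i * \<theta> (Suc i) = 1"
      using W\<theta> i_bounds by simp
    have C: "C \<noteq> 0"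
      using lp_nonzero_theta[OF x, of "m - 1"] i_bounds by (simp add: C_def \<theta>_def)
    have a: "takes_value (d - 1) (a_elt q d ratvar i (m - 1)) (to_y x)
        (lpoly q d (W x) (m - 1) 1 (\<theta> i) / C)"
      using aval[of "m - 1" i] i_bounds by (simp add: C_def)
    have expo: "d - 1 - i = m - 1" by simp
    have single: "(\<Prod>l=i..d - Suc (m - 1). to_y x l) = to_y x i"
      by (simp only: i_bounds(7)) simp
    have yi: "to_y x i = x i * W x i"
      using i_bounds by (simp add: to_y_def)
    have num_gen: "takes_value (d - 1) (to_num) (to_y x) z" if "to_num = a_elt q d ratvar i (m - 1) ^ q
       - ratvar i ^ (q ^ Suc (m - 1) - q ^ (m - 1)) * a_elt q d ratvar i (m - 1)"
       "z = lp x 1 (x i) / C ^ q" for to_num z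
    proof -
      have "takes_value (d - 1) to_num (to_y x) ((lpoly q d (W x) (m - 1) 1 (\<theta> i) / C) ^ q
       - to_y x i ^ (q ^ Suc (m - 1) - q ^ (m - 1)) * (lpoly q d (W x) (m - 1) 1 (\<theta> i) / C))"
        unfolding that(1) using i_bounds a
        by (intro takes_value_diff takes_value_mult takes_value_power takes_value_ratvar) auto
      also have "(lpoly q d (W x) (m - 1) 1 (\<theta> i) / C) ^ q
         - to_y x i ^ (q ^ Suc (m - 1) - q ^ (m - 1)) * (lpoly q d (W x) (m - 1) 1 (\<theta> i) / C)
         = lpoly q d (W x) (Suc (m - 1)) 1 (\<theta> i) / lpoly q d (W x) (m - 1) 1 (\<theta> (d - (m - 1))) ^ q"
        unfolding C_def single[symmetric]
      proof (rule a_elt_step)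
        show "\<theta> j = (\<Prod>l=j..d - 1. to_y x l)" for j
          by (simp add: \<theta>_def)
        show "W x (d - Suc (m - 1)) * \<theta> (d - (m - 1)) = 1"
          using Wi by (simp only: i_bounds(7,9))
        show "lpoly q d (W x) (m - 1) 1 (\<theta> i) / lpoly q d (W x) (m - 1) 1 (\<theta> (Suc i)) =
            lpoly q d (W x) (m - 1) 1 (\<theta> i) / lpoly q d (W x) (m - 1) 1 (\<theta> (d - (m - 1)))"
          by (simp only: i_bounds(9))
        show "lpoly q d (W x) (m - 1) 1 (\<theta> (d - (m - 1))) \<noteq> 0"
          using C unfolding C_def by (simp only: i_bounds(9) not_False_eq_True)
      qed (use i_ge_1 i_le d_ge_2 in auto)
      also have "\<dots> = z"
        unfolding i_bounds(8,9) C_def[symmetric] \<theta>i that(2) ..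
      finally show ?thesis .
    qed
    have num: "takes_value (d - 1) (a_elt q d ratvar i (d - 1 - i) ^ q
       - ratvar i ^ (q ^ (d - i) - q ^ (d - 1 - i)) * a_elt q d ratvar i (d - 1 - i)) (to_y x)
         (lp x 1 (x i) / C ^ q)"
      unfolding expo by (rule num_gen) (simp_all only: i_bounds(8))
    have "takes_value (d - 1) (ratvar i ^ N / (a_elt q d ratvar i (d - 1 - i) ^ q
       - ratvar i ^ (q ^ (d - i) - q ^ (d - 1 - i)) * a_elt q d ratvar i (d - 1 - i))) (to_y x)
         (to_y x i ^ N / (lp x 1 (x i) / C ^ q))"
    proof (rule takes_value_divide[OF takes_value_power[OF takes_value_ratvar[OF i_bounds(10)]] num])
      show "lp x 1 (x i) / C ^ q \<noteq> 0"
        using C lp_1_nonzero[OF source_facts(2)[OF x]] by simp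
    qed
    also have "to_y x i ^ N / (lp x 1 (x i) / C ^ q) = (W x i ^ N * C ^ q) * x i ^ N / lp x 1 (x i)"
      unfolding yi by (simp add: power_mult_distrib)
    also have "W x i ^ N * C ^ q = kappa x"
    proof -
      have "W x i ^ (q ^ (m - 1)) * C = lpoly q d (W x) (m - 1) (W x i) 1"
        unfolding C_def using lpoly_homogeneous[of d "W x" "m - 1" "W x i" 1 "\<theta> (Suc i)"] Wi by simp
      then have "kappa x = (W x i ^ (q ^ (m - 1))) ^ q * C ^ q"
        unfolding kappa_def by (metis power_mult_distrib)
      moreover have "N = q ^ (m - 1) * q"
        using power_Suc2[of q "m - 1"] unfolding i_bounds(8) .
      ultimately show ?thesis
        by (simp add: power_mult)
    qed
    finally show ?thesis
      using 2 j by (simp add: rho_component_def rmap_def v_elt_def)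
  next
    case 3
    have \<theta>j: "\<theta> j = 1 / x j"
      using theta_w[OF x, of j] 3 j by (auto simp: \<theta>_def w_coord_def)
    have "j - 1 \<in> {i..<d}" "Suc (j - 1) = j" "j \<noteq> d"
      using 3 j by auto
    then have "x j \<noteq> 0"
      using w_nonzero[OF source_facts(1)[OF x], of "j - 1"] unfolding w_coord_def by metis
    have "takes_value (d - 1) (1 / (\<Prod>l=j..d - 1. ratvar l)) (to_y x) (1 / (\<Prod>l=j..d - 1. to_y x l))"
      using \<theta>j \<open>x j \<noteq> 0\<close> j unfolding \<theta>_def
      by (intro takes_value_divide takes_value_one takes_value_prod takes_value_ratvar) auto
    also have "1 / (\<Prod>l=j..d - 1. to_y x l) = x j"
      using \<theta>j by (simp add: \<theta>_def)
    finally show ?thesis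
      using 3 j by (simp add: rho_component_def rmap_def)
  qed
qed

section \<open>The map on points\<close>

lemma w_coord_cong:
  assumes "\<And>j. j \<in> {Suc i..d - 1} \<Longrightarrow> x j = x' j" "l \<in> {i..<d}"
  shows "W x l = W x' l"
  using assms by (auto simp: w_coord_def)

lemma lp_cong:
  assumes "\<And>j. j \<in> {Suc i..d - 1} \<Longrightarrow> x j = x' j"
  shows "lp x \<xi> \<eta> = lp x' \<xi> \<eta>" "kappa x = kappa x'" "w_independent x \<longleftrightarrow> w_independent x'"
proof -
  have W: "W x l = W x' l" if "l \<in> {i..<d}" for l
    using assms that by (rule w_coord_cong)
  show "lp x \<xi> \<eta> = lp x' \<xi> \<eta>"
    by (rule lpoly_cong) (use W i_bounds in auto)
  have "lpoly q d (W x) (m - 1) \<xi> 1 = lpoly q d (W x') (m - 1) \<xi> 1" for \<xi>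
    by (rule lpoly_cong) (use W i_bounds in auto)
  then show "kappa x = kappa x'"
    using W[of i] i_bounds by (simp add: kappa_def)
  have "(\<Sum>l=i..<d. a l * W x l) = (\<Sum>l=i..<d. a l * W x' l)" for a
    by (intro sum.cong) (use W in auto)
  then show "w_independent x \<longleftrightarrow> w_independent x'"
    by (simp add: w_independent_def)
qed

definition xi_off :: "(nat \<Rightarrow> 'k) \<Rightarrow> bool"
  where "xi_off z \<longleftrightarrow>
    (\<forall>a. (\<forall>l. a l \<in> Fq q) \<longrightarrow> (\<Sum>j=1..i. a j * \<Xi> z j) = 0 \<longrightarrow> (\<forall>j\<in>{1..i}. a j = 0))"

lemma off_hyperplanes_xi:
  "off_hyperplanes q i (\<lambda>j. if j = i - 1 then 1 else z (j + 1)) \<longleftrightarrow> xi_off z"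
proof -
  have eq: "(\<Sum>j<i. a j * (if j = i - 1 then 1 else z (j + 1))) = (\<Sum>j=1..i. b j * \<Xi> z j)"
    if "\<And>j. j < i \<Longrightarrow> a j = b (Suc j)" for a b
    unfolding One_nat_def sum.atLeast1_atMost_eq
    by (intro sum.cong) (use that i_ge_1 in \<open>auto simp: xi_coord_def\<close>)
  show ?thesis
  proof
    assume off: "off_hyperplanes q i (\<lambda>j. if j = i - 1 then 1 else z (j + 1))"
    show "xi_off z"
      unfolding xi_off_def
    proof (intro allI impI ballI, rule ccontr)
      fix a j
      assume a: "\<forall>l. a l \<in> Fq q" "(\<Sum>j=1..i. a j * \<Xi> z j) = 0" "j \<in> {1..i}" "a j \<noteq> 0"
      then have "\<exists>l<i. a (Suc l) \<noteq> 0"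
        by (intro exI[of _ "j - 1"]) auto
      then show False
        using off eq[of "\<lambda>l. a (Suc l)" a] a(1,2) unfolding off_hyperplanes_def by auto
    qed
  next
    assume xi: "xi_off z"
    show "off_hyperplanes q i (\<lambda>j. if j = i - 1 then 1 else z (j + 1))"
      unfolding off_hyperplanes_def
    proof (intro allI impI notI)
      fix a
      assume a: "\<forall>j<i. a j \<in> Fq q" "\<exists>j<i. a j \<noteq> 0"
        "(\<Sum>j<i. a j * (if j = i - 1 then 1 else z (j + 1))) = 0"
      define b where "b = (\<lambda>l. if l \<in> {1..i} then a (l - 1) else 0)"
      have "\<forall>l. b l \<in> Fq q" "(\<Sum>j=1..i. b j * \<Xi> z j) = 0"
        using a eq[of a b] by (auto simp: b_def)
      then have "\<forall>j\<in>{1..i}. b j = 0"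
        using xi unfolding xi_off_def by blast
      then have "b (Suc j) = 0" if "j < i" for j
        using that by auto
      then have "\<forall>j<i. a j = 0"
        by (auto simp: b_def)
      then show False using a(2) by auto
    qed
  qed
qed

lemma off_hyperplanes_w:
  "off_hyperplanes q (d - i) (\<lambda>j. if j = d - i - 1 then 1 else z (i + 1 + j)) \<longleftrightarrow> w_independent z"
proof -
  have eq: "(\<Sum>j<d - i. a j * (if j = d - i - 1 then 1 else z (i + 1 + j))) = (\<Sum>l=i..<d. b l * W z l)"
    if "\<And>j. j < d - i \<Longrightarrow> a j = b (i + j)" for a b
    unfolding sum.atLeastLessThan_shift_0[of _ i] lessThan_atLeast0
    by (intro sum.cong) (use that i_bounds in \<open>auto simp: w_coord_def\<close>)
  show ?thesis
  proof
    assume off: "off_hyperplanes q (d - i) (\<lambda>j. if j = d - i - 1 then 1 else z (i + 1 + j))"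
    show "w_independent z"
      unfolding w_independent_def
    proof (intro allI impI ballI, rule ccontr)
      fix a j
      assume a: "\<forall>l. a l \<in> Fq q" "(\<Sum>l=i..<d. a l * W z l) = 0" "j \<in> {i..<d}" "a j \<noteq> 0"
      then have "\<exists>l<d - i. a (i + l) \<noteq> 0"
        by (intro exI[of _ "j - i"]) auto
      then show False
        using off eq[of "\<lambda>l. a (i + l)" a] a(1,2) unfolding off_hyperplanes_def by auto
    qed
  next
    assume w: "w_independent z"
    show "off_hyperplanes q (d - i) (\<lambda>j. if j = d - i - 1 then 1 else z (i + 1 + j))"
      unfolding off_hyperplanes_def
    proof (intro allI impI notI)
      fix a
      assume a: "\<forall>j<d - i. a j \<in> Fq q" "\<exists>j<d - i. a j \<noteq> 0"
        "(\<Sum>j<d - i. a j * (if j = d - i - 1 then 1 else z (i + 1 + j))) = 0"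
      define b where "b = (\<lambda>l. if l \<in> {i..<d} then a (l - i) else 0)"
      have b: "b l \<in> Fq q" for l
        using a(1) by (auto simp: b_def)
      have b0: "(\<Sum>l=i..<d. b l * W z l) = 0"
        using a(3) by (subst eq[of a b, symmetric]) (simp_all add: b_def)
      have "a j = 0" if "j < d - i" for j
        using w_independentD[OF w b b0, of "i + j"] that by (simp add: b_def)
      then show False using a(2) by auto
    qed
  qed
qed

lemma target_points_iff:
  "z \<in> target_points q d i A \<longleftrightarrow> z \<in> extensional {1..d - 1} \<and> z i \<in> A \<and> xi_off z \<and> w_independent z"
  unfolding target_points_def off_hyperplanes_xi off_hyperplanes_w by auto

lemma xi_offD:
  assumes "xi_off x" "\<And>l. a l \<in> Fq q" "(\<Sum>j=1..i. a j * \<Xi> x j) = 0" "j \<in> {1..i}"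
  shows "a j = 0"
  using assms unfolding xi_off_def by blast

lemma rmap_outer: "j \<in> {Suc i..d - 1} \<Longrightarrow> rmap x j = x j"
  by (auto simp: rmap_def)

lemma rmap_xi:
  assumes "x \<in> source" "j \<in> {1..i}"
  shows "\<Xi> (rmap x) j = lp x (\<Xi> x j) (x i) / lp x 1 (x i)"
  using assms lp_1_nonzero[OF source_facts(2)[OF assms(1)]] i_bounds by (auto simp: xi_coord_def rmap_def)

lemma rmap_mid: "rmap x i = kappa x * x i ^ N / lp x 1 (x i)"
  using i_bounds by (simp add: rmap_def)

lemma rmap_zero_iff:
  assumes "x \<in> source"
  shows "rmap x i = 0 \<longleftrightarrow> x i = 0"
  using kappa_nonzero[OF source_facts(1)[OF assms]] lp_1_nonzero[OF source_facts(2)[OF assms]]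
  by (simp add: rmap_mid)

lemma rmap_in_target:
  assumes x: "x \<in> source"
  shows "rmap x \<in> target_points q d i UNIV"
proof -
  have "xi_off (rmap x)"
    unfolding xi_off_def
  proof (intro allI impI ballI)
    fix a j assume a: "\<forall>l. a l \<in> Fq q" "(\<Sum>j=1..i. a j * \<Xi> (rmap x) j) = 0" and j: "j \<in> {1..i}"
    have "(\<Sum>j=1..i. a j * \<Xi> (rmap x) j) = (\<Sum>j=1..i. a j * lp x (\<Xi> x j) (x i)) / lp x 1 (x i)"
      using rmap_xi[OF x] by (simp add: sum_divide_distrib)
    also have "(\<Sum>j=1..i. a j * lp x (\<Xi> x j) (x i)) = lp x (\<Sum>j=1..i. a j * \<Xi> x j) (x i)"
      using a(1) by (simp add: lpoly_sum)
    finally have "lp x (\<Sum>j=1..i. a j * \<Xi> x j) (x i) = 0"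
      using a(2) lp_1_nonzero[OF source_facts(2)[OF x]] by simp
    then obtain b where "\<forall>l. b l \<in> Fq q" "(\<Sum>j=1..i. a j * \<Xi> x j) = x i * (\<Sum>l=i..<d. b l * W x l)"
      unfolding lp_kernel by blast
    then show "a j = 0"
      using xi_independentD[OF source_facts(2)[OF x], of a b j] a(1) j by blast
  qed
  moreover have "w_independent (rmap x)"
    using lp_cong(3)[of "rmap x" x] rmap_outer source_facts(1)[OF x] by blast
  ultimately show ?thesis
    by (simp add: target_points_iff) (simp add: rmap_def)
qed

text \<open>The middle coordinate is found first: off the boundary, \<open>\<theta> = 1 / \<eta>\<close> solves an additive equation.
  Then the other coordinates solve additive equations in which \<open>\<eta>\<close> is a parameter.\<close>

lemma rmap_surjective:
  assumes z: "z \<in> target_points q d i UNIV"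
  shows "\<exists>x\<in>source. rmap x = z"
proof -
  have zf: "z \<in> extensional {1..d - 1}" "xi_off z" "w_independent z"
    using z by (auto simp: target_points_iff)
  have "\<exists>\<eta>. z i * lp z 1 \<eta> = kappa z * \<eta> ^ N \<and> lp z 1 \<eta> \<noteq> 0"
  proof (cases "z i = 0")
    case True
    then show ?thesis
      by (intro exI[of _ 0]) (use q_gt_1 in \<open>auto simp: lpoly_at_0 power_0_left\<close>)
  next
    case False
    obtain \<theta> where \<theta>: "lp z \<theta> 1 = kappa z / z i"
      using lpoly_surjective by blast
    have \<theta>0: "\<theta> \<noteq> 0"
      using \<theta> kappa_nonzero[OF zf(3)] False by auto
    have "lp z 1 (1 / \<theta>) = (1 / \<theta>) ^ N * lp z \<theta> 1"
      using lpoly_homogeneous[of d "W z" m "1 / \<theta>" \<theta> 1] \<theta>0 by simp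
    then show ?thesis
      using \<theta> \<theta>0 False kappa_nonzero[OF zf(3)] by (intro exI[of _ "1 / \<theta>"]) simp
  qed
  then obtain \<eta> where \<eta>: "z i * lp z 1 \<eta> = kappa z * \<eta> ^ N" "lp z 1 \<eta> \<noteq> 0" by blast
  have "\<forall>j. \<exists>\<xi>. lp z \<xi> \<eta> = z j * lp z 1 \<eta>"
    using lpoly_surjective by blast
  then obtain \<xi> where \<xi>: "\<And>j. lp z (\<xi> j) \<eta> = z j * lp z 1 \<eta>"
    by metis
  define x where "x = (\<lambda>j\<in>{1..d - 1}. if j < i then \<xi> j else if j = i then \<eta> else z j)"
  have xo: "x j = z j" if "j \<in> {Suc i..d - 1}" for j
    using that by (simp add: x_def)
  have xi: "x i = \<eta>"
    using i_bounds by (simp add: x_def)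
  have lpe: "lp x a b = lp z a b" for a b
    using lp_cong(1)[of x z a b] xo by blast
  have kpe: "kappa x = kappa z" and wie: "w_independent x = w_independent z"
    using lp_cong(2,3)[of x z] xo by blast+
  have lpx: "lp x (\<Xi> x j) (x i) = \<Xi> z j * lp z 1 \<eta>" if "j \<in> {1..i}" for j
  proof (cases "j = i")
    case False
    then have "x j = \<xi> j"
      using that i_bounds by (auto simp: x_def)
    then show ?thesis
      using False \<xi>[of j] unfolding lpe by (simp add: xi xi_coord_def)
  qed (simp add: lpe kpe xi xi_coord_def)
  have "xi_independent x"
    unfolding xi_independent_def
  proof (intro allI impI ballI)
    fix a b j
    assume ab: "\<forall>l. a l \<in> Fq q" "\<forall>l. b l \<in> Fq q"
      "(\<Sum>j=1..i. a j * \<Xi> x j) = x i * (\<Sum>l=i..<d. b l * W x l)" and j: "j \<in> {1..i}"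
    have "(\<Sum>j=1..i. a j * \<Xi> z j) * lp z 1 \<eta> = (\<Sum>j=1..i. a j * lp x (\<Xi> x j) (x i))"
      unfolding sum_distrib_right by (intro sum.cong) (simp_all add: lpx mult.assoc)
    also have "\<dots> = lp x (\<Sum>j=1..i. a j * \<Xi> x j) (x i)"
      using ab(1) by (simp add: lpoly_sum)
    also have "\<dots> = 0"
      unfolding lp_kernel using ab by blast
    finally have "(\<Sum>j=1..i. a j * \<Xi> z j) = 0"
      using \<eta>(2) by simp
    then show "a j = 0"
      using xi_offD[OF zf(2)] ab(1) j by blast
  qed
  then have x: "x \<in> source"
    using wie zf(3) by (auto simp: source_def x_def)
  moreover have "rmap x = z"
  proof (rule extensionalityI[of _ "{1..d - 1}"])
    fix j assume j: "j \<in> {1..d - 1}"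
    consider "j < i" | "j = i" | "j > i" by linarith
    then show "rmap x j = z j"
    proof cases
      case 1
      then show ?thesis
        using j rmap_xi[OF x, of j] lpx[of j] \<eta>(2) by (simp add: xi_coord_def lpe kpe xi)
    next
      case 2
      then show ?thesis
        using \<eta> by (simp add: rmap_mid lpe kpe xi field_simps)
    next
      case 3
      then show ?thesis using j by (simp add: rmap_outer xo)
    qed
  qed (use zf in \<open>simp_all add: rmap_def\<close>)
  ultimately show ?thesis by blast
qed

section \<open>The unipotent group in coordinates\<close>

text \<open>The matrix with entries \<open>A (j, l)\<close> adds a combination of \<open>X i, \<dots>, X (d - 1)\<close> to each of
  \<open>X 0, \<dots>, X (i - 1)\<close>; the index \<open>j\<close> starts from 1 as for the coordinates \<open>\<Xi> x j\<close>.  The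
  denominators in \<open>act\<close> come from the normalisation \<open>X (i - 1) = 1\<close>.\<close>

definition coeffs :: "(nat \<times> nat \<Rightarrow> 'k) set"
  where "coeffs = ({1..i} \<times> {i..<d}) \<rightarrow>\<^sub>E Fq q"

definition shift :: "(nat \<times> nat \<Rightarrow> 'k) \<Rightarrow> (nat \<Rightarrow> 'k) \<Rightarrow> nat \<Rightarrow> 'k"
  where "shift A x j = (\<Sum>l=i..<d. A (j, l) * W x l)"

definition act :: "(nat \<times> nat \<Rightarrow> 'k) \<Rightarrow> (nat \<Rightarrow> 'k) \<Rightarrow> nat \<Rightarrow> 'k"
  where "act A x = (\<lambda>j\<in>{1..d - 1}. if j < i then (x j + shift A x j * x i) / (1 + shift A x i * x i)
     else if j = i then x i / (1 + shift A x i * x i) else x j)"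

lemma finite_coeffs: "finite coeffs"
  unfolding coeffs_def by (intro finite_PiE) (auto simp: finite_Fq)

lemma coeffs_Fq: "A \<in> coeffs \<Longrightarrow> j \<in> {1..i} \<Longrightarrow> l \<in> {i..<d} \<Longrightarrow> A (j, l) \<in> Fq q"
  unfolding coeffs_def by (auto dest!: PiE_mem)

text \<open>Elements of \<open>coeffs\<close> are undefined outside their index set, whereas the independence conditions
  and \<open>lp_kernel\<close> ask for coefficients that lie in the finite field everywhere.\<close>

lemma shift_alt:
  assumes "A \<in> coeffs" "j \<in> {1..i}"
  shows "\<exists>a. (\<forall>l. a l \<in> Fq q) \<and> shift A x j = (\<Sum>l=i..<d. a l * W x l)"
  unfolding shift_def
  by (intro exI[of _ "\<lambda>l. if l \<in> {i..<d} then A (j, l) else 0"]) (use coeffs_Fq[OF assms] in auto)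

lemma act_denom_nonzero:
  assumes x: "x \<in> source" and A: "A \<in> coeffs"
  shows "1 + shift A x i * x i \<noteq> 0"
proof
  assume z: "1 + shift A x i * x i = 0"
  obtain a where a: "\<forall>l. a l \<in> Fq q" "shift A x i = (\<Sum>l=i..<d. a l * W x l)"
    using shift_alt[OF A, of i] i_bounds by auto
  have "1 = x i * (\<Sum>l=i..<d. - a l * W x l)"
    using z a(2) by (simp add: sum_negf eq_neg_iff_add_eq_0 mult.commute)
  then have "lp x 1 (x i) = 0"
    unfolding lp_kernel using a(1) Fq_uminus by (intro exI[of _ "\<lambda>l. - a l"]) auto
  then show False
    using lp_1_nonzero[OF source_facts(2)[OF x]] by simp
qed

lemma act_outer: "j \<in> {Suc i..d - 1} \<Longrightarrow> act A x j = x j"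
  by (auto simp: act_def)

lemma act_mid: "act A x i = x i / (1 + shift A x i * x i)"
  using i_bounds by (simp add: act_def)

lemma act_xi:
  assumes "x \<in> source" "A \<in> coeffs" "j \<in> {1..i}"
  shows "\<Xi> (act A x) j = (\<Xi> x j + shift A x j * x i) / (1 + shift A x i * x i)"
  using assms act_denom_nonzero[OF assms(1,2)] i_bounds by (auto simp: xi_coord_def act_def)

lemma point_eqI:
  assumes "x \<in> extensional {1..d - 1}" "y \<in> extensional {1..d - 1}"
    "\<And>j. j \<in> {1..i} \<Longrightarrow> \<Xi> x j = \<Xi> y j" "x i = y i" "\<And>j. j \<in> {Suc i..d - 1} \<Longrightarrow> x j = y j"
  shows "x = y"
proof (rule extensionalityI[OF assms(1,2)])
  fix j assume j: "j \<in> {1..d - 1}"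
  consider "j < i" | "j = i" | "j > i" by linarith
  then show "x j = y j"
    using j assms(3)[of j] assms(4) assms(5)[of j] by cases (auto simp: xi_coord_def)
qed

lemma act_in_source:
  assumes x: "x \<in> source" and A: "A \<in> coeffs"
  shows "act A x \<in> source"
proof -
  note nz = act_denom_nonzero[OF x A]
  have "\<forall>j\<in>{1..i}. \<exists>a. (\<forall>l. a l \<in> Fq q) \<and> shift A x j = (\<Sum>l=i..<d. a l * W x l)"
    using shift_alt[OF A] by blast
  then obtain B where B: "\<And>j l. j \<in> {1..i} \<Longrightarrow> B j l \<in> Fq q"
      "\<And>j. j \<in> {1..i} \<Longrightarrow> shift A x j = (\<Sum>l=i..<d. B j l * W x l)"
    by metis
  have Wc: "W (act A x) l = W x l" if "l \<in> {i..<d}" for l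
    using that by (intro w_coord_cong) (auto simp: act_outer)
  have "xi_independent (act A x)"
    unfolding xi_independent_def
  proof (intro allI impI ballI)
    fix a b j
    assume ab: "\<forall>l. a l \<in> Fq q" "\<forall>l. b l \<in> Fq q"
      "(\<Sum>j=1..i. a j * \<Xi> (act A x) j) = act A x i * (\<Sum>l=i..<d. b l * W (act A x) l)"
      and j: "j \<in> {1..i}"
    have "(\<Sum>j=1..i. a j * (\<Xi> x j + shift A x j * x i)) / (1 + shift A x i * x i)
        = (\<Sum>j=1..i. a j * \<Xi> (act A x) j)"
      unfolding sum_divide_distrib by (intro sum.cong) (simp_all add: act_xi[OF x A])
    also have "\<dots> = x i * (\<Sum>l=i..<d. b l * W x l) / (1 + shift A x i * x i)"
      using ab(3) Wc by (simp add: act_mid)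
    finally have "(\<Sum>j=1..i. a j * (\<Xi> x j + shift A x j * x i)) = x i * (\<Sum>l=i..<d. b l * W x l)"
      using nz by simp
    then have "(\<Sum>j=1..i. a j * \<Xi> x j) = x i * ((\<Sum>l=i..<d. b l * W x l) - (\<Sum>j=1..i. a j * shift A x j))"
      by (simp add: sum.distrib algebra_simps sum_distrib_left)
    also have "(\<Sum>j=1..i. a j * shift A x j) = (\<Sum>j=1..i. \<Sum>l=i..<d. a j * B j l * W x l)"
      by (intro sum.cong) (simp_all add: B(2) sum_distrib_left algebra_simps)
    also have "\<dots> = (\<Sum>l=i..<d. (\<Sum>j=1..i. a j * B j l) * W x l)"
      by (subst sum.swap) (simp add: sum_distrib_right)
    also have "(\<Sum>l=i..<d. b l * W x l) - \<dots> = (\<Sum>l=i..<d. (b l - (\<Sum>j=1..i. a j * B j l)) * W x l)"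
      by (simp add: left_diff_distrib sum_subtractf)
    finally show "a j = 0"
      by (rule xi_independentD[OF source_facts(2)[OF x], rotated 2])
        (use ab B j in \<open>auto intro!: Fq_diff Fq_sum Fq_mult\<close>)
  qed
  moreover have "w_independent (act A x)"
    using lp_cong(3)[of "act A x" x] act_outer source_facts(1)[OF x] by blast
  ultimately show ?thesis
    by (simp add: source_def) (simp add: act_def)
qed

lemma lp_shift:
  assumes "A \<in> coeffs" "j \<in> {1..i}"
  shows "lp x (\<xi> + shift A x j * \<eta>) \<eta> = lp x \<xi> \<eta>"
proof -
  have "lp x (shift A x j * \<eta>) \<eta> = 0"
    unfolding lp_kernel using shift_alt[OF assms, of x] by (auto simp: mult.commute)
  then show ?thesis by (simp add: lpoly_add)
qed

text \<open>The action adds elements of the kernel and rescales homogeneously, which cancels in the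
  quotients.\<close>

lemma rmap_act:
  assumes x: "x \<in> source" and A: "A \<in> coeffs"
  shows "rmap (act A x) = rmap x"
proof (rule point_eqI)
  note nz = act_denom_nonzero[OF x A]
  define c where "c = 1 / (1 + shift A x i * x i)"
  have c: "c \<noteq> 0" using nz by (simp add: c_def)
  have mid: "act A x i = c * x i"
    by (simp add: act_mid c_def)
  have lp: "lp (act A x) (\<Xi> (act A x) j) (act A x i) = c ^ N * lp x (\<Xi> x j) (x i)" if j: "j \<in> {1..i}" for j
  proof -
    have "\<Xi> (act A x) j = c * (\<Xi> x j + shift A x j * x i)"
      using act_xi[OF x A j] by (simp add: c_def)
    then show ?thesis
      unfolding mid using lp_cong(1)[of "act A x" x] act_outer
      by (simp add: lpoly_homogeneous lp_shift[OF A j])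
  qed
  have lp1: "lp (act A x) 1 (act A x i) = c ^ N * lp x 1 (x i)"
    using lp[of i] i_bounds by (simp add: xi_coord_def)
  show "\<Xi> (rmap (act A x)) j = \<Xi> (rmap x) j" if "j \<in> {1..i}" for j
    using that c by (simp add: rmap_xi x act_in_source[OF x A] lp lp1)
  show "rmap (act A x) i = rmap x i"
    using c lp_cong(2)[of "act A x" x, OF act_outer] unfolding rmap_mid lp1
    by (simp add: mid power_mult_distrib)
qed (auto simp: rmap_outer act_outer, auto simp: rmap_def)

lemma act_zero:
  assumes x: "x \<in> source"
  shows "\<exists>Z\<in>coeffs. act Z x = x"
proof -
  define Z :: "nat \<times> nat \<Rightarrow> 'k" where "Z = (\<lambda>_\<in>{1..i} \<times> {i..<d}. 0)"
  have Z: "Z \<in> coeffs"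
    by (auto simp: coeffs_def Z_def)
  have sh: "shift Z x j = 0" if "j \<in> {1..i}" for j
    using that by (simp add: shift_def Z_def)
  have shi: "shift Z x i = 0"
    using sh i_bounds by simp
  have "act Z x = x"
  proof (rule point_eqI)
    show "\<Xi> (act Z x) j = \<Xi> x j" if "j \<in> {1..i}" for j
      unfolding act_xi[OF x Z that] sh[OF that] shi by simp
    show "act Z x i = x i"
      unfolding act_mid shi by simp
  qed (use act_in_source[OF x Z] source_facts(3) x in \<open>auto simp: act_outer\<close>)
  then show ?thesis using Z by blast
qed

text \<open>Off the boundary, equal images mean equal values of the additive polynomial at the ratios
  \<open>\<Xi> x j / x i\<close> and \<open>\<Xi> y j / y i\<close>, so these differ by elements of the kernel, whose coefficients
  are the matrix.  On the boundary the map is injective and the group acts trivially.\<close>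

lemma rmap_fibre:
  assumes x: "x \<in> source" and y: "y \<in> source" and eq: "rmap x = rmap y"
  shows "\<exists>A\<in>coeffs. y = act A x"
proof -
  note ext = source_facts(3)[OF x] source_facts(3)[OF y]
  have outer: "y j = x j" if "j \<in> {Suc i..d - 1}" for j
    using rmap_outer[OF that] eq by metis
  have lpe: "lp y a b = lp x a b" for a b
    using lp_cong(1)[of y x a b] outer by blast
  have kpe: "kappa y = kappa x"
    using lp_cong(2)[of y x] outer by blast
  note nzx = lp_1_nonzero[OF source_facts(2)[OF x]]
  have nzy: "lp x 1 (y i) \<noteq> 0"
    using lp_1_nonzero[OF source_facts(2)[OF y]] lpe by metis
  have xi: "lp x (\<Xi> x j) (x i) / lp x 1 (x i) = lp x (\<Xi> y j) (y i) / lp x 1 (y i)" if "j \<in> {1..i}" for j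
    using rmap_xi[OF x that] rmap_xi[OF y that] eq unfolding lpe by simp
  have mid: "kappa x * x i ^ N / lp x 1 (x i) = kappa x * y i ^ N / lp x 1 (y i)"
    using eq rmap_mid[of x] rmap_mid[of y] by (simp add: lpe kpe)
  show ?thesis
  proof (cases "x i = 0")
    case True
    then have y0: "y i = 0"
      using rmap_zero_iff[OF x] rmap_zero_iff[OF y] eq by simp
    have "\<Xi> x j = \<Xi> y j" if "j \<in> {1..i}" for j
      using xi[OF that] True y0 by (simp add: lpoly_at_0 frob_inj)
    then have "x = y"
      by (intro point_eqI ext) (use True y0 outer in auto)
    then show ?thesis
      using act_zero[OF y] by metis
  next
    case False
    then have y0: "y i \<noteq> 0"
      using rmap_zero_iff[OF x] rmap_zero_iff[OF y] eq by simp
    have hom: "lp x \<xi> \<eta> = \<eta> ^ N * lp x (\<xi> / \<eta>) 1" if "\<eta> \<noteq> 0" for \<xi> \<eta>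
      using lpoly_homogeneous[of d "W x" m \<eta> "\<xi> / \<eta>" 1] that by simp
    have "x i ^ N / lp x 1 (x i) = y i ^ N / lp x 1 (y i)"
      using mid kappa_nonzero[OF source_facts(1)[OF x]] by (metis mult_left_cancel times_divide_eq_right)
    then have "lp x (\<Xi> x j / x i) 1 = lp x (\<Xi> y j / y i) 1" if "j \<in> {1..i}" for j
    proof -
      assume m: "x i ^ N / lp x 1 (x i) = y i ^ N / lp x 1 (y i)"
      define u where "u = x i ^ N / lp x 1 (x i)"
      have "u \<noteq> 0" using False nzx by (simp add: u_def)
      have "lp x (\<Xi> x j) (x i) / lp x 1 (x i) = u * lp x (\<Xi> x j / x i) 1"
        using hom[OF False] by (simp add: u_def)
      moreover have "lp x (\<Xi> y j) (y i) / lp x 1 (y i) = u * lp x (\<Xi> y j / y i) 1"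
        using hom[OF y0, of "\<Xi> y j"] m by (simp add: u_def)
      ultimately show ?thesis
        using xi[OF that] \<open>u \<noteq> 0\<close> by simp
    qed
    then have "lp x (\<Xi> y j / y i - \<Xi> x j / x i) 1 = 0" if "j \<in> {1..i}" for j
      using that by (simp add: lpoly_diff)
    then have "\<forall>j\<in>{1..i}. \<exists>a. (\<forall>l. a l \<in> Fq q) \<and> \<Xi> y j / y i - \<Xi> x j / x i = (\<Sum>l=i..<d. a l * W x l)"
      unfolding lp_kernel by simp
    then obtain B where B: "\<And>j l. j \<in> {1..i} \<Longrightarrow> B j l \<in> Fq q"
      "\<And>j. j \<in> {1..i} \<Longrightarrow> \<Xi> y j / y i - \<Xi> x j / x i = (\<Sum>l=i..<d. B j l * W x l)"
      by metis
    define A where "A = (\<lambda>p\<in>{1..i} \<times> {i..<d}. B (fst p) (snd p))"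
    have A: "A \<in> coeffs"
      using B(1) by (auto simp: A_def coeffs_def)
    have sh: "shift A x j = \<Xi> y j / y i - \<Xi> x j / x i" if "j \<in> {1..i}" for j
      unfolding B(2)[OF that] shift_def using that by (intro sum.cong) (auto simp: A_def)
    have den: "1 + shift A x i * x i = x i / y i"
      using sh[of i] i_bounds False y0 by (simp add: xi_coord_def field_simps)
    have "y = act A x"
    proof (intro point_eqI)
      show "\<Xi> y j = \<Xi> (act A x) j" if "j \<in> {1..i}" for j
        using False y0 unfolding act_xi[OF x A that] den sh[OF that] by (simp add: field_simps)
      show "y i = act A x i"
        using False y0 unfolding act_mid den by simp
    qed (use act_in_source[OF x A] source_facts(3) y outer in \<open>auto simp: act_outer\<close>)
    then show ?thesis using A by blast
  qed
qed

lemma act_act: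
  assumes x: "x \<in> source" and A: "A \<in> coeffs" and B: "B \<in> coeffs"
    and C: "C \<in> coeffs" "\<And>j l. j \<in> {1..i} \<Longrightarrow> l \<in> {i..<d} \<Longrightarrow> C (j, l) = A (j, l) + B (j, l)"
  shows "act A (act B x) = act C x"
proof -
  have y: "act B x \<in> source" by (rule act_in_source[OF x B])
  have "shift A (act B x) j = shift A x j" for j
    unfolding shift_def by (intro sum.cong arg_cong2[where f = "(*)"] w_coord_cong) (auto simp: act_outer)
  moreover have "shift C x j = shift A x j + shift B x j" if "j \<in> {1..i}" for j
    unfolding shift_def sum.distrib[symmetric] using that
    by (intro sum.cong) (auto simp: C(2) distrib_right)
  moreover have "i \<in> {1..i}" using i_bounds by simp
  ultimately have sh: "1 + shift A (act B x) i * act B x i = (1 + shift C x i * x i) / (1 + shift B x i * x i)"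
    "\<And>j. shift A (act B x) j = shift A x j" "\<And>j. j \<in> {1..i} \<Longrightarrow> shift C x j = shift A x j + shift B x j"
    using act_denom_nonzero[OF x B] by (auto simp: act_mid field_simps)
  note nz = act_denom_nonzero[OF x B] act_denom_nonzero[OF x C(1)]
  show ?thesis
  proof (intro point_eqI)
    show "act A (act B x) i = act C x i"
      using nz unfolding act_mid[of A] sh(1) by (simp add: act_mid)
    fix j assume j: "j \<in> {1..i}"
    have "\<Xi> (act B x) j + shift A (act B x) j * act B x i
        = (\<Xi> x j + shift C x j * x i) / (1 + shift B x i * x i)"
      using nz(1) unfolding act_xi[OF x B j] act_mid sh(2) sh(3)[OF j] add_divide_distrib[symmetric]
      by (simp add: add_divide_distrib[symmetric] algebra_simps)
    then show "\<Xi> (act A (act B x)) j = \<Xi> (act C x) j"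
      unfolding act_xi[OF y A j] act_xi[OF x C(1) j] sh(1) using nz by simp
  qed (use act_in_source[OF y A] act_in_source[OF x C(1)] source_facts(3) in \<open>auto simp: act_outer\<close>)
qed

section \<open>Subrings of functions\<close>

text \<open>Functions are only considered on the source, so subrings are closed under equality there.\<close>

definition subring :: "((nat \<Rightarrow> 'k) \<Rightarrow> 'k) set \<Rightarrow> bool"
  where "subring R \<longleftrightarrow> (\<forall>c\<in>Fq q. (\<lambda>_. c) \<in> R) \<and>
    (\<forall>f\<in>R. \<forall>g\<in>R. (\<lambda>x. f x + g x) \<in> R \<and> (\<lambda>x. f x * g x) \<in> R) \<and>
    (\<forall>f\<in>R. \<forall>g. (\<forall>x\<in>source. f x = g x) \<longrightarrow> g \<in> R)"

lemma subring_const: "subring R \<Longrightarrow> c \<in> Fq q \<Longrightarrow> (\<lambda>_. c) \<in> R"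
  and subring_add: "subring R \<Longrightarrow> f \<in> R \<Longrightarrow> g \<in> R \<Longrightarrow> (\<lambda>x. f x + g x) \<in> R"
  and subring_mult: "subring R \<Longrightarrow> f \<in> R \<Longrightarrow> g \<in> R \<Longrightarrow> (\<lambda>x. f x * g x) \<in> R"
  unfolding subring_def by blast+

lemma subring_cong: "subring R \<Longrightarrow> f \<in> R \<Longrightarrow> (\<And>x. x \<in> source \<Longrightarrow> f x = g x) \<Longrightarrow> g \<in> R"
  unfolding subring_def by blast

lemma subring_sum: "subring R \<Longrightarrow> (\<And>a. a \<in> A \<Longrightarrow> f a \<in> R) \<Longrightarrow> (\<lambda>x. \<Sum>a\<in>A. f a x) \<in> R"
  by (induction A rule: infinite_finite_induct) (auto simp: subring_const subring_add)

lemma subring_prod: "subring R \<Longrightarrow> (\<And>a. a \<in> A \<Longrightarrow> f a \<in> R) \<Longrightarrow> (\<lambda>x. \<Prod>a\<in>A. f a x) \<in> R"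
  by (induction A rule: infinite_finite_induct) (auto simp: subring_const subring_mult)

lemma subring_power: "subring R \<Longrightarrow> f \<in> R \<Longrightarrow> (\<lambda>x. f x ^ n) \<in> R"
  by (induction n) (auto simp: subring_const subring_mult)

lemma subring_diff: "subring R \<Longrightarrow> f \<in> R \<Longrightarrow> g \<in> R \<Longrightarrow> (\<lambda>x. f x - g x) \<in> R"
  using subring_add[of R f "\<lambda>x. - 1 * g x"] subring_mult[OF _ subring_const[of R "- 1"], of g]
  by (simp add: Fq_uminus)

lemma subring_peval:
  assumes R: "subring R" and g: "g \<in> Fq_polys q (d - 1)"
    and x: "\<And>k. k \<in> {1..d - 1} \<Longrightarrow> (\<lambda>x. x k) \<in> R"
  shows "peval g \<in> R"
proof -
  have c: "Poly_Mapping.lookup g m \<in> Fq q" for m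
    using g by (auto simp: Fq_polys_def)
  have "k \<in> {1..d - 1}" if "m \<in> Poly_Mapping.keys g" "k \<in> Poly_Mapping.keys m" for k m
    using g that by (auto simp: Fq_polys_def dest!: bspec)
  then show ?thesis
    unfolding peval_def[abs_def]
    by (intro subring_sum subring_mult subring_const subring_prod subring_power R c x)
qed

lemma subring_lpoly:
  assumes R: "subring R" and W: "\<And>l. l \<in> {i..<d} \<Longrightarrow> (\<lambda>x. W x l) \<in> R" and k: "k \<le> m"
    and "f \<in> R" "g \<in> R"
  shows "(\<lambda>x. lpoly q d (W x) k (f x) (g x)) \<in> R"
  using assms(3-)
proof (induction k arbitrary: f g)
  case (Suc k)
  have "(\<lambda>x. lpoly q d (W x) k (W x (d - Suc k)) 1) \<in> R"
    using Suc.prems(1) i_bounds by (intro Suc.IH W subring_const R) auto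
  moreover have "(\<lambda>x. lpoly q d (W x) k (f x) (g x)) \<in> R"
    using Suc.prems by (intro Suc.IH) auto
  ultimately show ?case
    unfolding lpoly.simps using Suc.prems
    by (intro subring_diff subring_mult subring_power R) auto
qed simp

text \<open>Additive polynomials have no constant term; only the quotient by \<open>f x\<close> matters.\<close>

lemma subring_lpoly_factor:
  assumes R: "subring R" and W: "\<And>l. l \<in> {i..<d} \<Longrightarrow> (\<lambda>x. W x l) \<in> R" and k: "k \<le> m"
    and f: "f \<in> R" and g: "g \<in> R"
  shows "\<exists>s\<in>R. \<forall>x. lpoly q d (W x) k (f x) (g x) = f x * s x"
  using k
proof (induction k)
  case 0
  then show ?case
    by (intro bexI[of _ "\<lambda>_. 1"]) (auto simp: subring_const R)
next
  case (Suc k)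
  then obtain s where s: "s \<in> R" "\<And>x. lpoly q d (W x) k (f x) (g x) = f x * s x" by auto
  define c where "c = (\<lambda>x. lpoly q d (W x) k (W x (d - Suc k)) 1 ^ (q - 1) * g x ^ (q ^ Suc k - q ^ k))"
  have "c \<in> R"
    unfolding c_def using Suc.prems i_bounds
    by (intro subring_mult subring_power subring_lpoly W subring_const R g) auto
  then have "(\<lambda>x. f x ^ (q - 1) * s x ^ q - c x * s x) \<in> R"
    using s(1) f by (intro subring_diff subring_mult subring_power R) auto
  moreover have "lpoly q d (W x) (Suc k) (f x) (g x) = f x * (f x ^ (q - 1) * s x ^ q - c x * s x)" for x
    unfolding lpoly.simps s(2) power_mult_distrib power_q_split[of "f x"] by (simp add: c_def algebra_simps)
  ultimately show ?case
    by (intro bexI[of _ "\<lambda>x. f x ^ (q - 1) * s x ^ q - c x * s x"]) auto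
qed

text \<open>The elements of \<open>R[g]\<close> of degree less than \<open>n\<close> in \<open>g\<close>.\<close>

definition span :: "((nat \<Rightarrow> 'k) \<Rightarrow> 'k) set \<Rightarrow> ((nat \<Rightarrow> 'k) \<Rightarrow> 'k) \<Rightarrow> nat \<Rightarrow> ((nat \<Rightarrow> 'k) \<Rightarrow> 'k) set"
  where "span R g n = {f. \<exists>c. (\<forall>a<n. c a \<in> R) \<and> (\<forall>x\<in>source. f x = (\<Sum>a<n. c a x * g x ^ a))}"

lemma spanI: "(\<And>a. a < n \<Longrightarrow> c a \<in> R) \<Longrightarrow> (\<And>x. x \<in> source \<Longrightarrow> f x = (\<Sum>a<n. c a x * g x ^ a)) \<Longrightarrow>
    f \<in> span R g n"
  unfolding span_def by blast

lemma span_cong: "f \<in> span R g n \<Longrightarrow> (\<And>x. x \<in> source \<Longrightarrow> f x = h x) \<Longrightarrow> h \<in> span R g n"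
  unfolding span_def by auto

lemma span_add:
  assumes "subring R" "f \<in> span R g n" "h \<in> span R g n"
  shows "(\<lambda>x. f x + h x) \<in> span R g n"
proof -
  obtain c where c: "\<And>a. a < n \<Longrightarrow> c a \<in> R" "\<And>x. x \<in> source \<Longrightarrow> f x = (\<Sum>a<n. c a x * g x ^ a)"
    using assms(2) unfolding span_def by blast
  obtain b where b: "\<And>a. a < n \<Longrightarrow> b a \<in> R" "\<And>x. x \<in> source \<Longrightarrow> h x = (\<Sum>a<n. b a x * g x ^ a)"
    using assms(3) unfolding span_def by blast
  show ?thesis
    by (rule spanI[of _ "\<lambda>a x. c a x + b a x"])
      (use b c subring_add[OF assms(1)] in \<open>auto simp: sum.distrib distrib_right\<close>)
qed

lemma span_scale:
  assumes "subring R" "r \<in> R" "f \<in> span R g n"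
  shows "(\<lambda>x. r x * f x) \<in> span R g n"
proof -
  obtain c where c: "\<And>a. a < n \<Longrightarrow> c a \<in> R" "\<And>x. x \<in> source \<Longrightarrow> f x = (\<Sum>a<n. c a x * g x ^ a)"
    using assms(3) unfolding span_def by blast
  show ?thesis
    by (rule spanI[of _ "\<lambda>a x. r x * c a x"])
      (use c subring_mult[OF assms(1,2)] in \<open>auto simp: sum_distrib_left mult.assoc\<close>)
qed

lemma span_diff:
  assumes "subring R" "f \<in> span R g n" "h \<in> span R g n"
  shows "(\<lambda>x. f x - h x) \<in> span R g n"
  using span_add[OF assms(1,2) span_scale[OF assms(1) subring_const[OF assms(1), of "- 1"] assms(3)]]
  by (simp add: Fq_uminus)

lemma span_zero: "subring R \<Longrightarrow> (\<lambda>_. 0) \<in> span R g n"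
  by (rule spanI[of _ "\<lambda>_ _. 0"]) (auto simp: subring_const)

lemma span_sum:
  "subring R \<Longrightarrow> (\<And>a. a \<in> A \<Longrightarrow> f a \<in> span R g n) \<Longrightarrow> (\<lambda>x. \<Sum>a\<in>A. f a x) \<in> span R g n"
  by (induction A rule: infinite_finite_induct) (auto simp: span_zero span_add)

lemma span_monomial:
  assumes "subring R" "r \<in> R" "b < n"
  shows "(\<lambda>x. r x * g x ^ b) \<in> span R g n"
proof (rule spanI[of _ "\<lambda>a x. if a = b then r x else 0"])
  show "(\<lambda>x. if a = b then r x else 0) \<in> R" for a
    using assms by (cases "a = b") (auto simp: subring_const)
  show "r x * g x ^ b = (\<Sum>a<n. (if a = b then r x else 0) * g x ^ a)" for x
    using assms(3) by (simp add: if_distrib[of "\<lambda>c. c * _"] sum.delta cong: if_cong)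
qed

lemma span_base: "subring R \<Longrightarrow> r \<in> R \<Longrightarrow> n > 0 \<Longrightarrow> r \<in> span R g n"
  using span_monomial[of R r 0 n g] by simp

lemma span_gpow: "subring R \<Longrightarrow> b < n \<Longrightarrow> (\<lambda>x. g x ^ b) \<in> span R g n"
  using span_monomial[of R "\<lambda>_. 1" b n g] by (simp add: subring_const)

lemma span_mono:
  assumes "subring R" "f \<in> span R g n" "n \<le> n'"
  shows "f \<in> span R g n'"
proof -
  obtain c where c: "\<And>a. a < n \<Longrightarrow> c a \<in> R" "\<And>x. x \<in> source \<Longrightarrow> f x = (\<Sum>a<n. c a x * g x ^ a)"
    using assms(2) unfolding span_def by blast
  have "(\<lambda>x. \<Sum>a<n. c a x * g x ^ a) \<in> span R g n'"
    by (intro span_sum span_monomial) (use c assms in auto)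
  then show ?thesis
    by (rule span_cong) (simp add: c(2))
qed

lemma span_shift_power:
  assumes "subring R" "f \<in> span R g n" "b + n \<le> n'"
  shows "(\<lambda>x. g x ^ b * f x) \<in> span R g n'"
proof -
  obtain c where c: "\<And>a. a < n \<Longrightarrow> c a \<in> R" "\<And>x. x \<in> source \<Longrightarrow> f x = (\<Sum>a<n. c a x * g x ^ a)"
    using assms(2) unfolding span_def by blast
  have "(\<lambda>x. \<Sum>a<n. c a x * g x ^ (b + a)) \<in> span R g n'"
    by (intro span_sum span_monomial) (use c assms in auto)
  then show ?thesis
    by (rule span_cong) (simp add: c(2) sum_distrib_left power_add mult.left_commute)
qed

lemma span_frob:
  assumes "subring R" "f \<in> span R g n"
  shows "(\<lambda>x. f x ^ q) \<in> span R g (q * n)"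
proof -
  obtain c where c: "\<And>a. a < n \<Longrightarrow> c a \<in> R" "\<And>x. x \<in> source \<Longrightarrow> f x = (\<Sum>a<n. c a x * g x ^ a)"
    using assms(2) unfolding span_def by blast
  have "(\<lambda>x. \<Sum>a<n. c a x ^ q * g x ^ (q * a)) \<in> span R g (q * n)"
    by (intro span_sum span_monomial subring_power) (use c assms in auto)
  then show ?thesis
    by (rule span_cong) (simp add: c(2) frob1_sum power_mult_distrib power_mult[symmetric] mult.commute[of q])
qed

text \<open>If \<open>g\<close> satisfies a monic equation of degree \<open>n\<close> over \<open>R\<close>, the powers below \<open>n\<close> span \<open>R[g]\<close>.\<close>

lemma subring_adjoin:
  assumes R: "subring R" and n: "n > 0" and monic: "(\<lambda>x. g x ^ n) \<in> span R g n"
  shows "subring (span R g n)"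
proof -
  have shift: "(\<lambda>x. g x * f x) \<in> span R g n" if f: "f \<in> span R g n" for f
  proof -
    obtain c where c: "\<And>a. a < n \<Longrightarrow> c a \<in> R" "\<And>x. x \<in> source \<Longrightarrow> f x = (\<Sum>a<n. c a x * g x ^ a)"
      using f unfolding span_def by blast
    have "(\<lambda>x. g x ^ Suc a) \<in> span R g n" if "a < n" for a
      using span_gpow[OF R, of "Suc a" n g] monic that by (cases "Suc a = n") auto
    then have "(\<lambda>x. \<Sum>a<n. c a x * g x ^ Suc a) \<in> span R g n"
      by (intro span_sum span_scale R c) auto
    then show ?thesis
      by (rule span_cong) (simp add: c(2) sum_distrib_left algebra_simps)
  qed
  have pow: "(\<lambda>x. g x ^ b * f x) \<in> span R g n" if "f \<in> span R g n" for f b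
  proof (induction b)
    case (Suc b)
    from shift[OF Suc] show ?case by (simp add: mult.assoc)
  qed (use that in simp)
  have mult: "(\<lambda>x. f x * h x) \<in> span R g n" if f: "f \<in> span R g n" and h: "h \<in> span R g n" for f h
  proof -
    obtain c where c: "\<And>a. a < n \<Longrightarrow> c a \<in> R" "\<And>x. x \<in> source \<Longrightarrow> f x = (\<Sum>a<n. c a x * g x ^ a)"
      using f unfolding span_def by blast
    have "(\<lambda>x. \<Sum>a<n. c a x * (g x ^ a * h x)) \<in> span R g n"
      by (intro span_sum span_scale R c pow h) auto
    then show ?thesis
      by (rule span_cong) (simp add: c(2) sum_distrib_right mult.assoc)
  qed
  show ?thesis
    unfolding subring_def
    using span_add[OF R] mult span_base[OF R subring_const[OF R] n] by (blast intro: span_cong)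
qed

text \<open>In the variable \<open>\<eta>\<close> the polynomial \<open>lpoly q d W k 1 \<eta>\<close> has degree less than \<open>q ^ k\<close>, in the
  variable \<open>\<xi>\<close> the polynomial \<open>lpoly q d W k \<xi> \<eta>\<close> is monic of degree \<open>q ^ k\<close>.\<close>

lemma lpoly_1_in_span:
  assumes R: "subring R" and W: "\<And>l. l \<in> {i..<d} \<Longrightarrow> (\<lambda>x. W x l) \<in> R" and k: "k \<le> m"
  shows "(\<lambda>x. lpoly q d (W x) k 1 (g x)) \<in> span R g (q ^ k)"
  using k
proof (induction k)
  case 0
  then show ?case
    using span_gpow[OF R, of 0 1 g] by simp
next
  case (Suc k)
  then have IH: "(\<lambda>x. lpoly q d (W x) k 1 (g x)) \<in> span R g (q ^ k)" by simp
  have "(\<lambda>x. lpoly q d (W x) k (W x (d - Suc k)) 1 ^ (q - 1)) \<in> R"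
    using Suc.prems i_bounds by (intro subring_power subring_lpoly W subring_const R) auto
  then have "(\<lambda>x. lpoly q d (W x) k (W x (d - Suc k)) 1 ^ (q - 1) *
      (g x ^ (q ^ Suc k - q ^ k) * lpoly q d (W x) k 1 (g x))) \<in> span R g (q ^ Suc k)"
    using q_pow_split[of k] by (intro span_scale R span_shift_power[OF R IH]) auto
  from span_diff[OF R span_frob[OF R IH, folded power_Suc] this] show ?case
    by (simp add: mult.assoc)
qed

lemma lpoly_monic_in_span:
  assumes R: "subring R" and W: "\<And>l. l \<in> {i..<d} \<Longrightarrow> (\<lambda>x. W x l) \<in> R" and k: "k \<le> m"
    and h: "h \<in> R"
  shows "(\<lambda>x. g x ^ (q ^ k) - lpoly q d (W x) k (g x) (h x)) \<in> span R g (q ^ k)"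
  using k
proof (induction k)
  case 0
  then show ?case
    using span_zero[OF R] by simp
next
  case (Suc k)
  define L where "L = (\<lambda>x. g x ^ (q ^ k) - lpoly q d (W x) k (g x) (h x))"
  have IH: "L \<in> span R g (q ^ k)"
    unfolding L_def using Suc by simp
  define c where "c = (\<lambda>x. lpoly q d (W x) k (W x (d - Suc k)) 1 ^ (q - 1) * h x ^ (q ^ Suc k - q ^ k))"
  have c: "c \<in> R"
    unfolding c_def using Suc.prems i_bounds
    by (intro subring_mult subring_power subring_lpoly W subring_const R h) auto
  have lt: "q ^ k < q ^ Suc k"
    using q_gt_1 by simp
  have "(\<lambda>x. L x ^ q) \<in> span R g (q ^ Suc k)"
    using span_frob[OF R IH] by simp
  moreover have "(\<lambda>x. c x * g x ^ (q ^ k)) \<in> span R g (q ^ Suc k)"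
    using span_monomial[OF R c lt] .
  moreover have "(\<lambda>x. c x * L x) \<in> span R g (q ^ Suc k)"
    using span_mono[OF R span_scale[OF R c IH]] lt by simp
  ultimately have "(\<lambda>x. (L x ^ q + c x * g x ^ (q ^ k)) - c x * L x) \<in> span R g (q ^ Suc k)"
    by (intro span_diff span_add R)
  then show ?case
  proof (rule span_cong)
    fix x
    have "g x ^ (q ^ Suc k) = (g x ^ (q ^ k)) ^ q"
      by (simp add: power_mult[symmetric] mult.commute)
    moreover have "L x ^ q = (g x ^ (q ^ k)) ^ q - lpoly q d (W x) k (g x) (h x) ^ q"
      by (simp add: L_def frob1_diff)
    moreover have "lpoly q d (W x) k (W x (d - Suc k)) 1 ^ (q - 1) * h x ^ (q ^ Suc k - q ^ k) = c x"
      by (simp add: c_def)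
    moreover have "c x * L x = c x * g x ^ (q ^ k) - c x * lpoly q d (W x) k (g x) (h x)"
      by (simp add: L_def right_diff_distrib)
    ultimately show "L x ^ q + c x * g x ^ q ^ k - c x * L x
        = g x ^ q ^ Suc k - lpoly q d (W x) (Suc k) (g x) (h x)"
      unfolding lpoly.simps by (simp only:, simp add: algebra_simps)
  qed
qed

section \<open>The coordinate functions over the target\<close>

abbreviation "T \<equiv> target_points q d i (UNIV :: 'k set)"

definition pulled_back :: "((nat \<Rightarrow> 'k) \<Rightarrow> 'k) set"
  where "pulled_back = {f. \<exists>b. regular_on q (d - 1) T b \<and> (\<forall>x\<in>source. f x = b (rmap x))}"

lemma pulled_backI: "regular_on q (d - 1) T b \<Longrightarrow> (\<And>x. x \<in> source \<Longrightarrow> f x = b (rmap x)) \<Longrightarrow> f \<in> pulled_back"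
  unfolding pulled_back_def by blast

lemma subring_pulled_back: "subring pulled_back"
  unfolding subring_def
proof (intro conjI ballI allI impI)
  fix c :: 'k assume "c \<in> Fq q"
  then show "(\<lambda>_. c) \<in> pulled_back"
    by (intro pulled_backI[OF regular_on_const]) auto
next
  fix f g assume "f \<in> pulled_back" "g \<in> pulled_back"
  then obtain b c where *: "regular_on q (d - 1) T b" "\<forall>x\<in>source. f x = b (rmap x)"
    "regular_on q (d - 1) T c" "\<forall>x\<in>source. g x = c (rmap x)"
    unfolding pulled_back_def by blast
  show "(\<lambda>x. f x + g x) \<in> pulled_back" "(\<lambda>x. f x * g x) \<in> pulled_back"
    using * by (intro pulled_backI[OF regular_on_add] pulled_backI[OF regular_on_mult]; simp)+
qed (auto simp: pulled_back_def)

lemma regular_on_w: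
  assumes "l \<in> {i..<d}"
  shows "regular_on q (d - 1) S (\<lambda>x. W x l)"
  using assms by (cases "Suc l = d") (auto simp: w_coord_def regular_on_const intro!: regular_on_coord)

lemma regular_on_lpoly:
  assumes "k \<le> m" "regular_on q (d - 1) S f" "regular_on q (d - 1) S g"
  shows "regular_on q (d - 1) S (\<lambda>x. lpoly q d (W x) k (f x) (g x))"
  using assms
proof (induction k arbitrary: f g)
  case (Suc k)
  have "regular_on q (d - 1) S (\<lambda>x. lpoly q d (W x) k (W x (d - Suc k)) 1)"
    using Suc.prems(1) i_bounds by (intro Suc.IH regular_on_w regular_on_const) auto
  moreover have "regular_on q (d - 1) S (\<lambda>x. lpoly q d (W x) k (f x) (g x))"
    using Suc.prems by (intro Suc.IH) auto
  ultimately show ?case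
    unfolding lpoly.simps using Suc.prems
    by (intro regular_on_diff regular_on_mult regular_on_power) auto
qed simp

lemma regular_on_kappa: "regular_on q (d - 1) S kappa"
  unfolding kappa_def[abs_def]
  using i_bounds by (intro regular_on_power regular_on_lpoly regular_on_w regular_on_const) auto

lemma w_pulled_back: "l \<in> {i..<d} \<Longrightarrow> (\<lambda>x. W x l) \<in> pulled_back"
  by (rule pulled_backI[OF regular_on_w], assumption, rule w_coord_cong) (auto simp: rmap_outer)

lemma kappa_rmap: "kappa (rmap x) = kappa x"
  using lp_cong(2)[of "rmap x" x] rmap_outer by blast

lemma inverse_kappa_pulled_back: "(\<lambda>x. 1 / kappa x) \<in> pulled_back"
  by (rule pulled_backI[of "\<lambda>x. 1 / kappa x"])
    (intro regular_on_divide regular_on_const regular_on_kappa, auto simp: kappa_rmap target_points_iff kappa_nonzero)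

lemma rmap_pulled_back: "j \<in> {1..d - 1} \<Longrightarrow> (\<lambda>x. rmap x j) \<in> pulled_back"
  by (rule pulled_backI[OF regular_on_coord]) auto

text \<open>The definition of the middle component of \<open>rmap\<close>, read as a monic equation of degree \<open>N\<close> for
  \<open>x i\<close> over the target.\<close>

lemma eta_power:
  assumes "x \<in> source"
  shows "x i ^ N = rmap x i * (1 / kappa x) * lp x 1 (x i)"
  using kappa_nonzero[OF source_facts(1)[OF assms]] lp_1_nonzero[OF source_facts(2)[OF assms]]
  by (simp add: rmap_mid)

lemma N_gt_1: "1 < N" "0 < N"
  using q_gt_1 i_bounds one_less_power[of q m] by auto

text \<open>The coordinate \<open>x i\<close> is adjoined first because it is a parameter of the equations of the others.\<close>

primrec tower :: "nat \<Rightarrow> ((nat \<Rightarrow> 'k) \<Rightarrow> 'k) set"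
  where
    "tower 0 = span pulled_back (\<lambda>x. x i) N"
  | "tower (Suc k) = span (tower k) (\<lambda>x. x (Suc k)) N"

abbreviation "top_ring \<equiv> tower (i - 1)"

lemma tower_subring:
  assumes "k < i"
  shows "subring (tower k) \<and> pulled_back \<subseteq> tower k \<and> (\<lambda>x. x i) \<in> tower k \<and>
    (\<forall>j\<in>{1..k}. (\<lambda>x. x j) \<in> tower k)"
  using assms
proof (induction k)
  case 0
  note B = subring_pulled_back
  have "(\<lambda>x. rmap x i * (1 / kappa x) * lp x 1 (x i)) \<in> tower 0"
    unfolding tower.simps using i_bounds
    by (intro span_scale B lpoly_1_in_span w_pulled_back subring_mult rmap_pulled_back
        inverse_kappa_pulled_back) auto
  then have monic: "(\<lambda>x. x i ^ N) \<in> span pulled_back (\<lambda>x. x i) N"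
    unfolding tower.simps by (rule span_cong) (rule eta_power[symmetric])
  note N = N_gt_1(1)
  show ?case
    using subring_adjoin[OF B _ monic] span_base[OF B, of _ N] span_gpow[OF B N, of "\<lambda>x. x i"] N by auto
next
  case (Suc k)
  then have A: "subring (tower k)" and base: "pulled_back \<subseteq> tower k" and eta: "(\<lambda>x. x i) \<in> tower k"
    and xi: "\<And>j. j \<in> {1..k} \<Longrightarrow> (\<lambda>x. x j) \<in> tower k" by auto
  have W: "(\<lambda>x. W x l) \<in> tower k" if "l \<in> {i..<d}" for l
    using w_pulled_back[OF that] base by blast
  note N = N_gt_1
  have "(\<lambda>x. rmap x (Suc k) * lp x 1 (x i)) \<in> tower k"
    using rmap_pulled_back[of "Suc k"] Suc.prems i_bounds base
    by (intro subring_mult A subring_lpoly W eta subring_const) auto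
  then have "(\<lambda>x. (x (Suc k) ^ N - lp x (x (Suc k)) (x i)) + rmap x (Suc k) * lp x 1 (x i)) \<in> tower (Suc k)"
    unfolding tower.simps
    by (intro span_add A lpoly_monic_in_span W eta span_base N) auto
  then have monic: "(\<lambda>x. x (Suc k) ^ N) \<in> span (tower k) (\<lambda>x. x (Suc k)) N"
    unfolding tower.simps
  proof (rule span_cong)
    fix x assume "x \<in> source"
    then have "rmap x (Suc k) * lp x 1 (x i) = lp x (x (Suc k)) (x i)"
      using Suc.prems i_bounds lp_1_nonzero[OF source_facts(2), of x] by (simp add: rmap_def)
    then show "x (Suc k) ^ N - lp x (x (Suc k)) (x i) + rmap x (Suc k) * lp x 1 (x i) = x (Suc k) ^ N"
      by simp
  qed
  have sub: "tower k \<subseteq> tower (Suc k)"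
    using span_base[OF A _ N(2)] by auto
  moreover have "(\<lambda>x. x (Suc k)) \<in> tower (Suc k)"
    using span_gpow[OF A N(1), of "\<lambda>x. x (Suc k)"] by simp
  moreover have "subring (tower (Suc k))"
    using subring_adjoin[OF A N(2) monic] by simp
  moreover have "{1..Suc k} = insert (Suc k) {1..k}" by auto
  ultimately show ?case
    using base eta xi by auto
qed

lemma subring_top: "subring top_ring"
  and top_pulled_back: "f \<in> pulled_back \<Longrightarrow> f \<in> top_ring"
  and top_eta: "(\<lambda>x. x i) \<in> top_ring"
  and top_w: "l \<in> {i..<d} \<Longrightarrow> (\<lambda>x. W x l) \<in> top_ring"
  using tower_subring[of "i - 1"] w_pulled_back i_bounds by auto

lemma top_coord:
  assumes "k \<in> {1..d - 1}"
  shows "(\<lambda>x. x k) \<in> top_ring"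
proof -
  consider "k \<in> {1..i - 1}" | "k = i" | "k \<in> {Suc i..d - 1}"
    using assms by fastforce
  then show ?thesis
  proof cases
    case 1
    then show ?thesis
      using tower_subring[of "i - 1"] i_bounds by auto
  next
    case 3
    show ?thesis
      by (rule subring_cong[OF subring_top top_pulled_back[OF rmap_pulled_back[OF assms]]])
        (rule rmap_outer[OF 3])
  next
    case 2
    show ?thesis unfolding 2 by (rule top_eta)
  qed
qed

lemma top_xi:
  assumes "j \<in> {1..i}"
  shows "(\<lambda>x. \<Xi> x j) \<in> top_ring"
proof (cases "j = i")
  case True
  have "(\<lambda>x. \<Xi> x j) = (\<lambda>_. 1)"
    using True by (simp add: xi_coord_def)
  then show ?thesis
    using subring_const[OF subring_top Fq_1] by metis
next
  case False
  have "(\<lambda>x. \<Xi> x j) = (\<lambda>x. x j)"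
    using False by (simp add: xi_coord_def)
  moreover have "j \<in> {1..d - 1}"
    using assms i_bounds by auto
  ultimately show ?thesis
    using top_coord[of j] by metis
qed

lemma top_shift: "A \<in> coeffs \<Longrightarrow> j \<in> {1..i} \<Longrightarrow> (\<lambda>x. shift A x j) \<in> top_ring"
  unfolding shift_def
  by (intro subring_sum subring_mult subring_top subring_const top_w) (auto intro: coeffs_Fq)

text \<open>The action involves the inverse of \<open>\<beta> = 1 + \<omega> \<eta>\<close>, where \<open>\<omega> = shift A x i\<close> and \<open>\<eta> = x i\<close>.  Since
  \<open>lp x 1 \<eta> = lp x \<beta> \<eta>\<close>, the equation of \<open>\<eta>\<close> shows that \<open>\<eta> ^ N\<close> is a multiple of \<open>\<beta>\<close>; hence so is
  \<open>1 = \<beta> ^ N - (\<omega> \<eta>) ^ N\<close>.\<close>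

lemma top_inverse_denom:
  assumes A: "A \<in> coeffs"
  shows "(\<lambda>x. 1 / (1 + shift A x i * x i)) \<in> top_ring"
proof -
  define \<beta> where "\<beta> = (\<lambda>x. 1 + shift A x i * x i)"
  have i: "i \<in> {1..i}" using i_bounds by simp
  have \<beta>: "\<beta> \<in> top_ring"
    unfolding \<beta>_def
    by (intro subring_add subring_mult subring_top subring_const top_shift A i top_eta) auto
  obtain s where s: "s \<in> top_ring" "\<And>x. lp x (\<beta> x) (x i) = \<beta> x * s x"
    using subring_lpoly_factor[OF subring_top top_w le_refl \<beta> top_eta] by auto
  have "(\<lambda>x. \<beta> x ^ (N - 1) - shift A x i ^ N * (rmap x i * (1 / kappa x)) * s x) \<in> top_ring"
    using i_bounds
    by (intro subring_diff subring_mult subring_power subring_top \<beta> s top_shift A i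
        top_pulled_back rmap_pulled_back inverse_kappa_pulled_back) auto
  then show ?thesis
  proof (rule subring_cong[OF subring_top])
    fix x assume x: "x \<in> source"
    have "lp x 1 (x i) = \<beta> x * s x"
      using lp_shift[OF A i, of x 1 "x i"] s(2)[of x] by (simp add: \<beta>_def)
    then have e: "x i ^ N = rmap x i * (1 / kappa x) * (\<beta> x * s x)"
      using eta_power[OF x] by simp
    have "1 = (\<beta> x - shift A x i * x i) ^ N"
      by (simp add: \<beta>_def)
    also have "\<dots> = \<beta> x ^ N - shift A x i ^ N * x i ^ N"
      by (simp add: frob_diff power_mult_distrib)
    also have "\<beta> x ^ N = \<beta> x * \<beta> x ^ (N - 1)"
      by (metis power_minus_mult q_pow_pos mult.commute)
    finally have "1 = \<beta> x * (\<beta> x ^ (N - 1) - shift A x i ^ N * (rmap x i * (1 / kappa x)) * s x)"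
      unfolding e by (simp add: algebra_simps)
    then show "\<beta> x ^ (N - 1) - shift A x i ^ N * (rmap x i * (1 / kappa x)) * s x = 1 / (1 + shift A x i * x i)"
      using act_denom_nonzero[OF x A] by (simp add: \<beta>_def eq_divide_eq mult.commute)
  qed
qed

lemma top_act:
  assumes A: "A \<in> coeffs" and f: "f \<in> top_ring"
  shows "(\<lambda>x. f (act A x)) \<in> top_ring"
proof -
  note R = subring_top
  have span_act: "(\<lambda>x. f (act A x)) \<in> top_ring"
    if f: "f \<in> span B g n" and cg: "\<And>c. c \<in> B \<Longrightarrow> (\<lambda>x. c (act A x)) \<in> top_ring" "(\<lambda>x. g (act A x)) \<in> top_ring" for f B g n
  proof -
    obtain c where c: "\<And>a. a < n \<Longrightarrow> c a \<in> B" "\<And>x. x \<in> source \<Longrightarrow> f x = (\<Sum>a<n. c a x * g x ^ a)"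
      using f unfolding span_def by blast
    have "(\<lambda>x. \<Sum>a<n. c a (act A x) * g (act A x) ^ a) \<in> top_ring"
      by (intro subring_sum subring_mult subring_power R cg c) auto
    then show ?thesis
      by (rule subring_cong[OF R]) (simp add: c(2) act_in_source[OF _ A])
  qed
  have base: "(\<lambda>x. f (act A x)) \<in> top_ring" if "f \<in> pulled_back" for f
  proof -
    obtain b where b: "regular_on q (d - 1) T b" "\<forall>x\<in>source. f x = b (rmap x)"
      using \<open>f \<in> pulled_back\<close> unfolding pulled_back_def by blast
    show ?thesis
      by (rule subring_cong[OF R top_pulled_back[OF that]])
        (use b(2) act_in_source[OF _ A] rmap_act[OF _ A] in auto)
  qed
  have eta: "(\<lambda>x. act A x i) \<in> top_ring"
    by (rule subring_cong[OF R subring_mult[OF R top_eta top_inverse_denom[OF A]]]) (simp add: act_mid)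
  have xi: "(\<lambda>x. act A x j) \<in> top_ring" if "j \<in> {1..<i}" for j
  proof (rule subring_cong[OF R])
    show "(\<lambda>x. (\<Xi> x j + shift A x j * x i) * (1 / (1 + shift A x i * x i))) \<in> top_ring"
      using that by (intro subring_mult subring_add R top_xi top_shift A top_eta top_inverse_denom) auto
    fix x assume "x \<in> source"
    then show "(\<Xi> x j + shift A x j * x i) * (1 / (1 + shift A x i * x i)) = act A x j"
      using act_xi[OF _ A, of x j] that by (simp add: xi_coord_def)
  qed
  have "(\<lambda>x. f (act A x)) \<in> top_ring" if "f \<in> tower k" "k < i" for f k
    using that
  proof (induction k arbitrary: f)
    case 0
    then show ?case
      using span_act[of f pulled_back] base eta by simp
  next
    case (Suc k)
    then show ?case
      using span_act[of f "tower k"] xi[of "Suc k"] by simp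
  qed
  then show ?thesis
    using f i_bounds by simp
qed

section \<open>Invariant functions\<close>

text \<open>Subtracting \<open>v\<close> gives a polynomial with more roots than its degree allows.\<close>

lemma constant_on_many_points:
  fixes c :: "nat \<Rightarrow> 'k"
  assumes "card R = n" "0 < n" "\<And>t. t \<in> R \<Longrightarrow> (\<Sum>a<n. c a * t ^ a) = v"
  shows "c 0 = v"
proof -
  have fin: "finite R" using assms(1,2) by (metis card.infinite not_less0)
  define P where "P = (\<Sum>a<n. monom (c a) a) - [:v:]"
  have coeffP: "coeff P k = (if k < n then c k else 0) - coeff [:v:] k" for k
    unfolding P_def by (simp add: coeff_sum)
  have "P = 0"
  proof (rule ccontr)
    assume nz: "P \<noteq> 0"
    have "degree P < n"
      using nz assms(2) coeffP by (intro degree_lessI) (auto simp: coeff_pCons split: nat.splits)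
    moreover have "R \<subseteq> {t. poly P t = 0}"
      using assms(3) by (auto simp: P_def poly_sum poly_monom)
    then have "n \<le> card {t. poly P t = 0}"
      using card_mono[OF poly_roots_finite[OF nz]] assms(1) by blast
    ultimately show False
      using card_poly_roots_bound[OF nz] by linarith
  qed
  then have "coeff P 0 = 0" by simp
  then show ?thesis
    using assms(2) coeffP[of 0] by simp
qed

text \<open>Matrices with a single nonzero row \<open>k\<close> shift a single coordinate; the \<open>N\<close> combinations that they
  add are different by independence.\<close>

definition rows :: "(nat \<Rightarrow> 'k) set"
  where "rows = {i..<d} \<rightarrow>\<^sub>E Fq q"

definition row_coeffs :: "nat \<Rightarrow> (nat \<Rightarrow> 'k) \<Rightarrow> nat \<times> nat \<Rightarrow> 'k"
  where "row_coeffs k a = (\<lambda>p\<in>{1..i} \<times> {i..<d}. if fst p = k then a (snd p) else 0)"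

definition combination :: "(nat \<Rightarrow> 'k) \<Rightarrow> (nat \<Rightarrow> 'k) \<Rightarrow> 'k"
  where "combination x a = (\<Sum>l=i..<d. a l * W x l)"

lemma row_coeffs_in: "a \<in> rows \<Longrightarrow> row_coeffs k a \<in> coeffs"
  by (auto simp: row_coeffs_def rows_def coeffs_def)

lemma shift_row_coeffs:
  "j \<in> {1..i} \<Longrightarrow> shift (row_coeffs k a) x j = (if j = k then combination x a else 0)"
  by (auto simp: shift_def row_coeffs_def combination_def intro!: sum.cong sum.neutral)

lemma card_combinations:
  assumes x: "x \<in> source"
  shows "card (combination x ` rows) = N"
proof -
  have "inj_on (combination x) rows"
  proof (rule inj_onI)
    fix a b assume ab: "a \<in> rows" "b \<in> rows" "combination x a = combination x b"
    define c where "c = (\<lambda>l. if l \<in> {i..<d} then a l - b l else 0)"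
    have mem: "a l \<in> Fq q" "b l \<in> Fq q" if "l \<in> {i..<d}" for l
      using ab(1,2) that unfolding rows_def by (auto dest!: PiE_mem)
    have c: "c l \<in> Fq q" for l
      using mem[of l] by (auto simp: c_def intro!: Fq_diff)
    have "(\<Sum>l=i..<d. c l * W x l) = combination x a - combination x b"
      unfolding combination_def sum_subtractf[symmetric]
      by (intro sum.cong) (auto simp: c_def left_diff_distrib)
    then have "c l = 0" if "l \<in> {i..<d}" for l
      using w_independentD[OF source_facts(1)[OF x], of c l] c that ab(3) by simp
    then have "a l = b l" if "l \<in> {i..<d}" for l
      using that by (force simp: c_def)
    then show "a = b"
      using ab(1,2) unfolding rows_def by (intro PiE_ext) auto
  qed
  moreover have "card rows = N"
    unfolding rows_def by (simp add: card_PiE card_Fq)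
  ultimately show ?thesis
    by (simp add: card_image)
qed

lemma tower_fixed:
  assumes "k < i" "f \<in> tower k" "x \<in> source" "A \<in> coeffs"
    "shift A x i = 0" "\<And>j. j \<in> {1..k} \<Longrightarrow> shift A x j = 0"
  shows "f (act A x) = f x"
  using assms
proof (induction k arbitrary: f)
  case 0
  obtain c where c: "\<And>a. a < N \<Longrightarrow> c a \<in> pulled_back" "\<And>x. x \<in> source \<Longrightarrow> f x = (\<Sum>a<N. c a x * x i ^ a)"
    using 0(2) unfolding tower.simps span_def by blast
  have "c a (act A x) = c a x" if "a < N" for a
    using c(1)[OF that] rmap_act 0 act_in_source unfolding pulled_back_def by auto
  moreover have "act A x i = x i"
    using 0 by (simp add: act_mid)
  ultimately show ?case
    using 0 act_in_source c(2) by simp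
next
  case (Suc k)
  obtain c where c: "\<And>a. a < N \<Longrightarrow> c a \<in> tower k" "\<And>x. x \<in> source \<Longrightarrow> f x = (\<Sum>a<N. c a x * x (Suc k) ^ a)"
    using Suc(3) unfolding tower.simps span_def by blast
  have "c a (act A x) = c a x" if "a < N" for a
    using Suc c(1)[OF that] by auto
  moreover have "act A x (Suc k) = x (Suc k)"
    using Suc i_bounds by (simp add: act_def)
  ultimately show ?case
    using Suc act_in_source c(2) by simp
qed

text \<open>Off the boundary, one generator after the other can be removed from an invariant function: the
  group moves a generator through \<open>N\<close> values while the coefficients stay fixed.\<close>

lemma invariant_off_boundary:
  assumes "k < i" "f \<in> tower k"
    "\<And>x A. x \<in> source \<Longrightarrow> x i \<noteq> 0 \<Longrightarrow> A \<in> coeffs \<Longrightarrow> f (act A x) = f x"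
  shows "\<exists>b\<in>pulled_back. \<forall>x\<in>source. x i \<noteq> 0 \<longrightarrow> f x = b x"
  using assms
proof (induction k arbitrary: f)
  case 0
  obtain c where c: "\<And>a. a < N \<Longrightarrow> c a \<in> pulled_back" "\<And>x. x \<in> source \<Longrightarrow> f x = (\<Sum>a<N. c a x * x i ^ a)"
    using 0(2) unfolding tower.simps span_def by blast
  have "f x = c 0 x" if x: "x \<in> source" "x i \<noteq> 0" for x
  proof -
    let ?R = "(\<lambda>w. x i / (1 + w * x i)) ` combination x ` rows"
    have "inj_on (\<lambda>w. x i / (1 + w * x i)) (combination x ` rows)"
    proof (rule inj_onI)
      fix u v assume "u \<in> combination x ` rows" "v \<in> combination x ` rows"
        and eq: "x i / (1 + u * x i) = x i / (1 + v * x i)"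
      then obtain a b where ab: "a \<in> rows" "b \<in> rows" "u = combination x a" "v = combination x b" by blast
      have "1 + u * x i \<noteq> 0" "1 + v * x i \<noteq> 0"
        using act_denom_nonzero[OF x(1) row_coeffs_in, of _ i] ab i_bounds
        by (auto simp: shift_row_coeffs)
      then show "u = v"
        using eq x(2) by (simp add: frac_eq_eq)
    qed
    then have card: "card ?R = N"
      using card_combinations[OF x(1)] by (simp add: card_image)
    have val: "(\<Sum>a<N. c a x * t ^ a) = f x" if tR: "t \<in> ?R" for t
    proof -
      obtain r where r: "r \<in> rows" "t = x i / (1 + combination x r * x i)"
        using tR by blast
      define A where "A = row_coeffs i r"
      have A: "A \<in> coeffs" using r by (simp add: A_def row_coeffs_in)
      have t: "act A x i = t"
        using r i_bounds by (simp add: act_mid A_def shift_row_coeffs)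
      have "c a (act A x) = c a x" if "a < N" for a
        using c(1)[OF that] rmap_act A x act_in_source unfolding pulled_back_def by auto
      then have "f (act A x) = (\<Sum>a<N. c a x * t ^ a)"
        using c(2)[OF act_in_source[OF x(1) A]] t by simp
      then show ?thesis
        using 0(3)[OF x A] by simp
    qed
    show ?thesis
      using constant_on_many_points[of ?R N "\<lambda>a. c a x" "f x", OF card _ val] by simp
  qed
  then show ?case
    using c(1)[of 0] by auto
next
  case (Suc k)
  obtain c where c: "\<And>a. a < N \<Longrightarrow> c a \<in> tower k" "\<And>x. x \<in> source \<Longrightarrow> f x = (\<Sum>a<N. c a x * x (Suc k) ^ a)"
    using Suc(3) unfolding tower.simps span_def by blast
  have eq: "f x = c 0 x" if x: "x \<in> source" "x i \<noteq> 0" for x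
  proof -
    let ?R = "(\<lambda>w. x (Suc k) + w * x i) ` combination x ` rows"
    have "inj_on (\<lambda>w. x (Suc k) + w * x i) (combination x ` rows)"
      using x(2) by (auto intro!: inj_onI)
    then have card: "card ?R = N"
      using card_combinations[OF x(1)] by (simp add: card_image)
    have val: "(\<Sum>a<N. c a x * t ^ a) = f x" if tR: "t \<in> ?R" for t
    proof -
      obtain r where r: "r \<in> rows" "t = x (Suc k) + combination x r * x i"
        using tR by blast
      define A where "A = row_coeffs (Suc k) r"
      have A: "A \<in> coeffs" using r by (simp add: A_def row_coeffs_in)
      have sh: "shift A x i = 0" "shift A x (Suc k) = combination x r"
        "\<And>j. j \<in> {1..k} \<Longrightarrow> shift A x j = 0"
        using Suc.prems(1) i_bounds by (simp_all add: A_def shift_row_coeffs)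
      have t: "act A x (Suc k) = t"
        using r i_bounds Suc.prems(1) sh by (simp add: act_def)
      have "c a (act A x) = c a x" if "a < N" for a
        using tower_fixed[OF _ c(1)[OF that] x(1) A] sh Suc.prems(1) by auto
      then have "f (act A x) = (\<Sum>a<N. c a x * t ^ a)"
        using c(2)[OF act_in_source[OF x(1) A]] t by simp
      then show ?thesis
        using Suc.prems(3)[OF x A] by simp
    qed
    show ?thesis
      using constant_on_many_points[of ?R N "\<lambda>a. c a x" "f x", OF card _ val] by simp
  qed
  have "\<exists>b\<in>pulled_back. \<forall>x\<in>source. x i \<noteq> 0 \<longrightarrow> c 0 x = b x"
  proof (rule Suc.IH)
    fix x A assume x: "x \<in> source" "x i \<noteq> 0" and A: "A \<in> coeffs"
    have "act A x i \<noteq> 0"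
      using x act_denom_nonzero[OF x(1) A] by (simp add: act_mid)
    then show "c 0 (act A x) = c 0 x"
      using eq[OF x] eq[OF act_in_source[OF x(1) A]] Suc.prems(3)[OF x A] by simp
  qed (use Suc.prems c(1)[of 0] in auto)
  then show ?case
    using eq by auto
qed

section \<open>Regularity and density\<close>

lemma infinite_field: "infinite (UNIV :: 'k set)"
proof
  assume fin: "finite (UNIV :: 'k set)"
  define P where "P = (\<Prod>a\<in>UNIV. [:- a, 1:] :: 'k poly)"
  have deg: "degree P = card (UNIV :: 'k set)"
    unfolding P_def by (subst degree_prod_eq_sum_degree) auto
  then have "degree P > 0"
    using fin by (simp add: finite_UNIV_card_ge_0)
  then have "degree (P + 1) > 0"
    by (simp add: degree_add_eq_left)
  then obtain r where "poly (P + 1) r = 0"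
    using alg_closed_imp_poly_has_root by blast
  moreover have "poly P r = 0"
    unfolding P_def poly_prod using fin by (intro prod_zero) auto
  ultimately show False by simp
qed

lemma regular_on_rmap:
  assumes j: "j \<in> {1..d - 1}"
  shows "regular_on q (d - 1) source (\<lambda>x. rmap x j)"
proof -
  have eta: "regular_on q (d - 1) source (\<lambda>x. x i)"
    by (rule regular_on_coord) (rule i_bounds(10))
  have one: "regular_on q (d - 1) source (\<lambda>_. 1)"
    by (rule regular_on_const) simp
  have xj: "regular_on q (d - 1) source (\<lambda>x. x j)"
    by (rule regular_on_coord[OF j])
  note lp1 = regular_on_lpoly[OF le_refl one eta] and lpj = regular_on_lpoly[OF le_refl xj eta]
  consider "j < i" | "j = i" | "j > i" by linarith
  then show ?thesis
  proof cases
    case 1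
    have "regular_on q (d - 1) source (\<lambda>x. lp x (x j) (x i) / lp x 1 (x i))"
      by (intro regular_on_divide lpj lp1 lp_1_nonzero source_facts)
    then show ?thesis
      using 1 j by (simp add: rmap_def)
  next
    case 2
    have "regular_on q (d - 1) source (\<lambda>x. kappa x * x i ^ N / lp x 1 (x i))"
      by (intro regular_on_divide lp1 lp_1_nonzero source_facts regular_on_mult regular_on_power eta regular_on_kappa)
    then show ?thesis
      using 2 j by (simp add: rmap_def)
  next
    case 3
    then show ?thesis
      using xj j by (simp add: rmap_def)
  qed
qed

lemma pulled_back_regular: "regular_on q (d - 1) T b \<Longrightarrow> regular_on q (d - 1) source (\<lambda>x. b (rmap x))"
  by (rule regular_on_compose[OF _ rmap_in_target regular_on_rmap])

lemma tower_regular: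
  assumes "k < i" "f \<in> tower k"
  shows "regular_on q (d - 1) source f"
proof -
  have span_reg: "regular_on q (d - 1) source f"
    if f: "f \<in> span B g n" and B: "\<And>c. c \<in> B \<Longrightarrow> regular_on q (d - 1) source c"
      and g: "regular_on q (d - 1) source g" for f B g n
  proof -
    obtain c where c: "\<And>a. a < n \<Longrightarrow> c a \<in> B" "\<And>x. x \<in> source \<Longrightarrow> f x = (\<Sum>a<n. c a x * g x ^ a)"
      using f unfolding span_def by blast
    have "regular_on q (d - 1) source (\<lambda>x. \<Sum>a<n. c a x * g x ^ a)"
      by (intro regular_on_sum regular_on_mult regular_on_power g B c) auto
    then show ?thesis
      using regular_on_cong[of source f] c(2) by simp
  qed
  have base: "regular_on q (d - 1) source f" if fb: "f \<in> pulled_back" for f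
  proof -
    obtain b where b: "regular_on q (d - 1) T b" "\<And>x. x \<in> source \<Longrightarrow> f x = b (rmap x)"
      using fb unfolding pulled_back_def by blast
    show ?thesis
      using regular_on_cong[of source f, OF b(2)] pulled_back_regular[OF b(1)] by blast
  qed
  show ?thesis
    using assms
  proof (induction k arbitrary: f)
    case 0
    then show ?case
      using span_reg[OF _ base regular_on_coord[OF i_bounds(10)]] by simp
  next
    case (Suc k)
    have "Suc k \<in> {1..d - 1}"
      using Suc.prems(1) i_bounds by auto
    then show ?case
      using span_reg[OF _ Suc.IH regular_on_coord, of f "tower k"] Suc.prems by simp
  qed
qed

text \<open>The complement of the boundary is dense: each line in the direction of the \<open>i\<close>-th coordinate
  through a boundary point leaves the source in finitely many points only.\<close>

lemma finitely_many_bad: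
  assumes x: "x \<in> source" and x0: "x i = 0"
  shows "finite {s. x(i := s) \<notin> source}"
proof -
  define F where "F = ({1..i} \<rightarrow>\<^sub>E (Fq q :: 'k set)) \<times> rows"
  have "finite F"
    unfolding F_def rows_def by (intro finite_cartesian_product finite_PiE) (auto simp: finite_Fq)
  moreover have "{s. x(i := s) \<notin> source} \<subseteq>
      (\<lambda>(a, b). (\<Sum>j=1..i. a j * \<Xi> x j) / combination x b) ` F"
  proof
    fix s assume "s \<in> {s. x(i := s) \<notin> source}"
    then have ns: "x(i := s) \<notin> source" by simp
    have ext: "x(i := s) \<in> extensional {1..d - 1}"
      using source_facts(3)[OF x] i_bounds(10) by (auto simp: extensional_def)
    have w: "w_independent (x(i := s))"
      using lp_cong(3)[of "x(i := s)" x] source_facts(1)[OF x] by simp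
    have Wc: "W (x(i := s)) l = W x l" if "l \<in> {i..<d}" for l
      by (rule w_coord_cong[OF _ that]) auto
    have Xc: "\<Xi> (x(i := s)) j = \<Xi> x j" for j
      by (simp add: xi_coord_def)
    have "\<not> xi_independent (x(i := s))"
      using ns ext w by (simp add: source_def)
    then obtain a b j where ab0: "\<forall>l. a l \<in> Fq q" "\<forall>l. b l \<in> Fq q" "j \<in> {1..i}" "a j \<noteq> 0"
      "(\<Sum>j=1..i. a j * \<Xi> (x(i := s)) j) = (x(i := s)) i * (\<Sum>l=i..<d. b l * W (x(i := s)) l)"
      unfolding xi_independent_def by blast
    have "(\<Sum>l=i..<d. b l * W (x(i := s)) l) = (\<Sum>l=i..<d. b l * W x l)"
      by (intro sum.cong) (simp_all add: Wc)
    with ab0 have ab: "\<And>l. a l \<in> Fq q" "\<And>l. b l \<in> Fq q" "j \<in> {1..i}" "a j \<noteq> 0"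
      "(\<Sum>j=1..i. a j * \<Xi> x j) = s * (\<Sum>l=i..<d. b l * W x l)"
      by (simp_all add: Xc)
    have nz: "(\<Sum>j=1..i. a j * \<Xi> x j) \<noteq> 0"
    proof
      assume "(\<Sum>j=1..i. a j * \<Xi> x j) = 0"
      then have "(\<Sum>j=1..i. a j * \<Xi> x j) = x i * (\<Sum>l=i..<d. b l * W x l)"
        using x0 by simp
      from xi_independentD[OF source_facts(2)[OF x] ab(1,2) this ab(3)] ab(4) show False by simp
    qed
    define a' b' where "a' = restrict a {1..i}" and "b' = restrict b {i..<d}"
    have "(a', b') \<in> F"
      using ab(1,2) by (auto simp: F_def a'_def b'_def rows_def)
    moreover have "combination x b' = (\<Sum>l=i..<d. b l * W x l)"
      "(\<Sum>j=1..i. a' j * \<Xi> x j) = (\<Sum>j=1..i. a j * \<Xi> x j)"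
      unfolding combination_def a'_def b'_def by (auto intro!: sum.cong)
    then have "s = (\<Sum>j=1..i. a' j * \<Xi> x j) / combination x b'"
      using ab(5) nz by auto
    ultimately show "s \<in> (\<lambda>(a, b). (\<Sum>j=1..i. a j * \<Xi> x j) / combination x b) ` F"
      by force
  qed
  ultimately show ?thesis
    by (rule finite_surj)
qed

lemma density:
  assumes F: "regular_on q (d - 1) source F" and off: "\<And>x. x \<in> source \<Longrightarrow> x i \<noteq> 0 \<Longrightarrow> F x = 0"
    and x: "x \<in> source"
  shows "F x = 0"
proof (cases "x i = 0")
  case True
  obtain g h where gh: "peval h x \<noteq> 0" "\<And>z. z \<in> source \<Longrightarrow> peval h z \<noteq> 0 \<Longrightarrow> F z = peval g z / peval h z"
    using F x unfolding regular_on_def by blast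
  obtain P where P: "\<And>s. peval g (x(i := s)) = poly P s"
    using peval_line by blast
  obtain Q where Q: "\<And>s. peval h (x(i := s)) = poly Q s"
    using peval_line by blast
  have x0: "x(i := 0) = x"
    using True by auto
  have Q0: "poly Q 0 \<noteq> 0"
    using Q[of 0] gh(1) unfolding x0 by simp
  have "poly (P * Q) s = 0" if "x(i := s) \<in> source" "s \<noteq> 0" for s
  proof (cases "poly Q s = 0")
    case False
    then show ?thesis
      using gh(2)[OF that(1)] off[OF that(1)] that(2) P Q by simp
  qed simp
  then have "UNIV \<subseteq> {s. x(i := s) \<notin> source} \<union> {0} \<union> {s. poly (P * Q) s = 0}"
    by auto
  then have "infinite {s. poly (P * Q) s = 0}"
    using infinite_field finitely_many_bad[OF x True] by (meson finite.emptyI finite_UnI finite_insert infinite_super)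
  then have "P * Q = 0"
    using poly_roots_finite by blast
  then have "poly P 0 = 0"
    using Q0 by auto
  then show ?thesis
    using gh(2)[OF x gh(1)] P[of 0] unfolding x0 by simp
qed (use off x in simp)

text \<open>The ring functions are regular on the whole source, so equality off the boundary extends.\<close>

lemma invariant_pulled_back:
  assumes f: "f \<in> top_ring" and inv: "\<And>x A. x \<in> source \<Longrightarrow> A \<in> coeffs \<Longrightarrow> f (act A x) = f x"
  shows "f \<in> pulled_back"
proof -
  have lt: "i - 1 < i"
    using i_ge_1 by simp
  obtain b where b: "b \<in> pulled_back" "\<And>x. x \<in> source \<Longrightarrow> x i \<noteq> 0 \<Longrightarrow> f x = b x"
    using invariant_off_boundary[OF lt f inv] by blast
  have "(\<lambda>x. f x - b x) \<in> top_ring"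
    by (intro subring_diff subring_top f top_pulled_back b)
  then have "regular_on q (d - 1) source (\<lambda>x. f x - b x)"
    by (rule tower_regular[OF lt])
  then have "f x - b x = 0" if "x \<in> source" for x
    using density[of "\<lambda>x. f x - b x"] b(2) that by simp
  then show ?thesis
    using b(1) by (intro subring_cong[OF subring_pulled_back b(1)]) simp
qed

definition coeffs_add :: "(nat \<times> nat \<Rightarrow> 'k) \<Rightarrow> (nat \<times> nat \<Rightarrow> 'k) \<Rightarrow> nat \<times> nat \<Rightarrow> 'k"
  where "coeffs_add A B = (\<lambda>p\<in>{1..i} \<times> {i..<d}. A p + B p)"

lemma act_prod_invariant:
  assumes x: "x \<in> source" and B: "B \<in> coeffs"
  shows "(\<Prod>A\<in>coeffs. \<Phi> (act A (act B x))) = (\<Prod>A\<in>coeffs. \<Phi> (act A x) :: 'b::comm_monoid_mult)"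
proof -
  have in_add: "coeffs_add A C \<in> coeffs" if "A \<in> coeffs" "C \<in> coeffs" for A C
    using that by (auto simp: coeffs_add_def coeffs_def intro!: Fq_add dest: PiE_mem)
  define C where "C = (\<lambda>p\<in>{1..i} \<times> {i..<d}. - B p)"
  have C: "C \<in> coeffs"
    using B by (auto simp: C_def coeffs_def intro!: Fq_uminus dest: PiE_mem)
  have inv: "coeffs_add (coeffs_add A B) C = A" "coeffs_add (coeffs_add A C) B = A" if "A \<in> coeffs" for A
    using that unfolding coeffs_add_def C_def coeffs_def by (auto simp: fun_eq_iff restrict_def PiE_def extensional_def)
  have bij: "bij_betw (\<lambda>A. coeffs_add A B) coeffs coeffs"
    by (rule bij_betw_byWitness[where f' = "\<lambda>A. coeffs_add A C"]) (use in_add B C inv in auto)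
  have "(\<Prod>A\<in>coeffs. \<Phi> (act A (act B x))) = (\<Prod>A\<in>coeffs. \<Phi> (act (coeffs_add A B) x))"
    by (intro prod.cong refl arg_cong[where f = \<Phi>] act_act x B in_add) (auto simp: coeffs_add_def)
  also have "\<dots> = (\<Prod>A\<in>coeffs. \<Phi> (act A x))"
    by (rule prod.reindex_bij_betw[OF bij])
  finally show ?thesis .
qed

text \<open>The elements \<open>b\<close> of \<open>top_ring\<close> for which \<open>f b\<close> lies in it form an ideal, stable under the
  group because \<open>f\<close> is invariant.  If \<open>h\<close> is in this ideal and does not vanish at \<open>x0\<close>, the
  nonconstant coefficients of \<open>\<Prod> (1 + h (A x) t)\<close> are invariant elements of the ideal, and one of
  them does not vanish at \<open>x0\<close>, since the product vanishes at \<open>t = - 1 / h x0\<close> but not at 0.  (A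
  product of the conjugates of \<open>h\<close> alone might vanish at \<open>x0\<close>.)\<close>

lemma invariant_denominator:
  assumes f: "regular_on q (d - 1) source f" and inv: "\<And>x A. x \<in> source \<Longrightarrow> A \<in> coeffs \<Longrightarrow> f (act A x) = f x"
    and x0: "x0 \<in> source"
  shows "\<exists>b\<in>pulled_back. b x0 \<noteq> 0 \<and> (\<lambda>x. f x * b x) \<in> pulled_back"
proof -
  note R = subring_top
  obtain g h where gh: "g \<in> Fq_polys q (d - 1)" "h \<in> Fq_polys q (d - 1)" "peval h x0 \<noteq> 0"
    "\<And>z. z \<in> source \<Longrightarrow> peval h z \<noteq> 0 \<Longrightarrow> f z = peval g z / peval h z"
    using f x0 unfolding regular_on_def by blast
  (* f = g / h holds only where h does not vanish; f H = g h holds everywhere. *)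
  define H where "H = (\<lambda>x. peval h x * peval h x)"
  have H: "H \<in> top_ring"
    unfolding H_def by (intro subring_mult subring_peval R gh top_coord)
  have fH: "(\<lambda>x. f x * H x) \<in> top_ring"
  proof (rule subring_cong[OF R])
    show "(\<lambda>x. peval g x * peval h x) \<in> top_ring"
      by (intro subring_mult subring_peval R gh top_coord)
    fix x assume x: "x \<in> source"
    show "peval g x * peval h x = f x * H x"
      using gh(4)[OF x] by (cases "peval h x = 0") (auto simp: H_def)
  qed
  have H0: "H x0 \<noteq> 0"
    using gh(3) by (simp add: H_def)
  define P where "P = (\<lambda>x. \<Prod>A\<in>coeffs. [:1, H (act A x):])"
  have "(\<lambda>x. coeff (\<Prod>A\<in>F. [:1, H (act A x):]) k) \<in> top_ring \<and>
      (k \<ge> 1 \<longrightarrow> (\<lambda>x. f x * coeff (\<Prod>A\<in>F. [:1, H (act A x):]) k) \<in> top_ring)" if "F \<subseteq> coeffs" for F k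
    using finite_subset[OF that finite_coeffs] that
  proof (induction F arbitrary: k rule: finite_induct)
    case empty
    have "(\<lambda>x. coeff 1 k) \<in> top_ring"
      by (rule subring_const[OF R]) (auto simp: coeff_1)
    moreover have "(\<lambda>x. f x * coeff 1 k) \<in> top_ring" if "k \<ge> 1"
      using subring_const[OF R Fq_0] that by (simp add: coeff_1)
    ultimately show ?case by simp
  next
    case (insert A F)
    have A: "A \<in> coeffs" using insert.prems by simp
    have HA: "(\<lambda>x. H (act A x)) \<in> top_ring"
      by (rule top_act[OF A H])
    have fHA: "(\<lambda>x. f x * H (act A x)) \<in> top_ring"
      by (rule subring_cong[OF R top_act[OF A fH]]) (simp add: inv A)
    define p where "p = (\<lambda>x. \<Prod>A\<in>F. [:1, H (act A x):])"
    have IH: "(\<lambda>x. coeff (p x) k) \<in> top_ring" "k \<ge> 1 \<Longrightarrow> (\<lambda>x. f x * coeff (p x) k) \<in> top_ring" for k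
      using insert.IH[of k] insert.prems by (auto simp: p_def)
    have co: "coeff (\<Prod>A\<in>insert A F. [:1, H (act A x):]) k =
        coeff (p x) k + (if k = 0 then 0 else H (act A x) * coeff (p x) (k - 1))" for x
      using insert.hyps by (cases k) (simp_all add: p_def)
    show ?case
    proof (cases "k = 0")
      case True
      then show ?thesis
        unfolding co using IH(1)[of 0] by simp
    next
      case False
      have "(\<lambda>x. coeff (p x) k + H (act A x) * coeff (p x) (k - 1)) \<in> top_ring"
        by (intro subring_add subring_mult R HA IH)
      moreover have "(\<lambda>x. f x * coeff (p x) k + (f x * H (act A x)) * coeff (p x) (k - 1)) \<in> top_ring"
        using False by (intro subring_add subring_mult R fHA IH) auto
      ultimately show ?thesis
        unfolding co using False by (simp add: distrib_left mult.assoc)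
    qed
  qed
  then have co: "(\<lambda>x. coeff (P x) k) \<in> top_ring" "k \<ge> 1 \<Longrightarrow> (\<lambda>x. f x * coeff (P x) k) \<in> top_ring" for k
    unfolding P_def by auto
  have Pinv: "P (act B x) = P x" if "x \<in> source" "B \<in> coeffs" for x B
    unfolding P_def by (rule act_prod_invariant[OF that])
  have "\<exists>k\<ge>1. coeff (P x0) k \<noteq> 0"
  proof (rule ccontr)
    assume "\<not> ?thesis"
    then have z: "coeff (P x0) k = 0" if "k \<ge> 1" for k
      using that by blast
    obtain Z where Z: "Z \<in> coeffs" "act Z x0 = x0"
      using act_zero[OF x0] by blast
    have "poly (P x0) (- 1 / H x0) = (\<Prod>A\<in>coeffs. 1 + - 1 / H x0 * H (act A x0))"
      unfolding P_def poly_prod by simp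
    also have "\<dots> = 0"
      using Z H0 finite_coeffs by (intro prod_zero bexI[of _ Z]) auto
    finally have root: "poly (P x0) (- 1 / H x0) = 0" .
    have "poly (P x0) 0 = 1"
      unfolding P_def poly_prod by simp
    then have "coeff (P x0) 0 = 1"
      by (simp add: poly_0_coeff_0)
    then have "P x0 = 1"
      using z by (intro poly_eqI) (auto simp: coeff_1 Suc_le_eq)
    then show False using root by simp
  qed
  then obtain k where k: "k \<ge> 1" "coeff (P x0) k \<noteq> 0" by blast
  have "(\<lambda>x. coeff (P x) k) \<in> pulled_back" "(\<lambda>x. f x * coeff (P x) k) \<in> pulled_back"
    using k by (auto intro!: invariant_pulled_back co simp: Pinv inv)
  with k(2) show ?thesis
    by (intro bexI[of _ "\<lambda>x. coeff (P x) k"] conjI)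
qed

text \<open>The quotient of \<open>f b\<close> by \<open>b\<close>, both pulled back, is a local expression for the function on the
  target.\<close>

lemma invariant_descends:
  assumes f: "regular_on q (d - 1) source f" and inv: "\<And>x A. x \<in> source \<Longrightarrow> A \<in> coeffs \<Longrightarrow> f (act A x) = f x"
    and g: "\<And>x. x \<in> source \<Longrightarrow> g (rmap x) = f x"
  shows "regular_on q (d - 1) T g"
proof (rule regular_on_local_quotient)
  fix z assume "z \<in> T"
  then obtain x0 where x0: "x0 \<in> source" "rmap x0 = z"
    using rmap_surjective by blast
  obtain b where b: "b \<in> pulled_back" "b x0 \<noteq> 0" "(\<lambda>x. f x * b x) \<in> pulled_back"
    using invariant_denominator[OF f inv x0(1)] by blast
  obtain b1 where b1: "regular_on q (d - 1) T b1" "\<And>x. x \<in> source \<Longrightarrow> b x = b1 (rmap x)"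
    using b(1) unfolding pulled_back_def by blast
  obtain b2 where b2: "regular_on q (d - 1) T b2" "\<And>x. x \<in> source \<Longrightarrow> f x * b x = b2 (rmap x)"
    using b(3) unfolding pulled_back_def by blast
  have "g w * b1 w = b2 w" if w: "w \<in> T" for w
  proof -
    obtain x where "x \<in> source" "rmap x = w"
      using rmap_surjective[OF w] by blast
    then show ?thesis
      using g[of x] b1(2)[of x] b2(2)[of x] by simp
  qed
  moreover have "b1 z \<noteq> 0"
    using b1(2)[OF x0(1)] b(2) x0(2) by simp
  ultimately show "\<exists>G H. regular_on q (d - 1) T G \<and> regular_on q (d - 1) T H \<and> H z \<noteq> 0 \<and>
    (\<forall>w\<in>T. H w \<noteq> 0 \<longrightarrow> g w * H w = G w)"
    using b1(1) b2(1) by blast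
qed

end

section \<open>Matrices and flags\<close>

lemma GL_iff: "(g::'k::field mat) \<in> carrier (GL d) \<longleftrightarrow> g \<in> carrier_mat d d \<and> det g \<noteq> 0"
  using det_non_zero_imp_unit[of g d "()"] unit_imp_det_non_zero[of g d "()"]
  by (auto simp: GL_def units_of_def Units_def ring_mat_simps)

lemma GL_group: "group (GL d :: 'k::field mat monoid)"
  unfolding GL_def by (rule monoid.units_group) (rule ring.is_monoid, rule ring_mat)

lemma GL_mult: "x \<otimes>\<^bsub>GL d\<^esub> y = x * (y::'k::field mat)"
  and GL_one: "\<one>\<^bsub>GL d\<^esub> = (1\<^sub>m d :: 'k mat)"
  by (auto simp: GL_def units_of_def ring_mat_simps)

lemma GL_inv:
  assumes "(g::'k::field mat) \<in> carrier (GL d)"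
  shows "inv\<^bsub>GL d\<^esub> g \<in> carrier (GL d)" "inv\<^bsub>GL d\<^esub> g * g = 1\<^sub>m d" "g * inv\<^bsub>GL d\<^esub> g = 1\<^sub>m d"
proof -
  interpret group "GL d :: 'k mat monoid" by (rule GL_group)
  show "inv\<^bsub>GL d\<^esub> g \<in> carrier (GL d)" "inv\<^bsub>GL d\<^esub> g * g = 1\<^sub>m d" "g * inv\<^bsub>GL d\<^esub> g = 1\<^sub>m d"
    using assms l_inv[of g] r_inv[of g] by (auto simp: GL_mult GL_one)
qed

lemma GL_carrier_mat: "(g::'k::field mat) \<in> carrier (GL d) \<Longrightarrow> g \<in> carrier_mat d d"
  by (simp add: GL_iff)

lemma GL_prod: "(g::'k::field mat) \<in> carrier (GL d) \<Longrightarrow> h \<in> carrier (GL d) \<Longrightarrow> g * h \<in> carrier (GL d)"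
  using monoid.m_closed[OF group.is_monoid[OF GL_group]] by (metis GL_mult)

lemma GL_inv_vec:
  assumes "(g::'k::field mat) \<in> carrier (GL d)" "v \<in> carrier_vec d"
  shows "inv\<^bsub>GL d\<^esub> g *\<^sub>v (g *\<^sub>v v) = v" "g *\<^sub>v (inv\<^bsub>GL d\<^esub> g *\<^sub>v v) = v"
proof -
  note gc = GL_carrier_mat[OF assms(1)] and gic = GL_carrier_mat[OF GL_inv(1)[OF assms(1)]]
  show "inv\<^bsub>GL d\<^esub> g *\<^sub>v (g *\<^sub>v v) = v"
    unfolding assoc_mult_mat_vec[OF gic gc assms(2), symmetric] GL_inv(2)[OF assms(1)] using assms(2) by simp
  show "g *\<^sub>v (inv\<^bsub>GL d\<^esub> g *\<^sub>v v) = v"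
    unfolding assoc_mult_mat_vec[OF gc gic assms(2), symmetric] GL_inv(3)[OF assms(1)] using assms(2) by simp
qed

lemma GL_inj: "(g::'k::field mat) \<in> carrier (GL d) \<Longrightarrow> v \<in> carrier_vec d \<Longrightarrow> w \<in> carrier_vec d \<Longrightarrow>
    g *\<^sub>v v = g *\<^sub>v w \<Longrightarrow> v = w"
  by (metis GL_inv_vec(1))

text \<open>The \<open>j\<close>-th subspace of the flag of \<open>g\<close>.\<close>

definition col_span :: "'k::field mat \<Rightarrow> nat \<Rightarrow> 'k vec set"
  where "col_span g j = (\<lambda>v. g *\<^sub>v v) ` std_subspace (dim_row g) j"

lemma std_subspace_carrier: "v \<in> std_subspace d j \<Longrightarrow> v \<in> carrier_vec d"
  by (simp add: std_subspace_def)

lemma std_subspace_mono: "j \<le> j' \<Longrightarrow> std_subspace d j \<subseteq> std_subspace d j'"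
  by (auto simp: std_subspace_def)

lemma std_subspace_full: "std_subspace d d = carrier_vec d"
  by (auto simp: std_subspace_def)

lemma std_subspace_unit: "c < j \<Longrightarrow> c < d \<Longrightarrow> unit_vec d c \<in> std_subspace d j"
  by (auto simp: std_subspace_def)

lemma std_subspace_comb:
  "v \<in> std_subspace d j \<Longrightarrow> w \<in> std_subspace d j \<Longrightarrow> v + a \<cdot>\<^sub>v w \<in> std_subspace d j"
  by (auto simp: std_subspace_def)

lemma mat_vec_index:
  "(g::'k::field mat) \<in> carrier_mat d d \<Longrightarrow> v \<in> carrier_vec d \<Longrightarrow> r < d \<Longrightarrow>
    (g *\<^sub>v v) $ r = (\<Sum>c<d. g $$ (r, c) * v $ c)"
  by (auto simp: scalar_prod_def lessThan_atLeast0 intro!: sum.cong)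

lemma mat_unit_vec:
  assumes "(g::'k::field mat) \<in> carrier_mat d d" "c < d"
  shows "g *\<^sub>v unit_vec d c = col g c"
proof (rule eq_vecI)
  fix r assume "r < dim_vec (col g c)"
  then have r: "r < d" using assms by simp
  have "(g *\<^sub>v unit_vec d c) $ r = (\<Sum>l<d. g $$ (r, l) * unit_vec d c $ l)"
    by (rule mat_vec_index) (use assms r in auto)
  also have "\<dots> = (\<Sum>l<d. if l = c then g $$ (r, l) else 0)"
    by (intro sum.cong) (use assms in auto)
  finally show "(g *\<^sub>v unit_vec d c) $ r = col g c $ r"
    using assms r by simp
qed (use assms in simp)

context
  fixes d :: nat
begin

lemma col_span_eq: "(g::'k::field mat) \<in> carrier (GL d) \<Longrightarrow> col_span g j = (\<lambda>v. g *\<^sub>v v) ` std_subspace d j"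
  by (auto simp: col_span_def dest!: GL_carrier_mat)

lemma col_span_carrier: "(g::'k::field mat) \<in> carrier (GL d) \<Longrightarrow> v \<in> col_span g j \<Longrightarrow> v \<in> carrier_vec d"
  by (auto simp: col_span_eq std_subspace_carrier dest!: GL_carrier_mat)

lemma col_span_mono: "(g::'k::field mat) \<in> carrier (GL d) \<Longrightarrow> j \<le> j' \<Longrightarrow> col_span g j \<subseteq> col_span g j'"
  using std_subspace_mono[of j j' d] by (auto simp: col_span_eq)

lemma col_span_full: "(g::'k::field mat) \<in> carrier (GL d) \<Longrightarrow> col_span g d = carrier_vec d"
proof -
  assume g: "g \<in> carrier (GL d)"
  have "v \<in> col_span g d" if "v \<in> carrier_vec d" for v
    unfolding col_span_eq[OF g] std_subspace_full
    by (rule image_eqI[of _ _ "inv\<^bsub>GL d\<^esub> g *\<^sub>v v"])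
      (use GL_inv_vec(2)[OF g that] mult_mat_vec_carrier[OF GL_carrier_mat[OF GL_inv(1)[OF g]] that] in auto)
  then show ?thesis
    using col_span_carrier[OF g] by blast
qed

lemma col_in_span: "(g::'k::field mat) \<in> carrier (GL d) \<Longrightarrow> c < j \<Longrightarrow> c < d \<Longrightarrow> col g c \<in> col_span g j"
  using mat_unit_vec[of g d c] std_subspace_unit[of c j d] GL_carrier_mat[of g d]
  by (force simp: col_span_eq)

lemma col_span_comb:
  assumes g: "(g::'k::field mat) \<in> carrier (GL d)" and "v \<in> col_span g j" "w \<in> col_span g j"
  shows "v + a \<cdot>\<^sub>v w \<in> col_span g j"
proof -
  obtain v' w' where vw: "v' \<in> std_subspace d j" "v = g *\<^sub>v v'" "w' \<in> std_subspace d j" "w = g *\<^sub>v w'"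
    using assms by (auto simp: col_span_eq)
  have "v + a \<cdot>\<^sub>v w = g *\<^sub>v (v' + a \<cdot>\<^sub>v w')"
    using vw GL_carrier_mat[OF g] std_subspace_carrier
    by (subst mult_add_distrib_mat_vec) (auto simp: mult_mat_vec)
  then show ?thesis
    using std_subspace_comb[OF vw(1,3)] by (simp add: col_span_eq[OF g])
qed

lemma col_span_smult:
  assumes g: "(g::'k::field mat) \<in> carrier (GL d)" and v: "v \<in> col_span g j"
  shows "a \<cdot>\<^sub>v v \<in> col_span g j"
proof -
  have "v + (a - 1) \<cdot>\<^sub>v v \<in> col_span g j"
    by (rule col_span_comb[OF g v v])
  moreover have "v + (a - 1) \<cdot>\<^sub>v v = a \<cdot>\<^sub>v v"
    using col_span_carrier[OF g v] by (intro eq_vecI) (auto simp: algebra_simps)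
  ultimately show ?thesis by simp
qed

lemma col_span_mult:
  assumes g: "(g::'k::field mat) \<in> carrier (GL d)" and h: "h \<in> carrier (GL d)"
  shows "col_span (g * h) j = (\<lambda>v. g *\<^sub>v v) ` col_span h j"
  unfolding col_span_eq[OF h] col_span_eq[OF GL_prod[OF g h]] image_image
  by (intro image_cong refl assoc_mult_mat_vec) (use GL_carrier_mat[OF g] GL_carrier_mat[OF h] std_subspace_carrier in auto)

subsection \<open>The Borel subgroup\<close>

lemma borel_GL: "(b::'k::field mat) \<in> borel d \<Longrightarrow> b \<in> carrier (GL d)"
  by (simp add: borel_def)

lemma borel_diag:
  assumes "(b::'k::field mat) \<in> borel d" "r < d"
  shows "b $$ (r, r) \<noteq> 0"
proof
  assume "b $$ (r, r) = 0"
  moreover have "b \<in> carrier_mat d d" "upper_triangular b" "det b \<noteq> 0"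
    using assms(1) by (auto simp: borel_def GL_iff)
  ultimately have "0 \<in> set (diag_mat b)"
    using assms(2) by (auto simp: diag_mat_def intro!: image_eqI[of _ _ r])
  then show False
    using upper_triangular_imp_det_eq_0_iff[of b d] \<open>b \<in> carrier_mat d d\<close> \<open>upper_triangular b\<close> \<open>det b \<noteq> 0\<close>
    by simp
qed

lemma borel_below: "(b::'k::field mat) \<in> borel d \<Longrightarrow> r < d \<Longrightarrow> c < r \<Longrightarrow> b $$ (r, c) = 0"
  by (auto simp: borel_def GL_iff upper_triangular_def)

lemma borelI:
  "(b::'k::field mat) \<in> carrier (GL d) \<Longrightarrow> (\<And>r c. r < d \<Longrightarrow> c < r \<Longrightarrow> b $$ (r, c) = 0) \<Longrightarrow> b \<in> borel d"
  by (auto simp: borel_def GL_iff upper_triangular_def)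

lemma borelI_mat:
  assumes "(b::'k::field mat) \<in> carrier_mat d d" "\<And>r c. r < d \<Longrightarrow> c < r \<Longrightarrow> b $$ (r, c) = 0"
    "\<And>r. r < d \<Longrightarrow> b $$ (r, r) \<noteq> 0"
  shows "b \<in> borel d"
proof (rule borelI)
  have "upper_triangular b"
    using assms(1,2) by (auto simp: upper_triangular_def)
  moreover have "0 \<notin> set (diag_mat b)"
    using assms(1,3) by (auto simp: diag_mat_def)
  ultimately have "det b \<noteq> 0"
    using upper_triangular_imp_det_eq_0_iff[OF assms(1)] by simp
  then show "b \<in> carrier (GL d)"
    using assms(1) by (simp add: GL_iff)
qed (use assms in auto)

lemma borel_std_subspace:
  assumes b: "(b::'k::field mat) \<in> borel d" and v: "v \<in> std_subspace d j"
  shows "b *\<^sub>v v \<in> std_subspace d j"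
proof -
  have bc: "b \<in> carrier_mat d d" using b by (auto simp: borel_def GL_iff)
  have "(b *\<^sub>v v) $ r = 0" if "r \<in> {j..<d}" for r
  proof -
    have "(b *\<^sub>v v) $ r = (\<Sum>c<d. b $$ (r, c) * v $ c)"
      by (rule mat_vec_index) (use bc v std_subspace_carrier that in auto)
    also have "\<dots> = 0"
    proof (rule sum.neutral, rule ballI)
      fix c assume "c \<in> {..<d}"
      then show "b $$ (r, c) * v $ c = 0"
        using that v borel_below[OF b, of r c] by (cases "c < j") (auto simp: std_subspace_def)
    qed
    finally show ?thesis .
  qed
  then show ?thesis
    using mult_mat_vec_carrier[OF bc std_subspace_carrier[OF v]] by (simp add: std_subspace_def)
qed

lemma borel_inv:
  assumes b: "(b::'k::field mat) \<in> borel d"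
  shows "inv\<^bsub>GL d\<^esub> b \<in> borel d"
proof (rule borelI)
  note G = borel_GL[OF b]
  define c where "c = inv\<^bsub>GL d\<^esub> b"
  show "inv\<^bsub>GL d\<^esub> b \<in> carrier (GL d)" by (rule GL_inv(1)[OF G])
  then have cc: "c \<in> carrier_mat d d" by (simp add: c_def GL_iff)
  have bc: "b \<in> carrier_mat d d" using G by (simp add: GL_iff)
  have bc1: "b * c = 1\<^sub>m d" using GL_inv(3)[OF G] by (simp add: c_def)
  fix r s assume rs: "r < d" "s < r"
  show "(inv\<^bsub>GL d\<^esub> b) $$ (r, s) = 0"
  proof (rule ccontr)
    assume nz: "(inv\<^bsub>GL d\<^esub> b) $$ (r, s) \<noteq> 0"
    define t where "t = Max {t. t < d \<and> c $$ (t, s) \<noteq> 0}"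
    have fin: "finite {t. t < d \<and> c $$ (t, s) \<noteq> 0}" by simp
    have "r \<in> {t. t < d \<and> c $$ (t, s) \<noteq> 0}" using nz rs by (simp add: c_def)
    then have t: "t < d" "c $$ (t, s) \<noteq> 0" "r \<le> t"
      using Max_in[OF fin] Max_ge[OF fin] unfolding t_def by blast+
    have above: "c $$ (l, s) = 0" if "t < l" "l < d" for l
      using Max_ge[OF fin, of l] that unfolding t_def by fastforce
    have "(b * c) $$ (t, s) = (\<Sum>l<d. b $$ (t, l) * c $$ (l, s))"
      using bc cc t rs by (auto simp: scalar_prod_def lessThan_atLeast0 intro!: sum.cong)
    also have "\<dots> = (\<Sum>l<d. if l = t then b $$ (t, t) * c $$ (t, s) else 0)"
    proof (rule sum.cong, rule refl)
      fix l assume "l \<in> {..<d}"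
      then show "b $$ (t, l) * c $$ (l, s) = (if l = t then b $$ (t, t) * c $$ (t, s) else 0)"
        using borel_below[OF b t(1), of l] above[of l] by (cases l t rule: linorder_cases) auto
    qed
    also have "\<dots> = b $$ (t, t) * c $$ (t, s)"
      using t by simp
    finally have "(b * c) $$ (t, s) \<noteq> 0"
      using t borel_diag[OF b t(1)] by simp
    moreover have "(b * c) $$ (t, s) = 0"
      unfolding bc1 using t rs by simp
    ultimately show False by simp
  qed
qed

lemma borel_one: "(1\<^sub>m d :: 'k::field mat) \<in> borel d"
  by (rule borelI) (auto simp: GL_iff)

lemma borel_mult:
  assumes "(b::'k::field mat) \<in> borel d" "c \<in> borel d"
  shows "b * c \<in> borel d"
proof (rule borelI)
  show "b * c \<in> carrier (GL d)"
    using assms by (intro GL_prod borel_GL)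
  fix r s assume "r < d" "s < r"
  moreover have "b \<in> carrier_mat d d" "c \<in> carrier_mat d d"
    using assms by (auto simp: borel_def GL_iff)
  ultimately have "(b * c) $$ (r, s) = (\<Sum>l<d. b $$ (r, l) * c $$ (l, s))"
    by (auto simp: scalar_prod_def lessThan_atLeast0 intro!: sum.cong)
  also have "\<dots> = 0"
  proof (rule sum.neutral, rule ballI)
    fix l assume "l \<in> {..<d}"
    then show "b $$ (r, l) * c $$ (l, s) = 0"
      using borel_below[OF assms(1), of r l] borel_below[OF assms(2), of l s] \<open>r < d\<close> \<open>s < r\<close>
      by (cases "l < r") auto
  qed
  finally show "(b * c) $$ (r, s) = 0" .
qed

lemma borel_subgroup: "subgroup (borel d :: 'k::field mat set) (GL d)"
  by (rule group.subgroupI[OF GL_group])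
    (use borel_GL borel_one borel_inv borel_mult in \<open>auto simp: GL_mult\<close>)

lemma coset_mem: "(h::'k::field mat) \<in> g <#\<^bsub>GL d\<^esub> borel d \<longleftrightarrow> (\<exists>b\<in>borel d. h = g * b)"
  by (auto simp: l_coset_def GL_mult)

lemma coset_refl: "(g::'k::field mat) \<in> carrier (GL d) \<Longrightarrow> g \<in> g <#\<^bsub>GL d\<^esub> borel d"
  unfolding coset_mem by (intro bexI[of _ "1\<^sub>m d"] borel_one) (simp add: right_mult_one_mat[OF GL_carrier_mat])

lemma coset_eq: "(g::'k::field mat) \<in> carrier (GL d) \<Longrightarrow> h \<in> g <#\<^bsub>GL d\<^esub> borel d \<Longrightarrow>
    g <#\<^bsub>GL d\<^esub> borel d = h <#\<^bsub>GL d\<^esub> borel d"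
  using group.l_repr_independence[OF GL_group _ _ borel_subgroup] by blast

lemma col_span_borel:
  assumes b: "(b::'k::field mat) \<in> borel d"
  shows "col_span b j = std_subspace d j"
proof
  note G = borel_GL[OF b]
  show "col_span b j \<subseteq> std_subspace d j"
    using borel_std_subspace[OF b] by (auto simp: col_span_eq[OF G])
  show "std_subspace d j \<subseteq> col_span b j"
  proof
    fix v :: "'k vec" assume v: "v \<in> std_subspace d j"
    then have "inv\<^bsub>GL d\<^esub> b *\<^sub>v v \<in> std_subspace d j"
      by (rule borel_std_subspace[OF borel_inv[OF b]])
    moreover have "b *\<^sub>v (inv\<^bsub>GL d\<^esub> b *\<^sub>v v) = v"
      using GL_inv_vec(2)[OF G std_subspace_carrier[OF v]] .
    ultimately show "v \<in> col_span b j"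
      unfolding col_span_eq[OF G] by (metis imageI)
  qed
qed

lemma col_span_coset:
  assumes "(g::'k::field mat) \<in> carrier (GL d)" "h \<in> g <#\<^bsub>GL d\<^esub> borel d"
  shows "col_span h j = col_span g j"
proof -
  obtain b where b: "b \<in> borel d" "h = g * b"
    using assms(2) by (auto simp: coset_mem)
  then show ?thesis
    using col_span_mult[OF assms(1) borel_GL[OF b(1)]] col_span_borel[OF b(1)] col_span_eq[OF assms(1)]
    by simp
qed

text \<open>A flag contains another one subspace by subspace only if they are equal; it suffices to check
  columns.\<close>

lemma coset_eqI:
  assumes g: "(g::'k::field mat) \<in> carrier (GL d)" and h: "h \<in> carrier (GL d)"
    and cols: "\<And>c. c < d \<Longrightarrow> col h c \<in> col_span g (Suc c)"
  shows "g <#\<^bsub>GL d\<^esub> borel d = h <#\<^bsub>GL d\<^esub> borel d"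
proof -
  define b where "b = inv\<^bsub>GL d\<^esub> g * h"
  note gi = GL_inv[OF g] and gc = GL_carrier_mat[OF g] and hc = GL_carrier_mat[OF h]
  have gic: "inv\<^bsub>GL d\<^esub> g \<in> carrier_mat d d" by (rule GL_carrier_mat[OF gi(1)])
  have bG: "b \<in> carrier (GL d)"
    unfolding b_def by (rule GL_prod[OF gi(1) h])
  have "b \<in> borel d"
  proof (rule borelI[OF bG])
    fix r c assume rc: "r < d" "c < r"
    then obtain u where u: "u \<in> std_subspace d (Suc c)" "col h c = g *\<^sub>v u"
      using cols[of c] by (auto simp: col_span_eq[OF g])
    have "col b c = inv\<^bsub>GL d\<^esub> g *\<^sub>v col h c"
      unfolding b_def using rc by (intro col_mult2[OF gic hc]) auto
    also have "\<dots> = u"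
      unfolding u(2) by (rule GL_inv_vec(1)[OF g std_subspace_carrier[OF u(1)]])
    finally have "col b c $ r = 0"
      using u(1) rc by (auto simp: std_subspace_def)
    then show "b $$ (r, c) = 0"
      using rc GL_carrier_mat[OF bG] by simp
  qed
  moreover have "g * b = h"
    unfolding b_def assoc_mult_mat[OF gc gic hc, symmetric] gi(3) using hc by simp
  ultimately have "h \<in> g <#\<^bsub>GL d\<^esub> borel d"
    by (auto simp: coset_mem)
  then show ?thesis
    by (rule coset_eq[OF g])
qed

lemma coset_eq_spanI:
  assumes g: "(g::'k::field mat) \<in> carrier (GL d)" and h: "h \<in> carrier (GL d)"
    and "\<And>j. j \<le> d \<Longrightarrow> col_span h j = col_span g j"
  shows "g <#\<^bsub>GL d\<^esub> borel d = h <#\<^bsub>GL d\<^esub> borel d"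
proof (rule coset_eqI[OF g h])
  fix c assume "c < d"
  then show "col h c \<in> col_span g (Suc c)"
    using col_in_span[OF h, of c "Suc c"] assms(3)[of "Suc c"] by simp
qed

subsection \<open>Relative positions\<close>

lemma swap_GL:
  assumes "1 \<le> k" "k < d"
  shows "(swaprows_mat d (k - 1) k :: 'k::field mat) \<in> carrier (GL d)"
proof -
  have "k - 1 < d" "k - 1 \<noteq> k"
    using assms by auto
  then have "det (swaprows_mat d (k - 1) k) = (- 1 :: 'k)"
    using assms(2) by (intro det_swaprows_mat)
  then show ?thesis by (simp add: GL_iff)
qed

lemma swap_col:
  assumes "1 \<le> k" "k < d" "(g::'k::field mat) \<in> carrier_mat d d" "c < d"
  shows "col (g * swaprows_mat d (k - 1) k) c = col g (if c = k then k - 1 else if c = k - 1 then k else c)"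
  using assms swapcols_mat[OF assms(3), of "k - 1" k, symmetric] by (intro eq_vecI) auto

lemma swap_std_subspace:
  assumes k: "1 \<le> k" "k < d" and j: "j \<noteq> k"
  shows "col_span (swaprows_mat d (k - 1) k :: 'k::field mat) j = std_subspace d j"
proof -
  let ?s = "swaprows_mat d (k - 1) k :: 'k mat"
  note G = swap_GL[OF k, where 'k = 'k]
  have sub: "?s *\<^sub>v v \<in> std_subspace d j" if v: "v \<in> std_subspace d j" for v
  proof -
    have "(?s *\<^sub>v v) $ r = 0" if r: "r \<in> {j..<d}" for r
    proof -
      have "(?s *\<^sub>v v) $ r = (\<Sum>c<d. ?s $$ (r, c) * v $ c)"
        by (rule mat_vec_index) (use G v std_subspace_carrier r in \<open>auto simp: GL_iff\<close>)
      also have "\<dots> = 0"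
      proof (rule sum.neutral, rule ballI)
        fix c assume c: "c \<in> {..<d}"
        show "?s $$ (r, c) * v $ c = 0"
          using v r c k j by (cases "c < j") (auto simp: std_subspace_def)
      qed
      finally show ?thesis .
    qed
    then show ?thesis
      using mult_mat_vec_carrier[OF GL_carrier_mat[OF G] std_subspace_carrier[OF v]]
      by (simp add: std_subspace_def)
  qed
  have "std_subspace d j \<subseteq> col_span ?s j"
  proof
    fix v :: "'k vec" assume v: "v \<in> std_subspace d j"
    have "?s *\<^sub>v (?s *\<^sub>v v) = v"
      using swaprows_mat_inv[of "k - 1" d k, where 'a = 'k] k std_subspace_carrier[OF v]
      by (subst assoc_mult_mat_vec[symmetric, of _ d d _ d]) auto
    then show "v \<in> col_span ?s j"
      unfolding col_span_eq[OF G] using sub[OF v] by (metis imageI)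
  qed
  moreover have "col_span ?s j \<subseteq> std_subspace d j"
    unfolding col_span_eq[OF G] using sub by blast
  ultimately show ?thesis by blast
qed

lemma bruhat_cell_mem:
  "(r::'k::field mat) \<in> bruhat_cell d k \<longleftrightarrow> (\<exists>b\<in>borel d. \<exists>c\<in>borel d. r = b * swaprows_mat d (k - 1) k * c)"
  by (auto simp: bruhat_cell_def set_mult_def GL_mult)

text \<open>This turns relative positions into statements about subspaces, to which the Frobenius map and
  linear forms apply.\<close>

lemma bruhat_cell_span:
  assumes k: "1 \<le> k" "k < d" and r: "(r::'k::field mat) \<in> bruhat_cell d k"
  shows "j \<noteq> k \<Longrightarrow> col_span r j = std_subspace d j" "\<not> col_span r k \<subseteq> std_subspace d k"
proof -
  let ?s = "swaprows_mat d (k - 1) k :: 'k mat"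
  obtain b c where bc: "b \<in> borel d" "c \<in> borel d" "r = b * ?s * c"
    using r by (auto simp: bruhat_cell_mem)
  note s = swap_GL[OF k, where 'k = 'k]
  note G = borel_GL[OF bc(1)] borel_GL[OF bc(2)] GL_prod[OF borel_GL[OF bc(1)] s]
  have span: "col_span r j = (\<lambda>v. b *\<^sub>v v) ` col_span ?s j" for j
    unfolding bc(3) col_span_mult[OF G(3,2)] col_span_borel[OF bc(2)] col_span_eq[OF G(3), symmetric]
    by (rule col_span_mult[OF G(1) s])
  show "col_span r j = std_subspace d j" if "j \<noteq> k"
    unfolding span swap_std_subspace[OF k that] col_span_eq[OF G(1), symmetric]
    by (rule col_span_borel[OF bc(1)])
  show "\<not> col_span r k \<subseteq> std_subspace d k"
  proof
    assume sub: "col_span r k \<subseteq> std_subspace d k"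
    have "col ?s (k - 1) \<in> col_span ?s k"
      using k by (intro col_in_span[OF s]) auto
    moreover have "col ?s (k - 1) = unit_vec d k"
      using k by (intro eq_vecI) auto
    ultimately have "b *\<^sub>v unit_vec d k \<in> col_span r k"
      unfolding span by auto
    then have "col b k \<in> std_subspace d k"
      using sub mat_unit_vec[OF GL_carrier_mat[OF G(1)] k(2)] by auto
    then have "b $$ (k, k) = 0"
      using k GL_carrier_mat[OF G(1)] by (auto simp: std_subspace_def)
    then show False
      using borel_diag[OF bc(1) k(2)] by simp
  qed
qed

lemma rel_pos_mult:
  assumes "(g k::'k::field mat) \<in> carrier (GL d)" "g (k + 1) \<in> carrier (GL d)"
  shows "rel_pos d g k \<in> carrier (GL d)" "g (k + 1) = g k * rel_pos d g k"
proof -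
  show "rel_pos d g k \<in> carrier (GL d)"
    unfolding rel_pos_def GL_mult using assms by (intro GL_prod GL_inv)
  show "g (k + 1) = g k * rel_pos d g k"
    unfolding rel_pos_def GL_mult
      assoc_mult_mat[OF GL_carrier_mat[OF assms(1)] GL_carrier_mat[OF GL_inv(1)[OF assms(1)]]
        GL_carrier_mat[OF assms(2)], symmetric] GL_inv(3)[OF assms(1)]
    using GL_carrier_mat[OF assms(2)] by simp
qed

lemma rel_pos_borel_span:
  assumes "(g k::'k::field mat) \<in> carrier (GL d)" "g (k + 1) \<in> carrier (GL d)" "rel_pos d g k \<in> borel d"
  shows "col_span (g (k + 1)) j = col_span (g k) j"
  using rel_pos_mult[OF assms(1,2)] assms col_span_mult col_span_borel col_span_eq by metis

lemma rel_pos_cell_span: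
  assumes k: "1 \<le> k" "k < d" and g: "(g k::'k::field mat) \<in> carrier (GL d)" "g (k + 1) \<in> carrier (GL d)"
    and r: "rel_pos d g k \<in> bruhat_cell d k"
  shows "j \<noteq> k \<Longrightarrow> col_span (g (k + 1)) j = col_span (g k) j"
    "\<not> col_span (g (k + 1)) k \<subseteq> col_span (g k) k"
proof -
  have span: "col_span (g (k + 1)) j = (\<lambda>v. g k *\<^sub>v v) ` col_span (rel_pos d g k) j" for j
    using rel_pos_mult[of g k] g col_span_mult by metis
  show "j \<noteq> k \<Longrightarrow> col_span (g (k + 1)) j = col_span (g k) j"
    unfolding span using bruhat_cell_span(1)[OF k r] col_span_eq[OF g(1)] by simp
  show "\<not> col_span (g (k + 1)) k \<subseteq> col_span (g k) k"
  proof
    assume sub: "col_span (g (k + 1)) k \<subseteq> col_span (g k) k"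
    have "v \<in> std_subspace d k" if v: "v \<in> col_span (rel_pos d g k) k" for v
    proof -
      have vc: "v \<in> carrier_vec d"
        by (rule col_span_carrier[OF rel_pos_mult(1)[of g k] v]) (use g in auto)
      have "g k *\<^sub>v v \<in> col_span (g k) k"
        using sub v unfolding span by blast
      then obtain w where w: "w \<in> std_subspace d k" "g k *\<^sub>v v = g k *\<^sub>v w"
        unfolding col_span_eq[OF g(1)] by blast
      then show ?thesis
        using GL_inj[OF g(1) vc std_subspace_carrier[OF w(1)]] by simp
    qed
    then show False
      using bruhat_cell_span(2)[OF k r] by blast
  qed
qed

text \<open>A gallery of flags that crosses the walls in \<open>J\<close>: the \<open>j\<close>-th subspace only changes at step
  \<open>j\<close>.\<close>

definition crosses :: "nat set \<Rightarrow> (nat \<Rightarrow> 'k::field mat) \<Rightarrow> bool"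
  where "crosses J g \<longleftrightarrow> (\<forall>k\<in>{1..d - 1}. (k \<in> J \<longrightarrow> rel_pos d g k \<in> bruhat_cell d k) \<and>
    (k \<notin> J \<longrightarrow> rel_pos d g k \<in> borel d))"

text \<open>The \<open>j\<close>-th subspace of the \<open>k\<close>-th flag is that of the first flag up to \<open>k = j\<close>, and that of the
  last flag afterwards.\<close>

lemma crosses_span:
  assumes c: "crosses J g" and g: "\<And>k. k \<in> {1..d} \<Longrightarrow> (g k::'k::field mat) \<in> carrier (GL d)" and k: "k \<in> {1..d}"
  shows "k \<le> j \<Longrightarrow> col_span (g k) j = col_span (g 1) j"
    "j < k \<Longrightarrow> col_span (g k) j = col_span (g d) j"
proof -
  have step: "col_span (g (Suc k)) j = col_span (g k) j" if "k \<in> {1..<d}" "j \<noteq> k" for k j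
  proof (cases "k \<in> J")
    case True
    then show ?thesis
      using c rel_pos_cell_span(1)[of k g j] g[of k] g[of "Suc k"] that unfolding crosses_def by auto
  next
    case False
    then show ?thesis
      using c rel_pos_borel_span[of g k j] g[of k] g[of "Suc k"] that unfolding crosses_def by auto
  qed
  show "col_span (g k) j = col_span (g 1) j" if "k \<le> j"
  proof -
    have "1 \<le> k" using k by simp
    then show ?thesis
      using that k
    proof (induction k rule: dec_induct)
      case (step n)
      then show ?case
        using \<open>\<And>k j. k \<in> {1..<d} \<Longrightarrow> j \<noteq> k \<Longrightarrow> col_span (g (Suc k)) j = col_span (g k) j\<close>[of n j] by simp
    qed simp
  qed
  show "col_span (g k) j = col_span (g d) j" if "j < k"
  proof -
    have "k \<le> d" using k by simp
    then show ?thesis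
      using that k
    proof (induction k rule: inc_induct)
      case (step n)
      then show ?case
        using \<open>\<And>k j. k \<in> {1..<d} \<Longrightarrow> j \<noteq> k \<Longrightarrow> col_span (g (Suc k)) j = col_span (g k) j\<close>[of n j] by simp
    qed simp
  qed
qed

lemma crosses_last:
  assumes c: "crosses J g" and g: "\<And>k. k \<in> {1..d} \<Longrightarrow> (g k::'k::field mat) \<in> carrier (GL d)"
    and j: "j \<in> {1..d - 1}"
  shows "j \<in> J \<Longrightarrow> \<not> col_span (g d) j \<subseteq> col_span (g 1) j"
    "j \<notin> J \<Longrightarrow> col_span (g d) j = col_span (g 1) j"
proof -
  have s: "col_span (g j) j = col_span (g 1) j" "col_span (g (Suc j)) j = col_span (g d) j"
    using crosses_span[OF c g, of j j] crosses_span[OF c g, of "Suc j" j] j by auto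
  have jd: "1 \<le> j" "j < d" using j by auto
  have gj: "g j \<in> carrier (GL d)" "g (j + 1) \<in> carrier (GL d)"
    using g[of j] g[of "j + 1"] j by auto
  show "\<not> col_span (g d) j \<subseteq> col_span (g 1) j" if "j \<in> J"
    using rel_pos_cell_span(2)[of j g, OF jd gj] c that j s unfolding crosses_def by auto
  show "col_span (g d) j = col_span (g 1) j" if "j \<notin> J"
    using rel_pos_borel_span[OF gj, of j] c that j s unfolding crosses_def by auto
qed

lemma crosses_shift:
  assumes c: "crosses J g" and g: "\<And>k. k \<in> {1..d} \<Longrightarrow> (g k::'k::field mat) \<in> carrier (GL d)"
    and j: "j \<in> {1..d}"
  shows "col_span (g d) (j - 1) \<subseteq> col_span (g 1) j"
proof -
  have "col_span (g d) (j - 1) = col_span (g j) (j - 1)"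
    using crosses_span(2)[OF c g j, of "j - 1"] j by simp
  also have "\<dots> \<subseteq> col_span (g j) j"
    by (rule col_span_mono[OF g[OF j]]) simp
  also have "\<dots> = col_span (g 1) j"
    using crosses_span(1)[OF c g j, of j] by simp
  finally show ?thesis .
qed

end

section \<open>Flags and the Frobenius map\<close>

text \<open>The linear form with coefficients \<open>a\<close>; for \<open>a\<close> over the finite field its kernel is a rational
  hyperplane.\<close>

definition row_value :: "nat \<Rightarrow> (nat \<Rightarrow> 'k::field) \<Rightarrow> 'k vec \<Rightarrow> 'k"
  where "row_value d a v = (\<Sum>r<d. a r * v $ r)"

context frobenius
begin

definition frob_vec :: "'k vec \<Rightarrow> 'k vec"
  where "frob_vec v = map_vec (\<lambda>a. a ^ q) v"

lemma frob_hom: "comm_ring_hom (\<lambda>a::'k. a ^ q)"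
  by unfold_locales (auto simp: frob1_add power_mult_distrib power_0_left)

lemma frob_GL: "(g::'k mat) \<in> carrier (GL d) \<Longrightarrow> frob q g \<in> carrier (GL d)"
  using comm_ring_hom.hom_det[OF frob_hom, of g] by (auto simp: GL_iff frob_def)

lemma frob_mult: "(g::'k mat) \<in> carrier_mat d d \<Longrightarrow> h \<in> carrier_mat d d \<Longrightarrow> frob q (g * h) = frob q g * frob q h"
  using semiring_hom.mat_hom_mult[OF comm_ring_hom.axioms(1)[THEN ring_hom.axioms(1)], OF frob_hom, of g d d h d]
  by (simp add: frob_def)

lemma frob_vec_carrier [simp]: "frob_vec v \<in> carrier_vec d \<longleftrightarrow> v \<in> carrier_vec d"
  by (auto simp: frob_vec_def)

lemma frob_vec_index: "r < dim_vec v \<Longrightarrow> frob_vec v $ r = v $ r ^ q"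
  by (simp add: frob_vec_def)

lemma frob_mult_vec:
  assumes "(g::'k mat) \<in> carrier_mat d d" "v \<in> carrier_vec d"
  shows "frob_vec (g *\<^sub>v v) = frob q g *\<^sub>v frob_vec v"
proof (rule eq_vecI)
  fix r assume "r < dim_vec (frob q g *\<^sub>v frob_vec v)"
  then have r: "r < d" using assms by (simp add: frob_def)
  have "frob_vec (g *\<^sub>v v) $ r = (\<Sum>c<d. g $$ (r, c) * v $ c) ^ q"
    using mat_vec_index[OF assms r] r assms by (simp add: frob_vec_index)
  also have "\<dots> = (\<Sum>c<d. frob q g $$ (r, c) * frob_vec v $ c)"
    unfolding frob1_sum using assms r
    by (intro sum.cong) (auto simp: frob_def frob_vec_index power_mult_distrib)
  also have "\<dots> = (frob q g *\<^sub>v frob_vec v) $ r"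
    by (rule mat_vec_index[symmetric]) (use assms r in \<open>auto simp: frob_def\<close>)
  finally show "frob_vec (g *\<^sub>v v) $ r = (frob q g *\<^sub>v frob_vec v) $ r" .
qed (use assms in \<open>auto simp: frob_vec_def frob_def\<close>)

lemma frob_std_subspace: "frob_vec (v::'k vec) \<in> std_subspace d j \<longleftrightarrow> v \<in> std_subspace d j"
  using q_gt_1 by (auto simp: std_subspace_def frob_vec_index)

lemma frob_vec_surj: "\<exists>w. frob_vec w = (v::'k vec)"
proof -
  obtain f where f: "\<And>x::'k. f x ^ q = x"
    using frob_root[of 1] by (simp only: power_one_right) metis
  then have "frob_vec (map_vec f v) = v"
    by (intro eq_vecI) (auto simp: frob_vec_def)
  then show ?thesis by blast
qed

lemma col_span_frob:
  assumes g: "(g::'k mat) \<in> carrier (GL d)"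
  shows "col_span (frob q g) j = frob_vec ` col_span g j"
proof
  note gc = GL_carrier_mat[OF g]
  show "col_span (frob q g) j \<subseteq> frob_vec ` col_span g j"
  proof
    fix v assume "v \<in> col_span (frob q g) j"
    then obtain u where u: "u \<in> std_subspace d j" "v = frob q g *\<^sub>v u"
      by (auto simp: col_span_eq[OF frob_GL[OF g]])
    obtain w where w: "frob_vec w = u" using frob_vec_surj by blast
    then have "w \<in> std_subspace d j" using u(1) frob_std_subspace[of w d j] by simp
    moreover have "v = frob_vec (g *\<^sub>v w)"
      using frob_mult_vec[OF gc std_subspace_carrier[OF \<open>w \<in> std_subspace d j\<close>]] u w by simp
    ultimately show "v \<in> frob_vec ` col_span g j"
      by (auto simp: col_span_eq[OF g])
  qed
  show "frob_vec ` col_span g j \<subseteq> col_span (frob q g) j"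
  proof
    fix v assume "v \<in> frob_vec ` col_span g j"
    then obtain u where u: "u \<in> std_subspace d j" "v = frob_vec (g *\<^sub>v u)"
      by (auto simp: col_span_eq[OF g])
    have "v = frob q g *\<^sub>v frob_vec u"
      unfolding u(2) by (rule frob_mult_vec[OF gc std_subspace_carrier[OF u(1)]])
    then show "v \<in> col_span (frob q g) j"
      unfolding col_span_eq[OF frob_GL[OF g]] using u(1) frob_std_subspace[of u d j] by blast
  qed
qed

lemma row_value_frob:
  assumes "\<And>r. a r \<in> Fq q" "v \<in> carrier_vec d"
  shows "row_value d a (frob_vec v) = row_value d a (v::'k vec) ^ q"
  unfolding row_value_def frob1_sum using assms
  by (intro sum.cong) (auto simp: frob_vec_index power_mult_distrib Fq_def)

text \<open>Independence over the finite field makes the rows of a Moore matrix independent: a shortest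
  relation, with a coefficient normalised to 1, is fixed by the Frobenius map.\<close>

lemma moore_independent:
  assumes "finite J" and "\<And>a. (\<And>j. a j \<in> Fq q) \<Longrightarrow> (\<Sum>j\<in>J. a j * v j) = 0 \<Longrightarrow> \<forall>j\<in>J. a j = (0::'k)"
    and "\<And>k. k \<in> {n..<n + card J} \<Longrightarrow> (\<Sum>j\<in>J. a j * v j ^ (q ^ k)) = (0::'k)"
  shows "\<forall>j\<in>J. a j = 0"
  using assms
proof (induction "card J" arbitrary: J n a)
  case 0
  then show ?case by simp
next
  case (Suc s)
  show ?case
  proof (rule ccontr)
    assume "\<not> ?case"
    then obtain j0 where j0: "j0 \<in> J" "a j0 \<noteq> 0" by blast
    define b where "b = (\<lambda>j. a j / a j0)"
    have rel: "(\<Sum>j\<in>J. b j * v j ^ (q ^ k)) = 0" if "k \<in> {n..<n + card J}" for k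
      using Suc.prems(3)[OF that] by (simp add: b_def sum_divide_distrib[symmetric])
    define J' where "J' = J - {j0}"
    have card: "s = card J'" and finJ': "finite J'"
      using Suc.hyps(2) Suc.prems(1) j0 by (auto simp: J'_def)
    have rel': "(\<Sum>j\<in>J'. (b j ^ q - b j) * v j ^ (q ^ k)) = 0" if k: "k \<in> {Suc n..<Suc n + card J'}" for k
    proof -
      have "k - 1 \<in> {n..<n + card J}" "k \<in> {n..<n + card J}" "Suc (k - 1) = k"
        using k card Suc.hyps(2) by auto
      then have "(\<Sum>j\<in>J. b j * v j ^ (q ^ (k - 1))) ^ q = 0" "(\<Sum>j\<in>J. b j * v j ^ (q ^ k)) = 0"
        using rel q_gt_1 by (simp_all add: power_0_left)
      moreover have "(\<Sum>j\<in>J. b j * v j ^ (q ^ (k - 1))) ^ q = (\<Sum>j\<in>J. b j ^ q * v j ^ (q ^ k))"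
        unfolding frob1_sum power_mult_distrib power_mult[symmetric] power_Suc2[symmetric]
          \<open>Suc (k - 1) = k\<close> ..
      ultimately have "(\<Sum>j\<in>J. (b j ^ q - b j) * v j ^ (q ^ k)) = 0"
        using q_gt_1 by (simp add: left_diff_distrib sum_subtractf power_0_left)
      moreover have "b j0 ^ q - b j0 = 0"
        using j0 by (simp add: b_def)
      ultimately show ?thesis
        using Suc.prems(1) j0 by (simp add: J'_def sum.remove)
    qed
    have "\<forall>j\<in>J'. b j ^ q - b j = 0"
    proof (rule Suc.hyps(1)[OF card finJ' _ rel'])
      fix c assume c: "\<And>j. c j \<in> Fq q" "(\<Sum>j\<in>J'. c j * v j) = 0"
      define c' where "c' = c(j0 := 0)"
      have "(\<Sum>j\<in>J'. c' j * v j) = (\<Sum>j\<in>J'. c j * v j)"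
        by (intro sum.cong) (auto simp: c'_def J'_def)
      then have "(\<Sum>j\<in>J. c' j * v j) = 0"
        using Suc.prems(1) j0 c(2) by (simp add: J'_def sum.remove c'_def)
      moreover have "\<And>j. c' j \<in> Fq q" using c(1) by (simp add: c'_def)
      ultimately have "\<forall>j\<in>J. c' j = 0" using Suc.prems(2) by blast
      moreover have "c' j = c j" if "j \<in> J'" for j
        using that by (simp add: c'_def J'_def)
      ultimately show "\<forall>j\<in>J'. c j = 0" by (auto simp: J'_def)
    qed
    then have bq: "b j \<in> Fq q" if "j \<in> J" for j
      using that j0 by (cases "j = j0") (auto simp: J'_def Fq_def b_def)
    define b' where "b' = (\<lambda>j. if j \<in> J then b j else 0)"
    have b': "b' j \<in> Fq q" for j using bq by (simp add: b'_def)
    have "(\<Sum>j\<in>J. b' j * v j) ^ (q ^ n) = (\<Sum>j\<in>J. b j * v j ^ (q ^ n))"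
      unfolding frob_sum power_mult_distrib Fq_frob[OF b'] by (intro sum.cong) (auto simp: b'_def)
    also have "\<dots> = 0"
      using rel[of n] Suc.hyps(2) by simp
    finally have "(\<Sum>j\<in>J. b' j * v j) = 0" by simp
    then have "\<forall>j\<in>J. b' j = 0" using Suc.prems(2) b' by blast
    then have "b j0 = 0" using j0 by (auto simp: b'_def)
    then show False using j0 by (simp add: b_def)
  qed
qed

definition gallery :: "nat \<Rightarrow> nat set \<Rightarrow> (nat \<Rightarrow> 'k mat) \<Rightarrow> 'k flag_tuple \<Rightarrow> bool"
  where "gallery d J g c \<longleftrightarrow> represents q d g c \<and> crosses d J g"

lemma gallery_GL: "gallery d J g c \<Longrightarrow> k \<in> {1..d} \<Longrightarrow> g k \<in> carrier (GL d)"
  by (auto simp: gallery_def represents_def)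

lemma gallery_coset: "gallery d J g c \<Longrightarrow> k \<in> {1..d} \<Longrightarrow> c k = g k <#\<^bsub>GL d\<^esub> borel d"
  by (auto simp: gallery_def represents_def)

lemma gallery_last:
  assumes "gallery d J g c" "d \<ge> 1"
  shows "col_span (g d) j = frob_vec ` col_span (g 1) j"
proof -
  have G: "g 1 \<in> carrier (GL d)" "g d \<in> carrier (GL d)"
    using assms gallery_GL by auto
  have "c d = frob q (g 1) <#\<^bsub>GL d\<^esub> borel d"
    using assms by (simp add: gallery_def represents_def)
  then have "g d \<in> frob q (g 1) <#\<^bsub>GL d\<^esub> borel d"
    using gallery_coset[OF assms(1), of d] coset_refl[OF G(2)] assms(2) by simp
  then show ?thesis
    using col_span_coset[OF frob_GL[OF G(1)]] col_span_frob[OF G(1)] by simp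
qed

lemma gallery_shift:
  assumes c: "gallery d J g c" and j: "j \<in> {1..d}" and v: "v \<in> col_span (g 1) (j - 1)"
  shows "frob_vec v \<in> col_span (g 1) j"
proof -
  have "d \<ge> 1" using j by simp
  then have "frob_vec v \<in> col_span (g d) (j - 1)"
    using gallery_last[OF c] v by blast
  then show ?thesis
    using crosses_shift[of d J g j] gallery_GL[OF c] c j unfolding gallery_def by blast
qed

lemma gallery_wall:
  assumes c: "gallery d J g c" and j: "j \<in> {1..d - 1}"
  shows "j \<in> J \<Longrightarrow> \<not> frob_vec ` col_span (g 1) j \<subseteq> col_span (g 1) j"
    "j \<notin> J \<Longrightarrow> frob_vec ` col_span (g 1) j = col_span (g 1) j"
proof -
  have d: "d \<ge> 1" using j by auto
  show "j \<in> J \<Longrightarrow> \<not> frob_vec ` col_span (g 1) j \<subseteq> col_span (g 1) j"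
    "j \<notin> J \<Longrightarrow> frob_vec ` col_span (g 1) j = col_span (g 1) j"
    using crosses_last[of d J g j] gallery_GL[OF c] c j gallery_last[OF c d] unfolding gallery_def by auto
qed

text \<open>By \<open>crosses_span\<close> every flag is composed of subspaces of the first and of the last flag, which is
  the Frobenius image of the first.\<close>

lemma gallery_unique:
  assumes c: "gallery d J g c" and c': "gallery d J' g' c'" and d: "d \<ge> 1"
    and eq: "g 1 <#\<^bsub>GL d\<^esub> borel d = g' 1 <#\<^bsub>GL d\<^esub> borel d"
  shows "c = c'"
proof (rule extensionalityI[of _ "{1..d}"])
  have span1: "col_span (g 1) j = col_span (g' 1) j" for j
    using col_span_coset[of "g' 1" d "g 1" j] coset_refl[of "g 1" d] eq gallery_GL[OF c, of 1]
      gallery_GL[OF c', of 1] d by auto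
  fix k assume k: "k \<in> {1..d}"
  have "g k <#\<^bsub>GL d\<^esub> borel d = g' k <#\<^bsub>GL d\<^esub> borel d"
  proof (rule coset_eq_spanI[OF gallery_GL[OF c k] gallery_GL[OF c' k]])
    fix j
    show "col_span (g' k) j = col_span (g k) j"
    proof (cases "k \<le> j")
      case True
      then show ?thesis
        using crosses_span(1)[of d J g k j] crosses_span(1)[of d J' g' k j] gallery_GL[OF c] gallery_GL[OF c'] c c' k span1
        unfolding gallery_def by auto
    next
      case False
      then show ?thesis
        using crosses_span(2)[of d J g k j] crosses_span(2)[of d J' g' k j] gallery_GL[OF c] gallery_GL[OF c'] c c' k span1
          gallery_last[OF c d] gallery_last[OF c' d]
        unfolding gallery_def by auto
    qed
  qed
  then show "c k = c' k"
    using gallery_coset[OF c k] gallery_coset[OF c' k] by simp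
qed (use c c' in \<open>auto simp: gallery_def represents_def\<close>)

lemma col_span_Suc:
  assumes g: "(g::'k mat) \<in> carrier (GL d)" and n: "n < d" and v: "v \<in> col_span g (Suc n)"
  shows "\<exists>t w. w \<in> col_span g n \<and> v = w + t \<cdot>\<^sub>v col g n"
proof -
  note gc = GL_carrier_mat[OF g]
  obtain u where u: "u \<in> std_subspace d (Suc n)" "v = g *\<^sub>v u"
    using v by (auto simp: col_span_eq[OF g])
  have uc: "u \<in> carrier_vec d" by (rule std_subspace_carrier[OF u(1)])
  define u' where "u' = u + (- (u $ n)) \<cdot>\<^sub>v unit_vec d n"
  have u'd: "u' \<in> std_subspace d n"
    unfolding std_subspace_def
  proof (intro CollectI conjI ballI)
    show "u' \<in> carrier_vec d" using uc by (simp add: u'_def)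
    fix k assume "k \<in> {n..<d}"
    then show "u' $ k = 0"
      using u(1) uc n by (cases "k = n") (auto simp: u'_def std_subspace_def)
  qed
  have "u = u' + (u $ n) \<cdot>\<^sub>v unit_vec d n"
    using uc by (intro eq_vecI) (auto simp: u'_def)
  then have "v = g *\<^sub>v u' + g *\<^sub>v ((u $ n) \<cdot>\<^sub>v unit_vec d n)"
    unfolding u(2) using mult_add_distrib_mat_vec[OF gc, of u' "(u $ n) \<cdot>\<^sub>v unit_vec d n"]
      std_subspace_carrier[OF u'd] by simp
  also have "g *\<^sub>v ((u $ n) \<cdot>\<^sub>v unit_vec d n) = (u $ n) \<cdot>\<^sub>v col g n"
    using mat_unit_vec[OF gc n] by (simp add: mult_mat_vec[OF gc])
  finally show ?thesis
    using u'd by (auto simp: col_span_eq[OF g])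
qed

lemma row_value_comb:
  "v \<in> carrier_vec d \<Longrightarrow> w \<in> carrier_vec d \<Longrightarrow>
    row_value d a (v + t \<cdot>\<^sub>v w) = row_value d a v + t * row_value d a (w::'k vec)"
  by (simp add: row_value_def sum.distrib algebra_simps sum_distrib_left)

text \<open>If a rational hyperplane contains the subspace \<open>V\<close> of dimension \<open>n\<close> but not the next one \<open>V'\<close>,
  then \<open>V\<close> is the intersection of \<open>V'\<close> with the hyperplane.  It contains the Frobenius image of \<open>V\<close>,
  since \<open>V'\<close> and the hyperplane do, so the wall \<open>n\<close> is not crossed.\<close>

lemma row_value_step:
  assumes c: "gallery d J g c" and a: "\<And>r. a r \<in> Fq q" and n: "n \<in> {1..d - 1}" "n \<in> J"
    and z: "\<And>v. v \<in> col_span (g 1) n \<Longrightarrow> row_value d a v = 0" and v: "v \<in> col_span (g 1) (Suc n)"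
  shows "row_value d a v = 0"
proof -
  have d: "1 \<in> {1..d}" "n < d" using n by auto
  note G = gallery_GL[OF c d(1)]
  have cc: "col (g 1) n \<in> carrier_vec d"
    using GL_carrier_mat[OF G] d by auto
  have dec: "\<exists>t w. w \<in> col_span (g 1) n \<and> v = w + t \<cdot>\<^sub>v col (g 1) n \<and> row_value d a v = t * row_value d a (col (g 1) n)"
    if v: "v \<in> col_span (g 1) (Suc n)" for v
  proof -
    obtain t w where "w \<in> col_span (g 1) n" "v = w + t \<cdot>\<^sub>v col (g 1) n"
      using col_span_Suc[OF G d(2) v] by blast
    then show ?thesis
      using z[of w] row_value_comb[OF _ cc, of w a t] col_span_carrier[OF G] by auto
  qed
  have "row_value d a (col (g 1) n) = 0"
  proof (rule ccontr)
    assume nz: "row_value d a (col (g 1) n) \<noteq> 0"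
    have "frob_vec w \<in> col_span (g 1) n" if w: "w \<in> col_span (g 1) n" for w
    proof -
      have "frob_vec w \<in> col_span (g 1) (Suc n)"
        using gallery_shift[OF c, of "Suc n" w] w n by auto
      then obtain t w' where t: "w' \<in> col_span (g 1) n" "frob_vec w = w' + t \<cdot>\<^sub>v col (g 1) n"
        "row_value d a (frob_vec w) = t * row_value d a (col (g 1) n)"
        using dec by blast
      have "row_value d a (frob_vec w) = 0"
        using row_value_frob[OF a col_span_carrier[OF G w]] z[OF w] q_gt_1 by (simp add: power_0_left)
      then have "t = 0" using t(3) nz by simp
      then have "frob_vec w = w'"
        unfolding t(2) using cc col_span_carrier[OF G t(1)] GL_carrier_mat[OF G] d
        by (intro eq_vecI) auto
      then show ?thesis using t(1) by simp
    qed
    then show False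
      using gallery_wall(1)[OF c n] by blast
  qed
  then show ?thesis
    using dec[OF v] by auto
qed

lemma row_value_up:
  assumes c: "gallery d J g c" and a: "\<And>r. a r \<in> Fq q" and J: "{s..<t} \<subseteq> J" and s: "1 \<le> s" "s \<le> t" "t \<le> d"
    and z: "\<And>v. v \<in> col_span (g 1) s \<Longrightarrow> row_value d a v = 0" and v: "v \<in> col_span (g 1) t"
  shows "row_value d a v = 0"
  using s(2) J s(3) v
proof (induction t arbitrary: v rule: dec_induct)
  case base
  then show ?case using z by simp
next
  case (step n)
  have n: "n \<in> {1..d - 1}" "n \<in> J"
    using step s by auto
  have "row_value d a w = 0" if "w \<in> col_span (g 1) n" for w
    by (rule step.IH) (use step that in auto)
  then show ?case
    by (rule row_value_step[OF c a n _ step.prems(3)])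
qed

lemma row_value_unit: "r < d \<Longrightarrow> row_value d a (unit_vec d r) = (a r :: 'k)"
  unfolding row_value_def
  by (subst sum.cong[OF refl, of _ _ "\<lambda>s. if s = r then a r else 0"]) auto

end

context rho_setup
begin

section \<open>The flag tuple with given coordinates\<close>

abbreviation (input) "G \<equiv> (GL d :: 'k mat monoid)"
abbreviation (input) "B \<equiv> (borel d :: 'k mat set)"

text \<open>A spanning vector of the line of the first flag, normalised by \<open>X (i - 1) = 1\<close>.  On the boundary
  it lies in the standard subspace, and the line in the quotient by this subspace is given by the
  coordinates \<open>W x\<close>.\<close>

definition line :: "(nat \<Rightarrow> 'k) \<Rightarrow> nat \<Rightarrow> 'k"
  where "line x r = (if r < i then \<Xi> x (Suc r) else x i * W x r)"

text \<open>A representative of the first flag: the columns are the Frobenius images of the line and, on the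
  boundary from column \<open>i\<close> on, of the line in the quotient.\<close>

definition frame :: "(nat \<Rightarrow> 'k) \<Rightarrow> 'k mat"
  where "frame x = mat d d (\<lambda>(r, c). if x i = 0 \<and> i \<le> c then (if r < i then 0 else W x r ^ (q ^ (c - i)))
     else line x r ^ (q ^ c))"

definition walls :: "(nat \<Rightarrow> 'k) \<Rightarrow> nat set"
  where "walls x = (if x i = 0 then {1..d - 1} - {i} else {1..d - 1})"

lemma frame_carrier: "frame x \<in> carrier_mat d d"
  by (simp add: frame_def)

lemma frame_index: "r < d \<Longrightarrow> c < d \<Longrightarrow> frame x $$ (r, c) =
    (if x i = 0 \<and> i \<le> c then (if r < i then 0 else W x r ^ (q ^ (c - i))) else line x r ^ (q ^ c))"
  by (simp add: frame_def)

lemma line_0: "line x (i - 1) = 1"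
  using i_bounds by (simp add: line_def xi_coord_def)

lemma line_last: "line x (d - 1) = x i"
  using i_bounds d_ge_2 by (simp add: line_def w_coord_def)

lemma sum_line:
  "(\<Sum>r<d. a r * line x r) = (\<Sum>j=1..i. a (j - 1) * \<Xi> x j) + x i * (\<Sum>l=i..<d. a l * W x l)"
proof -
  have "{..<d} = {..<i} \<union> {i..<d}" "{..<i} \<inter> {i..<d} = {}"
    using i_bounds by auto
  then have "(\<Sum>r<d. a r * line x r) = (\<Sum>r<i. a r * line x r) + (\<Sum>r=i..<d. a r * line x r)"
    by (simp add: sum.union_disjoint)
  also have "(\<Sum>r<i. a r * line x r) = (\<Sum>j=1..i. a (j - 1) * \<Xi> x j)"
    unfolding One_nat_def sum.atLeast1_atMost_eq by (intro sum.cong) (auto simp: line_def)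
  also have "(\<Sum>r=i..<d. a r * line x r) = x i * (\<Sum>l=i..<d. a l * W x l)"
    unfolding sum_distrib_left by (intro sum.cong) (auto simp: line_def)
  finally show ?thesis .
qed

lemma line_independent:
  assumes x: "x \<in> source" and a: "\<And>r. a r \<in> Fq q" and z: "(\<Sum>r<d. a r * line x r) = 0"
  shows "r < i \<Longrightarrow> a r = 0" "x i \<noteq> 0 \<Longrightarrow> r \<in> {i..<d} \<Longrightarrow> a r = 0"
proof -
  have e: "(\<Sum>j=1..i. a (j - 1) * \<Xi> x j) = x i * (\<Sum>l=i..<d. - a l * W x l)"
    using z unfolding sum_line by (simp add: sum_negf eq_neg_iff_add_eq_0)
  have lo: "a (j - 1) = 0" if "j \<in> {1..i}" for j
    using xi_independentD[OF source_facts(2)[OF x], of "\<lambda>j. a (j - 1)" "\<lambda>l. - a l" j, OF a _ e that] a Fq_uminus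
    by blast
  show "a r = 0" if "r < i"
    using lo[of "Suc r"] that by simp
  show "a r = 0" if "x i \<noteq> 0" "r \<in> {i..<d}"
  proof -
    have "(\<Sum>j=1..i. a (j - 1) * \<Xi> x j) = 0"
      using lo by (intro sum.neutral) auto
    then have "(\<Sum>l=i..<d. a l * W x l) = 0"
      using z that(1) unfolding sum_line by simp
    then show ?thesis
      using w_independentD[OF source_facts(1)[OF x], of a r] a that by blast
  qed
qed

text \<open>Off the boundary the frame is a Moore matrix, on the boundary it is block diagonal with two Moore
  matrices.\<close>

lemma frame_GL:
  assumes x: "x \<in> source"
  shows "frame x \<in> carrier G"
proof -
  have "det (frame x) \<noteq> 0"
  proof
    assume "det (frame x) = 0"
    then have "det (transpose_mat (frame x)) = 0"
      using det_transpose[OF frame_carrier] by simp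
    then obtain v where v: "v \<in> carrier_vec d" "v \<noteq> 0\<^sub>v d" "transpose_mat (frame x) *\<^sub>v v = 0\<^sub>v d"
      using det_0_iff_vec_prod_zero_field[of "transpose_mat (frame x)" d] frame_carrier by auto
    have rel: "(\<Sum>r<d. v $ r * frame x $$ (r, c)) = 0" if c: "c < d" for c
    proof -
      have "(transpose_mat (frame x) *\<^sub>v v) $ c = (\<Sum>r<d. transpose_mat (frame x) $$ (c, r) * v $ r)"
        by (rule mat_vec_index) (use frame_carrier v c in auto)
      also have "\<dots> = (\<Sum>r<d. v $ r * frame x $$ (r, c))"
        using frame_carrier[of x] c by (intro sum.cong) (auto simp: mult.commute)
      finally show ?thesis
        using v(3) c by simp
    qed
    have "v $ r = 0" if r: "r < d" for r
    proof (cases "x i = 0")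
      case False
      have "\<forall>r\<in>{..<d}. v $ r = 0"
      proof (rule moore_independent[where v = "line x" and n = 0])
        fix a assume "\<And>j. a j \<in> Fq q" "(\<Sum>j<d. a j * line x j) = 0"
        then show "\<forall>j\<in>{..<d}. a j = 0"
          using line_independent[OF x, of a] False by (metis atLeastLessThan_iff lessThan_iff not_le)
      next
        fix k assume "k \<in> {0..<0 + card {..<d}}"
        then show "(\<Sum>j<d. v $ j * line x j ^ q ^ k) = 0"
          using rel[of k] False by (simp add: frame_index)
      qed simp
      then show ?thesis using r by simp
    next
      case True
      have split: "{..<d} = {..<i} \<union> {i..<d}" "{..<i} \<inter> {i..<d} = {}"
        using i_bounds by auto
      have "\<forall>r\<in>{..<i}. v $ r = 0"
      proof (rule moore_independent[where v = "line x" and n = 0])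
        fix a assume a: "\<And>j. a j \<in> Fq q" "(\<Sum>j<i. a j * line x j) = 0"
        define a' where "a' = (\<lambda>j. if j < i then a j else 0)"
        have "(\<Sum>j<d. a' j * line x j) = (\<Sum>j<i. a j * line x j)"
          unfolding split(1) by (subst sum.union_disjoint) (auto simp: a'_def split(2))
        then show "\<forall>j\<in>{..<i}. a j = 0"
          using line_independent(1)[OF x, of a'] a by (auto simp: a'_def)
      next
        fix k assume "k \<in> {0..<0 + card {..<i}}"
        then have k: "k < i" "k < d" using i_bounds by auto
        have "(\<Sum>r<d. v $ r * frame x $$ (r, k)) = (\<Sum>j<i. v $ j * line x j ^ q ^ k) + (\<Sum>j=i..<d. v $ j * frame x $$ (j, k))"
          unfolding split(1) using k i_bounds
          by (subst sum.union_disjoint) (auto simp: split(2) frame_index)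
        also have "(\<Sum>j=i..<d. v $ j * frame x $$ (j, k)) = 0"
          using k True q_gt_1 by (intro sum.neutral) (auto simp: frame_index line_def power_0_left)
        finally show "(\<Sum>j<i. v $ j * line x j ^ q ^ k) = 0"
          using rel[OF k(2)] by simp
      qed simp
      moreover have "\<forall>r\<in>{i..<d}. v $ r = 0"
      proof (rule moore_independent[where v = "W x" and n = 0])
        fix a :: "nat \<Rightarrow> 'k" assume "\<And>j. a j \<in> Fq q" "(\<Sum>j=i..<d. a j * W x j) = 0"
        then show "\<forall>j\<in>{i..<d}. a j = 0"
          using w_independentD[OF source_facts(1)[OF x], of a] by blast
      next
        fix k assume "k \<in> {0..<0 + card {i..<d}}"
        then have k: "i + k < d" by auto
        have "(\<Sum>r<d. v $ r * frame x $$ (r, i + k)) = (\<Sum>j<i. v $ j * frame x $$ (j, i + k)) + (\<Sum>j=i..<d. v $ j * W x j ^ q ^ k)"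
          unfolding split(1) using k True
          by (subst sum.union_disjoint) (auto simp: split(2) frame_index)
        also have "(\<Sum>j<i. v $ j * frame x $$ (j, i + k)) = 0"
          using k True i_bounds by (intro sum.neutral) (auto simp: frame_index)
        finally show "(\<Sum>j=i..<d. v $ j * W x j ^ q ^ k) = 0"
          using rel[OF k] by simp
      qed simp
      ultimately show ?thesis
        using r by (cases "r < i") auto
    qed
    then have "v = 0\<^sub>v d"
      using v(1) by (intro eq_vecI) auto
    then show False using v(2) by simp
  qed
  then show ?thesis
    using frame_carrier by (simp add: GL_iff)
qed

lemma frame_frob:
  assumes "Suc c < d" "Suc c \<in> walls x"
  shows "frob_vec (col (frame x) c) = col (frame x) (Suc c)"
proof (rule eq_vecI)
  fix r assume "r < dim_vec (col (frame x) (Suc c))"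
  then have r: "r < d" using frame_carrier[of x] by simp
  have "(q ^ c) * q = q ^ Suc c" by simp
  show "frob_vec (col (frame x) c) $ r = col (frame x) (Suc c) $ r"
    using r assms frame_carrier[of x] q_gt_1
    by (auto simp: frob_vec_index frame_index walls_def power_mult[symmetric] power_0_left Suc_diff_le
        mult.commute[of _ q] split: if_splits)
qed (use frame_carrier[of x] in \<open>simp_all add: frob_vec_def\<close>)

lemma frame_block_span:
  assumes x: "x \<in> source" and x0: "x i = 0"
  shows "col_span (frame x) i = std_subspace d i"
proof
  note g = frame_GL[OF x] and gc = frame_carrier[of x]
  have lo: "frame x $$ (r, c) = 0" if "r \<in> {i..<d}" "c < i" for r c
    using that x0 i_bounds by (simp add: frame_index line_def power_0_left)
  have up: "frame x $$ (r, c) = 0" if "r < i" "c \<in> {i..<d}" for r c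
    using that x0 i_bounds by (simp add: frame_index)
  show "col_span (frame x) i \<subseteq> std_subspace d i"
  proof
    fix v assume "v \<in> col_span (frame x) i"
    then obtain u where u: "u \<in> std_subspace d i" "v = frame x *\<^sub>v u"
      by (auto simp: col_span_eq[OF g])
    have "v $ r = 0" if r: "r \<in> {i..<d}" for r
    proof -
      have "v $ r = (\<Sum>c<d. frame x $$ (r, c) * u $ c)"
        unfolding u(2) using r by (intro mat_vec_index gc std_subspace_carrier[OF u(1)]) auto
      also have "\<dots> = 0"
      proof (rule sum.neutral, rule ballI)
        fix c assume "c \<in> {..<d}"
        then show "frame x $$ (r, c) * u $ c = 0"
          using lo[OF r, of c] u(1) by (cases "c < i") (auto simp: std_subspace_def)
      qed
      finally show ?thesis .
    qed
    then show "v \<in> std_subspace d i"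
      unfolding u(2) std_subspace_def using mult_mat_vec_carrier[OF gc std_subspace_carrier[OF u(1)]] by auto
  qed
  show "std_subspace d i \<subseteq> col_span (frame x) i"
  proof
    fix v :: "'k vec" assume v: "v \<in> std_subspace d i"
    then have "v \<in> col_span (frame x) d"
      unfolding col_span_full[OF g] by (rule std_subspace_carrier)
    then obtain w where w: "w \<in> carrier_vec d" "v = frame x *\<^sub>v w"
      by (auto simp: col_span_eq[OF g] std_subspace_full)
    define w' where "w' = vec d (\<lambda>c. if c < i then 0 else w $ c)"
    have w'c: "w' \<in> carrier_vec d" by (simp add: w'_def)
    have "frame x *\<^sub>v w' = frame x *\<^sub>v 0\<^sub>v d"
    proof (rule eq_vecI)
      fix r assume "r < dim_vec (frame x *\<^sub>v 0\<^sub>v d)"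
      then have r: "r < d" using gc by simp
      have e: "(frame x *\<^sub>v w') $ r = (\<Sum>c<d. frame x $$ (r, c) * w' $ c)"
        by (rule mat_vec_index[OF gc w'c r])
      also have "\<dots> = 0"
      proof (cases "r < i")
        case True
        show ?thesis
        proof (rule sum.neutral, rule ballI)
          fix c assume "c \<in> {..<d}"
          then show "frame x $$ (r, c) * w' $ c = 0"
            using up[OF True, of c] by (cases "c < i") (auto simp: w'_def)
        qed
      next
        case False
        have "(\<Sum>c<d. frame x $$ (r, c) * w' $ c) = (\<Sum>c<d. frame x $$ (r, c) * w $ c)"
        proof (rule sum.cong[OF refl])
          fix c assume "c \<in> {..<d}"
          then show "frame x $$ (r, c) * w' $ c = frame x $$ (r, c) * w $ c"
            using lo[of r c] False r by (cases "c < i") (auto simp: w'_def)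
        qed
        also have "\<dots> = v $ r"
          unfolding w(2) by (rule mat_vec_index[OF gc w(1) r, symmetric])
        also have "\<dots> = 0"
          using v False r by (auto simp: std_subspace_def)
        finally show ?thesis .
      qed
      finally show "(frame x *\<^sub>v w') $ r = (frame x *\<^sub>v 0\<^sub>v d) $ r"
        using mat_vec_index[OF gc zero_carrier_vec r] by simp
    qed (use gc in simp)
    then have "w' = 0\<^sub>v d"
      by (rule GL_inj[OF g w'c zero_carrier_vec])
    then have "w' $ c = 0" if "c \<in> {i..<d}" for c
      using that by simp
    moreover have "w' $ c = w $ c" if "c \<in> {i..<d}" for c
      using that by (simp add: w'_def)
    ultimately have "w $ c = 0" if "c \<in> {i..<d}" for c
      using that by simp
    then have "w \<in> std_subspace d i"
      using w(1) by (auto simp: std_subspace_def)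
    then show "v \<in> col_span (frame x) i"
      using w(2) by (auto simp: col_span_eq[OF g])
  qed
qed

text \<open>Starting from the frame, each crossed wall exchanges two neighbouring columns.\<close>

primrec path :: "'k mat \<Rightarrow> nat set \<Rightarrow> nat \<Rightarrow> 'k mat"
  where
    "path M J 0 = M"
  | "path M J (Suc k) = (if k \<in> J then path M J k * swaprows_mat d (k - 1) k else path M J k)"

lemma path_GL:
  assumes "M \<in> carrier G" "J \<subseteq> {1..d - 1}"
  shows "path M J k \<in> carrier G"
proof (induction k)
  case (Suc k)
  have "swaprows_mat d (k - 1) k \<in> carrier G" if "k \<in> J"
  proof -
    have "k \<in> {1..d - 1}" using that assms(2) by blast
    then show ?thesis by (intro swap_GL) auto
  qed
  then show ?case
    using Suc GL_prod by auto
qed (use assms in simp)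

lemma path_crosses:
  assumes M: "M \<in> carrier G" and J: "J \<subseteq> {1..d - 1}"
  shows "crosses d J (path M J)"
  unfolding crosses_def
proof (intro ballI conjI impI)
  fix k assume k: "k \<in> {1..d - 1}"
  note p = path_GL[OF M J, of k]
  note pc = GL_carrier_mat[OF p] and pic = GL_carrier_mat[OF GL_inv(1)[OF p]]
  have k': "1 \<le> k" "k < d" using k by auto
  note s = swap_GL[OF k', where 'k = 'k]
  show "rel_pos d (path M J) k \<in> bruhat_cell d k" if "k \<in> J"
  proof -
    have "rel_pos d (path M J) k = swaprows_mat d (k - 1) k"
      unfolding rel_pos_def GL_mult using that
      assoc_mult_mat[OF pic pc GL_carrier_mat[OF s], symmetric] GL_inv(2)[OF p] GL_carrier_mat[OF s] by simp
    also have "\<dots> = 1\<^sub>m d * swaprows_mat d (k - 1) k * 1\<^sub>m d"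
      by (simp add: left_mult_one_mat[OF GL_carrier_mat[OF s]] right_mult_one_mat[OF GL_carrier_mat[OF s]] del: One_nat_def)
    finally show ?thesis
      unfolding bruhat_cell_mem using borel_one by blast
  qed
  show "rel_pos d (path M J) k \<in> borel d" if "k \<notin> J"
    unfolding rel_pos_def GL_mult using that GL_inv(2)[OF p] borel_one by simp
qed

lemma path_col:
  assumes M: "M \<in> carrier G" and J: "J \<subseteq> {1..d - 1}" and k: "1 \<le> k" "k \<le> d"
  shows "(\<forall>b. k \<le> b \<longrightarrow> b < d \<longrightarrow> col (path M J k) b = col M b) \<and>
    (\<forall>b. Suc b < k \<longrightarrow> Suc b \<in> J \<longrightarrow> col (path M J k) b = col M (Suc b))"
  using k
proof (induction k rule: dec_induct)
  case base
  have "0 \<notin> J" using J by auto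
  then show ?case by simp
next
  case (step k)
  show ?case
  proof (cases "k \<in> J")
    case False
    have "Suc b < k" if "Suc b < Suc k" "Suc b \<in> J" for b
      using that False by (metis less_antisym)
    then show ?thesis
      using step False by auto
  next
    case True
    have k': "1 \<le> k" "k < d" using step by auto
    note sc = swap_col[OF k' GL_carrier_mat[OF path_GL[OF M J]], of _ k]
    show ?thesis
    proof (intro conjI allI impI)
      fix b assume b: "Suc k \<le> b" "b < d"
      then have "b \<noteq> k" "b \<noteq> k - 1" "k \<le> b" by auto
      then show "col (path M J (Suc k)) b = col M b"
        using True sc[of b] step k' b by simp
    next
      fix b assume b: "Suc b < Suc k" "Suc b \<in> J"
      show "col (path M J (Suc k)) b = col M (Suc b)"
      proof (cases "Suc b = k")
        case True
        then show ?thesis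
          using \<open>k \<in> J\<close> sc[of b] step k' by auto
      next
        case False
        then show ?thesis
          using True sc[of b] step k' b by auto
      qed
    qed
  qed
qed

definition flag_of :: "(nat \<Rightarrow> 'k) \<Rightarrow> 'k flag_tuple"
  where "flag_of x = (\<lambda>k\<in>{1..d}. path (frame x) (walls x) k <#\<^bsub>GL d\<^esub> borel d)"

lemma walls_sub: "walls x \<subseteq> {1..d - 1}" "0 \<notin> walls x"
  by (auto simp: walls_def)

lemma path_1: "path (frame x) (walls x) 1 = frame x"
  using walls_sub by simp

text \<open>After all exchanges column \<open>b\<close> is the Frobenius image of column \<open>b\<close> of the frame, apart from the
  last column and, on the boundary, column \<open>i - 1\<close>, where the subspaces are known otherwise.\<close>

lemma flag_of_gallery:
  assumes x: "x \<in> source"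
  shows "gallery d (walls x) (path (frame x) (walls x)) (flag_of x)"
proof -
  note g = frame_GL[OF x] and gc = frame_carrier[of x]
  note p = path_GL[OF g walls_sub(1)[of x]]
  note cr = path_crosses[OF g walls_sub(1)[of x]]
  let ?p = "path (frame x) (walls x)"
  have d1: "1 \<le> d" using d_ge_2 by simp
  have "col (frob q (frame x)) b \<in> col_span (?p d) (Suc b)" if b: "b < d" for b
  proof -
    have cf: "col (frob q (frame x)) b = frob_vec (col (frame x) b)"
      using gc b by (intro eq_vecI) (auto simp: frob_def frob_vec_def)
    consider "Suc b = d" | "Suc b < d" "Suc b \<in> walls x" | "Suc b < d" "x i = 0" "Suc b = i"
      using b by (cases "Suc b = d"; cases "x i = 0"; cases "Suc b = i") (auto simp: walls_def)
    then show ?thesis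
    proof cases
      case 1
      have "col (frob q (frame x)) b \<in> carrier_vec d"
        unfolding cf frob_vec_carrier by (rule col_carrier_vec[OF b gc])
      then show ?thesis
        using 1 col_span_full[OF p] by simp
    next
      case 2
      have "col (?p d) b = col (frame x) (Suc b)"
        using path_col[OF g walls_sub(1)[of x] d1 le_refl] 2 by blast
      then show ?thesis
        unfolding cf frame_frob[OF 2] using col_in_span[OF p[of d], of b "Suc b"] b by simp
    next
      case 3
      have "col_span (?p d) i = col_span (?p 1) i"
        by (rule crosses_last(2)[OF cr p]) (use 3 i_bounds in \<open>auto simp: walls_def\<close>)
      also have "\<dots> = std_subspace d i"
        unfolding path_1 by (rule frame_block_span[OF x 3(2)])
      finally have e: "col_span (?p d) (Suc b) = std_subspace d i"
        using 3 by simp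
      have "col (frame x) b \<in> std_subspace d i"
        using col_in_span[OF g, of b i] 3 b frame_block_span[OF x 3(2)] by auto
      then show ?thesis
        unfolding e cf frob_std_subspace .
    qed
  qed
  then have "?p d <#\<^bsub>GL d\<^esub> borel d = frob q (frame x) <#\<^bsub>GL d\<^esub> borel d"
    by (intro coset_eqI p frob_GL g)
  then show ?thesis
    unfolding gallery_def represents_def path_1 using p cr d1 by (auto simp: flag_of_def)
qed

lemma gallery_iff_Omega: "c \<in> Omega q d \<longleftrightarrow> (\<exists>g. gallery d {1..d - 1} g c)"
  unfolding Omega_def Omega_bar_def gallery_def crosses_def by blast

lemma C_I_iff: "c \<in> C_I q d i \<longleftrightarrow> (\<exists>g. gallery d ({1..d - 1} - {i}) g c \<and>
    g 1 <#\<^bsub>GL d\<^esub> borel d #>\<^bsub>GL d\<^esub> inv\<^bsub>GL d\<^esub> (g 1) \<subseteq> parabolic d i)"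
  unfolding C_I_def Omega_bar_def gallery_def crosses_def using i_bounds by blast

lemma conj_coset_mem:
  "h \<in> (g <#\<^bsub>G\<^esub> borel d #>\<^bsub>G\<^esub> k) \<longleftrightarrow> (\<exists>b\<in>borel d. h = g * b * k)"
  by (auto simp: r_coset_def l_coset_def GL_mult)

lemma flag_of_Omega: "x \<in> source \<Longrightarrow> x i \<noteq> 0 \<Longrightarrow> flag_of x \<in> Omega q d"
  using flag_of_gallery[of x] unfolding gallery_iff_Omega walls_def by auto

lemma flag_of_C_I:
  assumes x: "x \<in> source" and x0: "x i = 0"
  shows "flag_of x \<in> C_I q d i"
proof -
  note g = frame_GL[OF x] and gc = frame_carrier[of x]
  have "h \<in> parabolic d i" if h: "h \<in> (frame x <#\<^bsub>G\<^esub> borel d #>\<^bsub>G\<^esub> inv\<^bsub>G\<^esub> (frame x))" for h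
  proof -
    obtain b where b: "b \<in> borel d" "h = frame x * b * inv\<^bsub>G\<^esub> (frame x)"
      using h unfolding conj_coset_mem by blast
    note bG = borel_GL[OF b(1)]
    note gb = GL_prod[OF g bG]
    have hG: "h \<in> carrier G"
      unfolding b(2) by (rule GL_prod[OF gb GL_inv(1)[OF g]])
    have "h * frame x = frame x * b"
      unfolding b(2) using GL_inv(2)[OF g] right_mult_one_mat[OF GL_carrier_mat[OF gb]]
        assoc_mult_mat[OF GL_carrier_mat[OF gb] GL_carrier_mat[OF GL_inv(1)[OF g]] gc] by simp
    then have "(\<lambda>v. h *\<^sub>v v) ` col_span (frame x) i = (\<lambda>v. frame x *\<^sub>v v) ` col_span b i"
      using col_span_mult[OF hG g, of i] col_span_mult[OF g bG, of i] by simp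
    also have "\<dots> = col_span (frame x) i"
      unfolding col_span_borel[OF b(1)] col_span_eq[OF g] ..
    finally show ?thesis
      using hG unfolding frame_block_span[OF x x0] parabolic_def by blast
  qed
  then show ?thesis
    using flag_of_gallery[OF x] x0 unfolding C_I_iff walls_def
    by (intro exI[of _ "path (frame x) (walls x)"]) (auto simp: path_1[unfolded One_nat_def] walls_def)
qed

text \<open>By \<open>gallery_shift\<close> the first flag of a gallery contains with its line the Frobenius images of it
  in the successive subspaces; on the boundary this starts again at dimension \<open>i + 1\<close>.  So it is the
  flag of the frame.\<close>

lemma flag_of_eqI:
  assumes x: "x \<in> source" and c: "gallery d (walls x) g c"
    and line: "col (frame x) 0 \<in> col_span (g 1) 1"
    and line': "x i = 0 \<Longrightarrow> col (frame x) i \<in> col_span (g 1) (Suc i)"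
  shows "c = flag_of x"
proof (rule gallery_unique[OF c flag_of_gallery[OF x]])
  have d1: "1 \<in> {1..d}" using d_ge_2 by simp
  have "col (frame x) b \<in> col_span (g 1) (Suc b)" if "b < d" for b
    using that
  proof (induction b)
    case (Suc b)
    show ?case
    proof (cases "Suc b \<in> walls x")
      case True
      then show ?thesis
        unfolding frame_frob[OF Suc.prems True, symmetric] using Suc
        by (intro gallery_shift[OF c]) auto
    next
      case False
      then have "x i = 0" "Suc b = i"
        using Suc.prems by (auto simp: walls_def split: if_splits)
      then show ?thesis using line' by simp
    qed
  qed (use line in simp)
  then show "g 1 <#\<^bsub>GL d\<^esub> borel d = path (frame x) (walls x) 1 <#\<^bsub>GL d\<^esub> borel d"
    unfolding path_1 by (intro coset_eqI gallery_GL[OF c d1] frame_GL[OF x])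
qed (use d_ge_2 in simp)

section \<open>Classification of the flag tuples\<close>

lemma row_value_span_0:
  assumes "(g::'k mat) \<in> carrier G" "v \<in> col_span g 0"
  shows "row_value d a v = 0"
proof -
  obtain u where u: "u \<in> std_subspace d 0" "v = g *\<^sub>v u"
    using assms by (auto simp: col_span_eq)
  then have "u = 0\<^sub>v d"
    by (intro eq_vecI) (auto simp: std_subspace_def)
  then have "v = 0\<^sub>v d"
    using u(2) GL_carrier_mat[OF assms(1)] by (intro eq_vecI) (auto simp: scalar_prod_def)
  then show ?thesis by (simp add: row_value_def)
qed

lemma row_value_span_Suc:
  assumes g: "(g::'k mat) \<in> carrier G" and n: "n < d" and z: "\<And>v. v \<in> col_span g n \<Longrightarrow> row_value d a v = 0"
    and c: "row_value d a (col g n) = 0" and v: "v \<in> col_span g (Suc n)"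
  shows "row_value d a v = 0"
proof -
  obtain t w where tw: "w \<in> col_span g n" "v = w + t \<cdot>\<^sub>v col g n"
    using col_span_Suc[OF g n v] by blast
  show ?thesis
    unfolding tw(2) using row_value_comb[OF col_span_carrier[OF g tw(1)] col_carrier_vec[OF n GL_carrier_mat[OF g]]]
      z[OF tw(1)] c by simp
qed

lemma source_of_line:
  assumes ext: "x \<in> extensional {1..d - 1}" and x: "x i \<noteq> 0"
    and ind: "\<And>a r. (\<And>r. a r \<in> Fq q) \<Longrightarrow> (\<Sum>r<d. a r * line x r) = 0 \<Longrightarrow> r < d \<Longrightarrow> a r = 0"
  shows "x \<in> source"
proof -
  have "w_independent x"
    unfolding w_independent_def
  proof (intro allI impI ballI)
    fix a l assume a: "\<forall>l. a l \<in> Fq q" "(\<Sum>l=i..<d. a l * W x l) = 0" and l: "l \<in> {i..<d}"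
    define c where "c = (\<lambda>r. if r < i then 0 else a r)"
    have "(\<Sum>l=i..<d. c l * W x l) = (\<Sum>l=i..<d. a l * W x l)"
      by (intro sum.cong) (auto simp: c_def)
    moreover have "(\<Sum>j=1..i. c (j - 1) * \<Xi> x j) = 0"
      by (intro sum.neutral) (auto simp: c_def)
    ultimately have "(\<Sum>r<d. c r * line x r) = 0"
      unfolding sum_line using a(2) by simp
    moreover have "c r \<in> Fq q" for r using a(1) by (simp add: c_def)
    ultimately have "c l = 0" using ind[of c l] l by auto
    then show "a l = 0" using l by (simp add: c_def)
  qed
  moreover have "xi_independent x"
    unfolding xi_independent_def
  proof (intro allI impI ballI)
    fix a b j
    assume ab: "\<forall>l. a l \<in> Fq q" "\<forall>l. b l \<in> Fq q"
      "(\<Sum>j=1..i. a j * \<Xi> x j) = x i * (\<Sum>l=i..<d. b l * W x l)" and j: "j \<in> {1..i}"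
    define c where "c = (\<lambda>r. if r < i then a (Suc r) else - b r)"
    have "(\<Sum>l=i..<d. c l * W x l) = - (\<Sum>l=i..<d. b l * W x l)"
      unfolding sum_negf[symmetric] by (intro sum.cong) (auto simp: c_def)
    moreover have "(\<Sum>j=1..i. c (j - 1) * \<Xi> x j) = (\<Sum>j=1..i. a j * \<Xi> x j)"
      by (intro sum.cong) (auto simp: c_def)
    ultimately have "(\<Sum>r<d. c r * line x r) = 0"
      unfolding sum_line using ab(3) by simp
    moreover have "c r \<in> Fq q" for r using ab(1,2) by (simp add: c_def Fq_uminus)
    ultimately have "c (j - 1) = 0" using ind[of c "j - 1"] j i_bounds by auto
    then show "a j = 0" using j by (cases j) (auto simp: c_def)
  qed
  ultimately show ?thesis using ext by (simp add: source_def)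
qed

text \<open>A rational hyperplane containing the line would contain every subspace of the flag, by
  \<open>row_value_up\<close>, up to the whole space.\<close>

lemma Omega_imp_flag_of:
  assumes "c \<in> Omega q d"
  shows "\<exists>x\<in>source. x i \<noteq> 0 \<and> c = flag_of x"
proof -
  obtain g where g: "gallery d {1..d - 1} g c"
    using assms gallery_iff_Omega by blast
  have d1: "1 \<in> {1..d}" "0 < d" using d_ge_2 by auto
  note G = gallery_GL[OF g d1(1)]
  note gc = GL_carrier_mat[OF G]
  define u where "u = (\<lambda>r. g 1 $$ (r, 0))"
  have ind: "a r = 0" if a: "\<And>r. a r \<in> Fq q" and z: "(\<Sum>r<d. a r * u r) = 0" and r: "r < d" for a r
  proof -
    have "row_value d a (col (g 1) 0) = 0"
      using z gc d1 by (simp add: row_value_def u_def)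
    then have V: "row_value d a v = 0" if "v \<in> col_span (g 1) 1" for v
      using row_value_span_Suc[OF G d1(2) row_value_span_0[OF G], of a v] that by simp
    have "row_value d a (unit_vec d r) = 0"
    proof (rule row_value_up[OF g a _ _ _ _ V])
      show "unit_vec d r \<in> col_span (g 1) d"
        unfolding col_span_full[OF G] by simp
    qed (use d1 in auto)
    then show ?thesis using row_value_unit[OF r] by simp
  qed
  have nz: "u r \<noteq> 0" if r: "r < d" for r
  proof
    assume "u r = 0"
    then have "(\<Sum>s<d. (if s = r then 1 else 0) * u s) = 0"
      by (intro sum.neutral) auto
    then have "(if r = r then 1 else 0) = (0::'k)"
      by (rule ind[rotated]) (use r in auto)
    then show False by simp
  qed
  define x where "x = (\<lambda>j\<in>{1..d - 1}. if j < i then u (j - 1) / u (i - 1)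
    else if j = i then u (d - 1) / u (i - 1) else u (j - 1) / u (d - 1))"
  have nz': "u (i - 1) \<noteq> 0" "u (d - 1) \<noteq> 0"
    using nz i_bounds d1 by auto
  have xi: "x i = u (d - 1) / u (i - 1)"
    using i_bounds by (simp add: x_def)
  have line: "line x r = u r / u (i - 1)" if r: "r < d" for r
  proof (cases "r < i")
    case True
    then show ?thesis
      using i_bounds nz' by (cases "Suc r = i") (auto simp: line_def xi_coord_def x_def)
  next
    case False
    then show ?thesis
      using r nz' xi i_bounds by (cases "Suc r = d") (auto simp: line_def w_coord_def x_def)
  qed
  have x: "x \<in> source"
  proof (rule source_of_line)
    show "x i \<noteq> 0" using xi nz' by simp
    fix a r assume a: "\<And>r. a r \<in> Fq q" "(\<Sum>r<d. a r * line x r) = 0" "r < d"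
    have "(\<Sum>r<d. a r * line x r) = (\<Sum>r<d. a r * u r) / u (i - 1)"
      unfolding sum_divide_distrib by (intro sum.cong) (simp_all add: line)
    then show "a r = 0" using ind[of a r] a nz' by simp
  qed (simp add: x_def)
  have "c = flag_of x"
  proof (rule flag_of_eqI[OF x])
    show "gallery d (walls x) g c"
      using g xi nz' by (simp add: walls_def)
    have "col (frame x) 0 = (1 / u (i - 1)) \<cdot>\<^sub>v col (g 1) 0"
      using frame_carrier[of x] gc d1 i_bounds by (intro eq_vecI) (auto simp: frame_index line u_def)
    then show "col (frame x) 0 \<in> col_span (g 1) 1"
      using col_span_smult[OF G col_in_span[OF G, of 0 1]] d1 by simp
  qed (use xi nz' in simp)
  then show ?thesis using x xi nz' by (intro bexI[of _ x]) auto
qed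

text \<open>If a vector of \<open>E\<close> has a nonzero entry \<open>k\<close>, adding multiples of row \<open>k\<close> to row \<open>l \<le> k\<close> produces
  the unit vector \<open>l\<close>.  For \<open>l = k\<close> the matrix is diagonal, and a scalar other than 0 and 1 is
  needed.\<close>

lemma borel_stable_subspace:
  fixes E :: "'k vec set"
  assumes E: "E \<subseteq> carrier_vec d"
    and comb: "\<And>v w t. v \<in> E \<Longrightarrow> w \<in> E \<Longrightarrow> v + t \<cdot>\<^sub>v w \<in> E" and zero: "0\<^sub>v d \<in> E"
    and stable: "\<And>b v. b \<in> B \<Longrightarrow> v \<in> E \<Longrightarrow> b *\<^sub>v v \<in> E"
  shows "\<exists>n\<le>d. E = std_subspace d n"
proof -
  have unit: "unit_vec d l \<in> E" if w: "w \<in> E" "w $ k \<noteq> 0" and l: "l \<le> k" "k < d" for w k l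
  proof -
    obtain t :: 'k where t: "t \<noteq> 0" "1 + t \<noteq> 0"
    proof -
      obtain t :: 'k where "t \<notin> {0, - 1}"
        using ex_new_if_finite[OF infinite_field, of "{0, - 1}"] by auto
      then show ?thesis
        by (intro that[of t]) (auto simp: eq_neg_iff_add_eq_0 add.commute)
    qed
    define b :: "'k mat" where "b = mat d d (\<lambda>(r, s). (if r = s then 1 else 0) + (if r = l \<and> s = k then t else 0))"
    have bc: "b \<in> carrier_mat d d" by (simp add: b_def)
    have "b \<in> B"
      by (rule borelI_mat) (use l t in \<open>auto simp: b_def\<close>)
    then have "b *\<^sub>v w + (- 1) \<cdot>\<^sub>v w \<in> E"
      using w stable comb by blast
    moreover have "b *\<^sub>v w + (- 1) \<cdot>\<^sub>v w = (t * w $ k) \<cdot>\<^sub>v unit_vec d l"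
    proof (rule eq_vecI)
      have wc: "w \<in> carrier_vec d" using w E by blast
      fix r assume "r < dim_vec ((t * w $ k) \<cdot>\<^sub>v unit_vec d l)"
      then have r: "r < d" by simp
      have "(b *\<^sub>v w) $ r = (\<Sum>s<d. b $$ (r, s) * w $ s)"
        by (rule mat_vec_index[OF bc wc r])
      also have "\<dots> = (\<Sum>s<d. (if s = r then w $ s else 0) + (if s = k then (if r = l then t * w $ k else 0) else 0))"
        using r by (intro sum.cong) (auto simp: b_def distrib_right)
      also have "\<dots> = w $ r + (if r = l then t * w $ k else 0)"
        using r l by (simp add: sum.distrib)
      finally show "(b *\<^sub>v w + (- 1) \<cdot>\<^sub>v w) $ r = ((t * w $ k) \<cdot>\<^sub>v unit_vec d l) $ r"
        using r wc bc l by simp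
    qed (use w E bc in auto)
    ultimately have "0\<^sub>v d + (1 / (t * w $ k)) \<cdot>\<^sub>v ((t * w $ k) \<cdot>\<^sub>v unit_vec d l) \<in> E"
      using comb[OF zero] by metis
    moreover have "0\<^sub>v d + (1 / (t * w $ k)) \<cdot>\<^sub>v ((t * w $ k) \<cdot>\<^sub>v unit_vec d l) = unit_vec d l"
      using t w by (simp add: smult_smult_assoc)
    ultimately show ?thesis by simp
  qed
  define vanish where "vanish = (\<lambda>n. n \<le> d \<and> (\<forall>v\<in>E. \<forall>k\<in>{n..<d}. v $ k = 0))"
  have "vanish d" by (simp add: vanish_def)
  define n where "n = (LEAST n. vanish n)"
  have n: "vanish n" "\<And>k. k < n \<Longrightarrow> \<not> vanish k"
    unfolding n_def using LeastI[of vanish, OF \<open>vanish d\<close>] not_less_Least[of _ vanish] by blast+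
  have nd: "n \<le> d" using n(1) by (simp add: vanish_def)
  have sub: "E \<subseteq> std_subspace d n"
    using n(1) E by (auto simp: vanish_def std_subspace_def)
  have "std_subspace d n \<subseteq> E"
  proof (cases "n = 0")
    case True
    have "v = 0\<^sub>v d" if "v \<in> std_subspace d 0" for v :: "'k vec"
      using that by (intro eq_vecI) (auto simp: std_subspace_def)
    then show ?thesis using zero True by blast
  next
    case False
    then obtain w k where w: "w \<in> E" "k \<in> {n - 1..<d}" "w $ k \<noteq> 0"
      using n(2)[of "n - 1"] nd unfolding vanish_def by auto
    have un: "unit_vec d l \<in> E" if "l < n" for l
      by (rule unit[OF w(1,3)]) (use that w(2) in auto)
    have "vec d (\<lambda>r. if r < s then v $ r else 0) \<in> E" if v: "v \<in> std_subspace d n" and "s \<le> n" for v s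
      using that(2)
    proof (induction s)
      case 0
      have "vec d (\<lambda>r. if r < 0 then v $ r else 0) = 0\<^sub>v d"
        by (intro eq_vecI) auto
      then show ?case using zero by simp
    next
      case (Suc s)
      have "vec d (\<lambda>r. if r < Suc s then v $ r else 0) =
          vec d (\<lambda>r. if r < s then v $ r else 0) + (v $ s) \<cdot>\<^sub>v unit_vec d s"
        using Suc.prems nd by (intro eq_vecI) (auto simp: less_Suc_eq)
      then show ?case
        using comb[OF Suc.IH un[of s], of "v $ s"] Suc.prems by simp
    qed
    moreover have "vec d (\<lambda>r. if r < n then v $ r else 0) = v" if "v \<in> std_subspace d n" for v :: "'k vec"
      using that by (intro eq_vecI) (auto simp: std_subspace_def)
    ultimately show ?thesis by force
  qed
  then show ?thesis using sub nd by blast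
qed

text \<open>The group of the first flag stabilises the standard subspace, which is therefore a member of this
  flag.  Being rational, it is at a wall that is not crossed, and \<open>i\<close> is the only one.\<close>

lemma C_I_span:
  assumes g: "gallery d ({1..d - 1} - {i}) g c"
    and par: "g 1 <#\<^bsub>G\<^esub> borel d #>\<^bsub>G\<^esub> inv\<^bsub>G\<^esub> (g 1) \<subseteq> parabolic d i"
  shows "col_span (g 1) i = std_subspace d i"
proof -
  have d1: "1 \<in> {1..d}" using d_ge_2 by simp
  note G = gallery_GL[OF g d1]
  note gc = GL_carrier_mat[OF G]
  define E where "E = {w \<in> carrier_vec d. g 1 *\<^sub>v w \<in> std_subspace d i}"
  have "\<exists>n\<le>d. E = std_subspace d n"
  proof (rule borel_stable_subspace)
    fix v w t assume "v \<in> E" "w \<in> E"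
    then have vw: "v \<in> carrier_vec d" "w \<in> carrier_vec d" "g 1 *\<^sub>v v \<in> std_subspace d i" "g 1 *\<^sub>v w \<in> std_subspace d i"
      by (auto simp: E_def)
    have "g 1 *\<^sub>v (v + t \<cdot>\<^sub>v w) = g 1 *\<^sub>v v + t \<cdot>\<^sub>v (g 1 *\<^sub>v w)"
      using mult_add_distrib_mat_vec[OF gc vw(1), of "t \<cdot>\<^sub>v w"] mult_mat_vec[OF gc vw(2), of t] vw(2) by simp
    then show "v + t \<cdot>\<^sub>v w \<in> E"
      using std_subspace_comb[OF vw(3,4), of t] vw(1,2) by (simp add: E_def)
  next
    have "g 1 *\<^sub>v 0\<^sub>v d = 0\<^sub>v d"
      using gc by (intro eq_vecI) (auto simp: scalar_prod_def)
    then show "0\<^sub>v d \<in> E" by (simp add: E_def std_subspace_def)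
  next
    fix b v assume b: "b \<in> B" and v: "v \<in> E"
    have vc: "v \<in> carrier_vec d" "g 1 *\<^sub>v v \<in> std_subspace d i" using v by (auto simp: E_def)
    note bc = GL_carrier_mat[OF borel_GL[OF b]]
    define h where "h = g 1 * b * inv\<^bsub>G\<^esub> (g 1)"
    have "h \<in> parabolic d i"
      using par b unfolding h_def by (meson conj_coset_mem subsetD)
    then have "h *\<^sub>v (g 1 *\<^sub>v v) \<in> std_subspace d i"
      using vc(2) unfolding parabolic_def by blast
    moreover have "h *\<^sub>v (g 1 *\<^sub>v v) = g 1 *\<^sub>v (b *\<^sub>v v)"
    proof -
      note ic = GL_carrier_mat[OF GL_inv(1)[OF G]]
      have "h *\<^sub>v (g 1 *\<^sub>v v) = (g 1 * b) *\<^sub>v (inv\<^bsub>G\<^esub> (g 1) *\<^sub>v (g 1 *\<^sub>v v))"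
        unfolding h_def using gc bc ic vc by (intro assoc_mult_mat_vec) auto
      also have "\<dots> = g 1 *\<^sub>v (b *\<^sub>v v)"
        unfolding GL_inv_vec(1)[OF G vc(1)] by (rule assoc_mult_mat_vec[OF gc bc vc(1)])
      finally show ?thesis .
    qed
    ultimately show "b *\<^sub>v v \<in> E"
      using mult_mat_vec_carrier[OF bc vc(1)] by (simp add: E_def)
  qed (auto simp: E_def)
  then obtain n where n: "n \<le> d" "E = std_subspace d n" by blast
  have span: "col_span (g 1) n = std_subspace d i"
  proof
    show "col_span (g 1) n \<subseteq> std_subspace d i"
      unfolding col_span_eq[OF G] n(2)[symmetric] by (auto simp: E_def)
    show "std_subspace d i \<subseteq> col_span (g 1) n"
    proof
      fix v :: "'k vec" assume v: "v \<in> std_subspace d i"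
      note vc = std_subspace_carrier[OF v]
      have "inv\<^bsub>G\<^esub> (g 1) *\<^sub>v v \<in> E"
        unfolding E_def using GL_inv_vec(2)[OF G vc] v mult_mat_vec_carrier[OF GL_carrier_mat[OF GL_inv(1)[OF G]] vc]
        by simp
      then show "v \<in> col_span (g 1) n"
        unfolding col_span_eq[OF G] n(2)[symmetric] using GL_inv_vec(2)[OF G vc] by (metis imageI)
    qed
  qed
  have "n = i"
  proof (rule ccontr)
    assume ni: "n \<noteq> i"
    consider "n = 0" | "n = d" | "n \<in> {1..d - 1}" using n(1) by fastforce
    then show False
    proof cases
      case 1
      have "row_value d (\<lambda>_. 1) (unit_vec d 0) = (0::'k)"
        using row_value_span_0[OF G, of "unit_vec d 0" "\<lambda>_. 1"] span 1 std_subspace_unit[of 0 i d] i_bounds by simp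
      then show False using row_value_unit[of 0 d "\<lambda>_. 1"] i_bounds by simp
    next
      case 2
      then have "unit_vec d i \<in> (std_subspace d i :: 'k vec set)"
        using span col_span_full[OF G] by auto
      then have "\<forall>k\<in>{i..<d}. (unit_vec d i :: 'k vec) $ k = 0"
        unfolding std_subspace_def by blast
      then have "(unit_vec d i :: 'k vec) $ i = 0"
        using i_bounds(2) by (meson atLeastLessThan_iff le_refl)
      then show False using i_bounds(2) by simp
    next
      case 3
      have "frob_vec ` col_span (g 1) n \<subseteq> col_span (g 1) n"
        unfolding span using frob_std_subspace by blast
      then show False
        using gallery_wall(1)[OF g 3] 3 ni by blast
    qed
  qed
  then show ?thesis using span by simp
qed

text \<open>The argument for \<open>Omega\<close> applies to the line in the standard subspace and to the line in the
  quotient by it.\<close>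

lemma C_I_imp_flag_of:
  assumes "c \<in> C_I q d i"
  shows "\<exists>x\<in>source. x i = 0 \<and> c = flag_of x"
proof -
  obtain g where g: "gallery d ({1..d - 1} - {i}) g c"
    and par: "g 1 <#\<^bsub>G\<^esub> borel d #>\<^bsub>G\<^esub> inv\<^bsub>G\<^esub> (g 1) \<subseteq> parabolic d i"
    using assms C_I_iff by blast
  note span = C_I_span[OF g par]
  have d1: "1 \<in> {1..d}" "0 < d" using d_ge_2 by auto
  note G = gallery_GL[OF g d1(1)]
  note gc = GL_carrier_mat[OF G]
  define u where "u = (\<lambda>r. g 1 $$ (r, 0))"
  define u' where "u' = (\<lambda>r. g 1 $$ (r, i))"
  have "col (g 1) 0 \<in> std_subspace d i"
    using col_in_span[OF G, of 0 i] span i_bounds d1 by simp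
  then have u0: "u r = 0" if "r \<in> {i..<d}" for r
    using that gc d1 by (auto simp: std_subspace_def u_def)
  have ind: "a r = 0" if a: "\<And>r. a r \<in> Fq q" and z: "(\<Sum>r<i. a r * u r) = 0" and r: "r < i" for a r
  proof -
    have "{..<d} = {..<i} \<union> {i..<d}" "{..<i} \<inter> {i..<d} = {}"
      using i_bounds by auto
    then have "(\<Sum>r<d. a r * u r) = (\<Sum>r<i. a r * u r) + (\<Sum>r=i..<d. a r * u r)"
      by (simp add: sum.union_disjoint)
    then have "row_value d a (col (g 1) 0) = 0"
      using z u0 gc d1 by (simp add: row_value_def u_def)
    then have V: "row_value d a v = 0" if "v \<in> col_span (g 1) 1" for v
      using row_value_span_Suc[OF G d1(2) row_value_span_0[OF G], of a v] that by simp
    have "row_value d a (unit_vec d r) = 0"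
    proof (rule row_value_up[OF g a _ _ _ _ V])
      show "unit_vec d r \<in> col_span (g 1) i"
        unfolding span using r i_bounds(2) by (intro std_subspace_unit) auto
    qed (use i_bounds in auto)
    then show ?thesis using row_value_unit[of r d a] r i_bounds by simp
  qed
  have ind': "a r = 0" if a: "\<And>r. a r \<in> Fq q" and z: "(\<Sum>r=i..<d. a r * u' r) = 0" and r: "r \<in> {i..<d}" for a r
  proof -
    define b where "b = (\<lambda>r. if r < i then 0 else a r)"
    have bq: "b r \<in> Fq q" for r using a by (simp add: b_def)
    have "{..<d} = {..<i} \<union> {i..<d}" "{..<i} \<inter> {i..<d} = {}"
      using i_bounds by auto
    then have "(\<Sum>r<d. b r * u' r) = (\<Sum>r<i. b r * u' r) + (\<Sum>r=i..<d. b r * u' r)"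
      by (simp add: sum.union_disjoint)
    also have "(\<Sum>r=i..<d. b r * u' r) = (\<Sum>r=i..<d. a r * u' r)"
      by (intro sum.cong) (auto simp: b_def)
    also have "(\<Sum>r<i. b r * u' r) = 0"
      by (intro sum.neutral) (auto simp: b_def)
    finally have c0: "row_value d b (col (g 1) i) = 0"
      using z gc i_bounds by (simp add: row_value_def u'_def)
    have lo: "row_value d b v = 0" if "v \<in> col_span (g 1) i" for v
      using that unfolding span row_value_def by (intro sum.neutral) (auto simp: b_def std_subspace_def)
    have "row_value d b v = 0" if "v \<in> col_span (g 1) (Suc i)" for v
      using row_value_span_Suc[OF G i_bounds(2) lo c0 that] .
    note V = this
    have "row_value d b (unit_vec d r) = 0"
    proof (rule row_value_up[OF g bq _ _ _ _ V])
      show "unit_vec d r \<in> col_span (g 1) d"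
        unfolding col_span_full[OF G] by simp
    qed (use i_bounds in auto)
    then show ?thesis using row_value_unit[of r d b] r by (auto simp: b_def)
  qed
  have nz: "u (i - 1) \<noteq> 0"
  proof
    assume "u (i - 1) = 0"
    then have "(\<Sum>s<i. (if s = i - 1 then 1 else 0) * u s) = 0"
      by (intro sum.neutral) auto
    then have "(if i - 1 = i - 1 then 1 else 0) = (0::'k)"
      by (rule ind[rotated]) (use i_bounds in auto)
    then show False by simp
  qed
  have nz': "u' (d - 1) \<noteq> 0"
  proof
    assume "u' (d - 1) = 0"
    then have "(\<Sum>s=i..<d. (if s = d - 1 then 1 else 0) * u' s) = 0"
      by (intro sum.neutral) auto
    then have "(if d - 1 = d - 1 then 1 else 0) = (0::'k)"
      by (rule ind'[rotated]) (use i_bounds in auto)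
    then show False by simp
  qed
  define x where "x = (\<lambda>j\<in>{1..d - 1}. if j < i then u (j - 1) / u (i - 1)
    else if j = i then 0 else u' (j - 1) / u' (d - 1))"
  have xi: "x i = 0"
    using i_bounds by (simp add: x_def)
  have Xi: "\<Xi> x j = u (j - 1) / u (i - 1)" if "j \<in> {1..i}" for j
    using that i_bounds nz by (auto simp: xi_coord_def x_def)
  have Wx: "W x l = u' l / u' (d - 1)" if "l \<in> {i..<d}" for l
    using that nz' by (cases "Suc l = d") (auto simp: w_coord_def x_def)
  have "w_independent x"
    unfolding w_independent_def
  proof (intro allI impI ballI)
    fix a l assume a: "\<forall>l. a l \<in> Fq q" "(\<Sum>l=i..<d. a l * W x l) = 0" "l \<in> {i..<d}"
    have "(\<Sum>l=i..<d. a l * W x l) = (\<Sum>l=i..<d. a l * u' l) / u' (d - 1)"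
      unfolding sum_divide_distrib by (intro sum.cong) (simp_all add: Wx)
    then show "a l = 0" using ind'[of a l] a nz' by simp
  qed
  moreover have "xi_independent x"
    unfolding xi_independent_def
  proof (intro allI impI ballI)
    fix a b j
    assume ab: "\<forall>l. a l \<in> Fq q" "\<forall>l. b l \<in> Fq q"
      "(\<Sum>j=1..i. a j * \<Xi> x j) = x i * (\<Sum>l=i..<d. b l * W x l)" and j: "j \<in> {1..i}"
    have "(\<Sum>j=1..i. a j * \<Xi> x j) = (\<Sum>j=1..i. a j * u (j - 1)) / u (i - 1)"
      unfolding sum_divide_distrib by (intro sum.cong) (simp_all add: Xi)
    then have "(\<Sum>j=1..i. a j * u (j - 1)) = 0"
      using ab(3) xi nz by simp
    then have "(\<Sum>r<i. a (Suc r) * u r) = 0"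
      unfolding One_nat_def sum.atLeast1_atMost_eq by simp
    then show "a j = 0"
      using ind[of "\<lambda>r. a (Suc r)" "j - 1"] ab(1) j by auto
  qed
  ultimately have x: "x \<in> source"
    by (simp add: source_def) (simp add: x_def)
  have "c = flag_of x"
  proof (rule flag_of_eqI[OF x])
    show "gallery d (walls x) g c"
      using g xi by (simp add: walls_def)
    have "col (frame x) 0 = (1 / u (i - 1)) \<cdot>\<^sub>v col (g 1) 0"
    proof (rule eq_vecI)
      fix r assume "r < dim_vec ((1 / u (i - 1)) \<cdot>\<^sub>v col (g 1) 0)"
      then have r: "r < d" using gc by simp
      have "line x r = u r / u (i - 1)"
        using r xi u0[of r] Xi[of "Suc r"] by (auto simp: line_def)
      then show "col (frame x) 0 $ r = ((1 / u (i - 1)) \<cdot>\<^sub>v col (g 1) 0) $ r"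
        using frame_carrier[of x] gc d1 r i_bounds by (simp add: frame_index u_def)
    qed (use frame_carrier[of x] gc in simp)
    then show "col (frame x) 0 \<in> col_span (g 1) 1"
      using col_span_smult[OF G col_in_span[OF G, of 0 1]] d1 by simp
    define \<delta> where "\<delta> = vec d (\<lambda>r. if r < i then - (u' r / u' (d - 1)) else 0)"
    have "\<delta> \<in> std_subspace d i"
      by (auto simp: \<delta>_def std_subspace_def)
    then have "\<delta> \<in> col_span (g 1) (Suc i)"
      using span col_span_mono[OF G, of i "Suc i"] by auto
    moreover have "col (frame x) i = \<delta> + (1 / u' (d - 1)) \<cdot>\<^sub>v col (g 1) i"
    proof (rule eq_vecI)
      fix r assume "r < dim_vec (\<delta> + (1 / u' (d - 1)) \<cdot>\<^sub>v col (g 1) i)"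
      then have r: "r < d" using gc by simp
      then show "col (frame x) i $ r = (\<delta> + (1 / u' (d - 1)) \<cdot>\<^sub>v col (g 1) i) $ r"
        using frame_carrier[of x] gc d1 r i_bounds xi Wx[of r] by (simp add: frame_index u'_def \<delta>_def)
    qed (use frame_carrier[of x] gc in simp)
    ultimately show "col (frame x) i \<in> col_span (g 1) (Suc i)"
      using col_span_comb[OF G _ col_in_span[OF G, of i "Suc i"]] i_bounds by simp
  qed
  then show ?thesis using x xi by blast
qed

lemma Omega_eq: "Omega q d = flag_of ` {x \<in> source. x i \<noteq> 0}"
  using Omega_imp_flag_of flag_of_Omega by blast

lemma C_I_eq: "C_I q d i = flag_of ` {x \<in> source. x i = 0}"
  using C_I_imp_flag_of flag_of_C_I by blast

lemma Omega_I_eq: "Omega_I q d i = flag_of ` source"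
  unfolding Omega_I_def Omega_eq C_I_eq by blast

lemma flag_of_1: "flag_of x 1 = frame x <#\<^bsub>G\<^esub> borel d"
  unfolding flag_of_def using d_ge_2 path_1[of x] by (simp add: restrict_def)

lemma coset_col_0:
  assumes "x \<in> source" "h \<in> frame x <#\<^bsub>G\<^esub> borel d"
  shows "\<exists>t. t \<noteq> 0 \<and> (\<forall>r<d. h $$ (r, 0) = t * line x r)"
proof -
  obtain b where b: "b \<in> borel d" "h = frame x * b"
    using assms(2) by (auto simp: coset_mem)
  have d0: "0 < d" using d_ge_2 by simp
  note bc = GL_carrier_mat[OF borel_GL[OF b(1)]]
  have "h $$ (r, 0) = b $$ (0, 0) * line x r" if r: "r < d" for r
  proof -
    have "h $$ (r, 0) = (\<Sum>l<d. frame x $$ (r, l) * b $$ (l, 0))"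
      unfolding b(2) using frame_carrier[of x] bc r d0
      by (auto simp: scalar_prod_def lessThan_atLeast0 intro!: sum.cong)
    also have "\<dots> = (\<Sum>l<d. if l = 0 then frame x $$ (r, 0) * b $$ (0, 0) else 0)"
      using borel_below[OF b(1), of _ 0] by (intro sum.cong) auto
    also have "\<dots> = b $$ (0, 0) * line x r"
      using r d0 i_bounds by (simp add: frame_index)
    finally show ?thesis .
  qed
  then show ?thesis
    using borel_diag[OF b(1) d0] by blast
qed

lemma coset_col_i:
  assumes "x i = 0" "h \<in> frame x <#\<^bsub>G\<^esub> borel d"
  shows "\<exists>t. t \<noteq> 0 \<and> (\<forall>r\<in>{i..<d}. h $$ (r, i) = t * W x r)"
proof -
  obtain b where b: "b \<in> borel d" "h = frame x * b"
    using assms(2) by (auto simp: coset_mem)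
  note bc = GL_carrier_mat[OF borel_GL[OF b(1)]]
  have "h $$ (r, i) = b $$ (i, i) * W x r" if r: "r \<in> {i..<d}" for r
  proof -
    have "h $$ (r, i) = (\<Sum>l<d. frame x $$ (r, l) * b $$ (l, i))"
      unfolding b(2) using frame_carrier[of x] bc r i_bounds
      by (auto simp: scalar_prod_def lessThan_atLeast0 intro!: sum.cong)
    also have "\<dots> = (\<Sum>l<d. if l = i then frame x $$ (r, i) * b $$ (i, i) else 0)"
    proof (rule sum.cong[OF refl])
      fix l assume "l \<in> {..<d}"
      then show "frame x $$ (r, l) * b $$ (l, i) = (if l = i then frame x $$ (r, i) * b $$ (i, i) else 0)"
        using borel_below[OF b(1), of l i] r assms(1) q_gt_1
        by (cases l i rule: linorder_cases) (auto simp: frame_index line_def power_0_left)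
    qed
    also have "\<dots> = b $$ (i, i) * W x r"
      using r i_bounds(2) assms(1) by (simp add: frame_index)
    finally show ?thesis .
  qed
  then show ?thesis
    using borel_diag[OF b(1) i_bounds(2)] by blast
qed

text \<open>Needed because \<open>ycoords\<close> distinguishes cases by membership in \<open>C_I\<close>.\<close>

lemma flag_of_boundary:
  assumes x: "x \<in> source" and y: "y \<in> source" and eq: "flag_of x = flag_of y"
  shows "x i = y i"
proof -
  have "frame y \<in> frame x <#\<^bsub>G\<^esub> borel d"
    using coset_refl[OF frame_GL[OF y]] flag_of_1[of x] flag_of_1[of y] eq by simp
  then obtain t where t: "\<And>r. r < d \<Longrightarrow> frame y $$ (r, 0) = t * line x r"
    using coset_col_0[OF x] by blast
  have l: "line y r = t * line x r" if "r < d" for r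
    using t[OF that] that i_bounds by (simp add: frame_index)
  have "t = 1"
    using l[of "i - 1"] i_bounds(2) unfolding line_0 by simp
  then show ?thesis
    using l[of "d - 1"] d_ge_2 unfolding line_last by simp
qed

lemma flag_of_C_I_iff:
  assumes x: "x \<in> source"
  shows "flag_of x \<in> C_I q d i \<longleftrightarrow> x i = 0"
proof
  assume "flag_of x \<in> C_I q d i"
  then obtain y where "y \<in> source" "y i = 0" "flag_of x = flag_of y"
    using C_I_imp_flag_of by blast
  then show "x i = 0"
    using flag_of_boundary[OF x] by simp
qed (rule flag_of_C_I[OF x])

lemma ycoords_flag_of:
  assumes x: "x \<in> source"
  shows "ycoords q d i (flag_of x) = to_y x"
proof -
  define g where "g = (SOME g. g \<in> flag_of x 1)"
  have g: "g \<in> frame x <#\<^bsub>G\<^esub> borel d"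
    unfolding g_def flag_of_1 using coset_refl[OF frame_GL[OF x]] by (rule someI)
  obtain t where t: "t \<noteq> 0" "\<And>r. r < d \<Longrightarrow> g $$ (r, 0) = t * line x r"
    using coset_col_0[OF x g] by blast
  have nzW: "W x l \<noteq> 0" if "l \<in> {i..<d}" for l
    by (rule w_nonzero[OF source_facts(1)[OF x] that])
  have "(if flag_of x \<in> C_I q d i \<and> k > i then g $$ (k, i) / g $$ (k - 1, i)
                    else g $$ (k, 0) / g $$ (k - 1, 0)) = to_y x k" if k: "k \<in> {1..d - 1}" for k
  proof (cases "x i = 0 \<and> k > i")
    case True
    then obtain s where s: "s \<noteq> 0" "\<And>r. r \<in> {i..<d} \<Longrightarrow> g $$ (r, i) = s * W x r"
      using coset_col_i[OF _ g] by blast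
    have kk: "k \<in> {i..<d}" "k - 1 \<in> {i..<d}"
      using True k by auto
    show ?thesis
      using True k s(1) s(2)[OF kk(1)] s(2)[OF kk(2)] flag_of_C_I_iff[OF x] by (simp add: to_y_def)
  next
    case False
    have kd: "k < d" "k - 1 < d" using k by auto
    have "g $$ (k, 0) / g $$ (k - 1, 0) = line x k / line x (k - 1)"
      using t kd by simp
    also have "\<dots> = to_y x k"
      using k False by (auto simp: to_y_def line_def xi_coord_def)
    finally show ?thesis
      using False flag_of_C_I_iff[OF x] by auto
  qed
  then show ?thesis
    unfolding ycoords_def Let_def g_def[symmetric]
    by (intro extensionalityI[of _ "{1..d - 1}"]) (auto simp: to_y_def)
qed

section \<open>The unipotent group acting on flags\<close>

definition unip :: "(nat \<times> nat \<Rightarrow> 'k) \<Rightarrow> 'k mat"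
  where "unip A = mat d d (\<lambda>(r, s). if r = s then 1 else if r < i \<and> i \<le> s then A (Suc r, s) else 0)"

lemma unip_GL: "unip A \<in> carrier G"
  by (rule borel_GL, rule borelI_mat) (auto simp: unip_def)

lemma unip_carrier: "unip A \<in> carrier_mat d d"
  by (simp add: unip_def)

lemma unip_vec:
  assumes v: "v \<in> carrier_vec d" and r: "r < d"
  shows "(unip A *\<^sub>v v) $ r = v $ r + (if r < i then \<Sum>s=i..<d. A (Suc r, s) * v $ s else 0)"
proof -
  have "(unip A *\<^sub>v v) $ r = (\<Sum>s<d. unip A $$ (r, s) * v $ s)"
    by (rule mat_vec_index[OF unip_carrier v r])
  also have "\<dots> = (\<Sum>s<d. (if s = r then v $ s else 0) + (if s \<in> {i..<d} then (if r < i then A (Suc r, s) * v $ s else 0) else 0))"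
    using r by (intro sum.cong) (auto simp: unip_def)
  also have "\<dots> = v $ r + (\<Sum>s<d. if s \<in> {i..<d} then (if r < i then A (Suc r, s) * v $ s else 0) else 0)"
    using r by (simp add: sum.distrib)
  also have "(\<Sum>s<d. if s \<in> {i..<d} then (if r < i then A (Suc r, s) * v $ s else 0) else 0)
      = (\<Sum>s\<in>{..<d} \<inter> {i..<d}. if r < i then A (Suc r, s) * v $ s else 0)"
    by (rule sum.inter_restrict[symmetric]) simp
  also have "{..<d} \<inter> {i..<d} = {i..<d}" by auto
  finally show ?thesis by simp
qed

lemma unip_fixes:
  assumes v: "v \<in> std_subspace d i"
  shows "unip A *\<^sub>v v = v"
proof (rule eq_vecI)
  note vc = std_subspace_carrier[OF v]
  fix r assume "r < dim_vec v"
  then have r: "r < d" using vc by simp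
  have "(\<Sum>s=i..<d. A (Suc r, s) * v $ s) = 0"
    using v by (intro sum.neutral) (auto simp: std_subspace_def)
  then show "(unip A *\<^sub>v v) $ r = v $ r"
    using unip_vec[OF vc r] by simp
qed (use std_subspace_carrier[OF v] unip_carrier[of A] in auto)

lemma unip_diff:
  assumes v: "v \<in> carrier_vec d"
  shows "unip A *\<^sub>v v - v \<in> std_subspace d i"
  using mult_mat_vec_carrier[OF unip_carrier v, of A] v unip_vec[OF v, of _ A] by (auto simp: std_subspace_def)

lemma unip_frob: "A \<in> coeffs \<Longrightarrow> frob q (unip A) = unip A"
  using q_gt_1 by (intro eq_matI) (auto simp: frob_def unip_def coeffs_Fq[unfolded Fq_def, simplified] power_0_left)

lemma unipotent_group_carrier: "carrier (unipotent_group q d i) = unip ` coeffs"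
proof
  show "unip ` coeffs \<subseteq> carrier (unipotent_group q d i)"
  proof
    fix u assume "u \<in> unip ` coeffs"
    then obtain A where A: "A \<in> coeffs" "u = unip A" by blast
    have "(\<lambda>v. unip A *\<^sub>v v) ` std_subspace d i = std_subspace d i"
      using unip_fixes by force
    then show "u \<in> carrier (unipotent_group q d i)"
      using A(2) unip_GL unip_frob[OF A(1)] unip_fixes unip_diff
      by (auto simp: unipotent_group_def unipotent_radical_def parabolic_def)
  qed
  show "carrier (unipotent_group q d i) \<subseteq> unip ` coeffs"
  proof
    fix u :: "'k mat" assume "u \<in> carrier (unipotent_group q d i)"
    then have u: "u \<in> carrier G" "\<And>v. v \<in> std_subspace d i \<Longrightarrow> u *\<^sub>v v = v"
      "\<And>v. v \<in> carrier_vec d \<Longrightarrow> u *\<^sub>v v - v \<in> std_subspace d i" "frob q u = u"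
      by (auto simp: unipotent_group_def unipotent_radical_def parabolic_def)
    note uc = GL_carrier_mat[OF u(1)]
    have mem: "u $$ (r, s) \<in> Fq q" if "r < d" "s < d" for r s
      using arg_cong[OF u(4), of "\<lambda>u. u $$ (r, s)"] that uc by (simp add: frob_def Fq_def)
    have lo: "u $$ (r, s) = (if r = s then 1 else 0)" if "r < d" "s < i" for r s
    proof -
      have s: "s < d" using that i_bounds(2) by simp
      have "col u s = unit_vec d s"
        using u(2)[OF std_subspace_unit[OF that(2) s]] mat_unit_vec[OF uc s] by simp
      then have "col u s $ r = (unit_vec d s :: 'k vec) $ r"
        by simp
      then show ?thesis
        using uc that s by simp
    qed
    have hi: "u $$ (r, s) = (if r = s then 1 else 0)" if "i \<le> r" "r < d" "s < d" for r s
    proof -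
      have "(u *\<^sub>v unit_vec d s - unit_vec d s) $ r = 0"
        using u(3)[of "unit_vec d s"] that by (auto simp: std_subspace_def)
      then show ?thesis
        using that uc mat_unit_vec[OF uc, of s] by auto
    qed
    define A where "A = (\<lambda>p\<in>{1..i} \<times> {i..<d}. u $$ (fst p - 1, snd p))"
    have "A \<in> coeffs"
      unfolding A_def coeffs_def using mem i_bounds(2) by auto
    moreover have "u = unip A"
      using uc lo hi i_bounds(2) by (intro eq_matI) (auto simp: unip_def A_def)
    ultimately show "u \<in> unip ` coeffs" by blast
  qed
qed

lemma action_gallery:
  assumes u: "u \<in> carrier G" "frob q u = u" and g: "gallery d J g c"
  shows "gallery d J (\<lambda>k. u * g k) (flag_action d u c)"
proof -
  interpret group G by (rule GL_group)
  have gG: "g k \<in> carrier G" if "k \<in> {1..d}" for k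
    by (rule gallery_GL[OF g that])
  have sub: "borel d \<subseteq> carrier G"
    using borel_GL by blast
  have co: "u <#\<^bsub>G\<^esub> (h <#\<^bsub>G\<^esub> borel d) = (u * h) <#\<^bsub>G\<^esub> borel d" if "h \<in> carrier G" for h
    using lcos_m_assoc[OF sub u(1) that] by (simp add: GL_mult)
  have d1: "1 \<in> {1..d}" "d \<in> {1..d}" using d_ge_2 by auto
  have fr: "frob q (u * g 1) = u * frob q (g 1)"
    using frob_mult[OF GL_carrier_mat[OF u(1)] GL_carrier_mat[OF gG[OF d1(1)]]] u(2) by simp
  have "represents q d (\<lambda>k. u * g k) (flag_action d u c)"
    unfolding represents_def fr co[OF frob_GL[OF gG[OF d1(1)]], symmetric]
  proof (intro conjI ballI)
    fix k assume k: "k \<in> {1..d}"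
    show "u * g k \<in> carrier G" by (rule GL_prod[OF u(1) gG[OF k]])
    show "flag_action d u c k = (u * g k) <#\<^bsub>G\<^esub> borel d"
      using k gallery_coset[OF g k] co[OF gG[OF k]] by (simp add: flag_action_def)
  next
    show "flag_action d u c d = u <#\<^bsub>G\<^esub> (frob q (g 1) <#\<^bsub>G\<^esub> borel d)"
      using g d1 by (simp add: flag_action_def gallery_def represents_def)
  qed (simp add: flag_action_def)
  moreover have "rel_pos d (\<lambda>k. u * g k) k = rel_pos d g k" if k: "k \<in> {1..d - 1}" for k
  proof -
    have G: "g k \<in> carrier G" "g (k + 1) \<in> carrier G"
      using gG[of k] gG[of "k + 1"] k by auto
    have "inv\<^bsub>G\<^esub> (u \<otimes>\<^bsub>G\<^esub> g k) \<otimes>\<^bsub>G\<^esub> (u \<otimes>\<^bsub>G\<^esub> g (k + 1)) = inv\<^bsub>G\<^esub> (g k) \<otimes>\<^bsub>G\<^esub> g (k + 1)"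
      using u(1) G by (simp add: inv_mult_group m_assoc inv_solve_left')
    then show ?thesis
      by (simp add: rel_pos_def GL_mult)
  qed
  ultimately show ?thesis
    using g unfolding gallery_def crosses_def by simp
qed

lemma line_act:
  assumes x: "x \<in> source" and A: "A \<in> coeffs" and r: "r < d"
  shows "(1 + shift A x i * x i) * line (act A x) r =
    line x r + (if r < i then \<Sum>s=i..<d. A (Suc r, s) * line x s else 0)"
proof -
  note nz = act_denom_nonzero[OF x A]
  have sh: "(\<Sum>s=i..<d. A (Suc r, s) * line x s) = shift A x (Suc r) * x i"
    unfolding shift_def sum_distrib_right by (intro sum.cong) (auto simp: line_def)
  show ?thesis
  proof (cases "r < i")
    case True
    then show ?thesis
      using nz act_xi[OF x A, of "Suc r"] unfolding sh by (simp add: line_def)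
  next
    case False
    have "W (act A x) r = W x r"
      by (rule w_coord_cong) (use act_outer False r in auto)
    then show ?thesis
      using nz False by (simp add: line_def act_mid)
  qed
qed

text \<open>By uniqueness of galleries it suffices to compare first flags.  Off the boundary the columns agree
  up to the scalars by which the line is normalised.  On the boundary \<open>x\<close> is fixed and the matrix
  changes a column at most by a vector of the standard subspace, which is in the flag.\<close>

lemma action_flag_of:
  assumes x: "x \<in> source" and A: "A \<in> coeffs"
  shows "flag_action d (unip A) (flag_of x) = flag_of (act A x)"
proof (rule gallery_unique[OF action_gallery[OF unip_GL unip_frob[OF A] flag_of_gallery[OF x]]
      flag_of_gallery[OF act_in_source[OF x A]]])
  note nz = act_denom_nonzero[OF x A]
  note y = act_in_source[OF x A]
  note g = frame_GL[OF x] and gc = frame_carrier[of x]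
  let ?g = "unip A * frame x"
  have ug: "?g \<in> carrier G" by (rule GL_prod[OF unip_GL g])
  note ugc = GL_carrier_mat[OF ug]
  have "col (frame (act A x)) c \<in> col_span ?g (Suc c)" if c: "c < d" for c
  proof -
    have cc: "col (frame x) c \<in> carrier_vec d" by (rule col_carrier_vec[OF c gc])
    have uc: "col ?g c = unip A *\<^sub>v col (frame x) c"
      by (rule col_mult2[OF unip_carrier gc c])
    have ic: "col ?g c \<in> col_span ?g (Suc c)"
      by (rule col_in_span[OF ug]) (use c in auto)
    show ?thesis
    proof (cases "x i = 0")
      case False
      define t where "t = (1 + shift A x i * x i) ^ (q ^ c)"
      have t: "t \<noteq> 0" using nz by (simp add: t_def)
      have yi: "act A x i \<noteq> 0" using False nz by (simp add: act_mid)
      have "col (frame (act A x)) c = (1 / t) \<cdot>\<^sub>v col ?g c"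
      proof (rule eq_vecI)
        fix r assume "r < dim_vec ((1 / t) \<cdot>\<^sub>v col ?g c)"
        then have r: "r < d" using unip_carrier[of A] by simp
        have fi: "col (frame x) c $ s = line x s ^ (q ^ c)" if "s < d" for s
          using that c gc False by (simp add: frame_index)
        have "t * line (act A x) r ^ (q ^ c)
            = (line x r + (if r < i then \<Sum>s=i..<d. A (Suc r, s) * line x s else 0)) ^ (q ^ c)"
          unfolding t_def power_mult_distrib[symmetric] line_act[OF x A r] ..
        also have "\<dots> = line x r ^ (q ^ c) + (if r < i then \<Sum>s=i..<d. (A (Suc r, s) * line x s) ^ (q ^ c) else 0)"
          by (simp add: frob_add frob_sum)
        also have "\<dots> = line x r ^ (q ^ c) + (if r < i then \<Sum>s=i..<d. A (Suc r, s) * col (frame x) c $ s else 0)"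
          using coeffs_Fq[OF A] fi Fq_frob by (auto simp: power_mult_distrib intro!: sum.cong)
        also have "\<dots> = col ?g c $ r"
          unfolding uc unip_vec[OF cc r] fi[OF r] ..
        finally show "col (frame (act A x)) c $ r = ((1 / t) \<cdot>\<^sub>v col ?g c) $ r"
          using t r c ugc unip_carrier[of A] frame_carrier[of "act A x"] yi by (simp add: frame_index eq_divide_eq mult.commute)
      qed (use ugc unip_carrier[of A] frame_carrier[of "act A x"] in simp)
      then show ?thesis
        using col_span_smult[OF ug ic] by simp
    next
      case True
      have fixed: "act A x = x"
        by (rule point_eqI) (use True y x source_facts(3) in \<open>auto simp: act_xi[OF x A] act_mid act_outer\<close>)
      have block: "col_span ?g i = std_subspace d i"
        unfolding col_span_mult[OF unip_GL g] frame_block_span[OF x True] using unip_fixes by force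
      show ?thesis
      proof (cases "c < i")
        case c': True
        have "col (frame x) c \<in> std_subspace d i"
          using col_in_span[OF g c' c] frame_block_span[OF x True] by simp
        then have "col ?g c = col (frame x) c"
          unfolding uc by (rule unip_fixes)
        then show ?thesis using ic fixed by simp
      next
        case False
        have "unip A *\<^sub>v col (frame x) c - col (frame x) c \<in> col_span ?g (Suc c)"
          using unip_diff[OF cc, of A] col_span_mono[OF ug, of i "Suc c"] False unfolding block by auto
        from col_span_comb[OF ug ic this, of "- 1"]
        have "col ?g c + (- 1) \<cdot>\<^sub>v (unip A *\<^sub>v col (frame x) c - col (frame x) c) \<in> col_span ?g (Suc c)" .
        moreover have "col ?g c + (- 1) \<cdot>\<^sub>v (unip A *\<^sub>v col (frame x) c - col (frame x) c) = col (frame x) c"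
          unfolding uc using cc mult_mat_vec_carrier[OF unip_carrier cc, of A] by (intro eq_vecI) auto
        ultimately show ?thesis using fixed by simp
      qed
    qed
  qed
  then show "(unip A * path (frame x) (walls x) 1) <#\<^bsub>G\<^esub> borel d =
      path (frame (act A x)) (walls (act A x)) 1 <#\<^bsub>G\<^esub> borel d"
    unfolding path_1 by (intro coset_eqI ug frame_GL[OF y])
qed (use d_ge_2 in simp)

lemma orbit_flag_of:
  assumes x: "x \<in> source"
  shows "orbit (unipotent_group q d i) (flag_action d) (flag_of x) = flag_of ` {y \<in> source. rmap y = rmap x}"
proof -
  have "orbit (unipotent_group q d i) (flag_action d) (flag_of x) = (\<lambda>A. flag_of (act A x)) ` coeffs"
    unfolding orbit_def unipotent_group_carrier using action_flag_of[OF x] by force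
  also have "\<dots> = flag_of ` {y \<in> source. rmap y = rmap x}"
    using rmap_act[OF x] act_in_source[OF x] rmap_fibre[OF x] by (auto simp: image_iff) metis
  finally show ?thesis .
qed

section \<open>Transport to the source\<close>

lemma to_y_regular:
  assumes X: "X \<subseteq> source" and k: "k \<in> {1..d - 1}"
  shows "regular_on q (d - 1) X (\<lambda>x. to_y x k)"
proof -
  have xi: "regular_on q (d - 1) X (\<lambda>x. \<Xi> x j)" if "j \<in> {1..i}" for j
  proof (cases "j = i")
    case True
    then show ?thesis
      using regular_on_const[OF Fq_1, of "d - 1" X] by (simp add: xi_coord_def)
  next
    case False
    then have "j \<in> {1..d - 1}" using that i_bounds by auto
    then show ?thesis
      using False regular_on_coord[of j "d - 1" X] by (simp add: xi_coord_def)
  qed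
  consider "k < i" | "k = i" | "k > i" by linarith
  then show ?thesis
  proof cases
    case 1
    have "regular_on q (d - 1) X (\<lambda>x. \<Xi> x (Suc k) / \<Xi> x k)"
      by (intro regular_on_divide xi xi_nonzero source_facts) (use 1 k X in auto)
    then show ?thesis using 1 k by (simp add: to_y_def)
  next
    case 2
    have "regular_on q (d - 1) X (\<lambda>x. x i * W x i)"
      by (intro regular_on_mult regular_on_w regular_on_coord[OF i_bounds(10)]) (use i_bounds(2) in auto)
    then show ?thesis using 2 k by (simp add: to_y_def)
  next
    case 3
    have "regular_on q (d - 1) X (\<lambda>x. W x k / W x (k - 1))"
      by (intro regular_on_divide regular_on_w w_nonzero source_facts) (use 3 k X in auto)
    then show ?thesis using 3 k by (simp add: to_y_def)
  qed
qed

lemma from_y_regular: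
  assumes X: "X \<subseteq> source" and j: "j \<in> {1..d - 1}"
  shows "regular_on q (d - 1) (to_y ` X) (\<lambda>y. from_y y j)"
proof -
  have prod: "regular_on q (d - 1) S (\<lambda>y. \<Prod>l=j..b. y l)" if "b \<le> d - 1" for S :: "(nat \<Rightarrow> 'k) set" and b
    by (intro regular_on_prod regular_on_coord) (use that j in auto)
  have *: "{j..i - 1} = {j..<i}" using i_ge_1 by auto
  consider "j < i" | "j = i" | "j > i" by linarith
  then show ?thesis
  proof cases
    case 1
    have "(\<Prod>l=j..i - 1. y l) \<noteq> 0" if y: "y \<in> to_y ` X" for y
    proof -
      obtain x where x: "x \<in> source" "y = to_y x" using y X by blast
      have jj: "j \<in> {1..i}" using 1 j by auto
      show ?thesis
        unfolding * x(2) prod_xi[OF x(1) jj] using xi_nonzero[OF source_facts(2)[OF x(1)] jj] by (metis divide_eq_0_iff one_neq_zero)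
    qed
    then have "regular_on q (d - 1) (to_y ` X) (\<lambda>y. 1 / (\<Prod>l=j..i - 1. y l))"
      by (intro regular_on_divide regular_on_const prod) (use i_bounds in auto)
    then show ?thesis using 1 j by (simp add: from_y_def)
  next
    case 2
    then show ?thesis using prod[of "d - 1"] j by (simp add: from_y_def)
  next
    case 3
    have "(\<Prod>l=j..d - 1. y l) \<noteq> 0" if y: "y \<in> to_y ` X" for y
    proof -
      obtain x where x: "x \<in> source" "y = to_y x" using y X by blast
      have jj: "j \<in> {Suc i..d}" "j - 1 \<in> {i..<d}" using 3 j by auto
      show ?thesis
        unfolding x(2) theta_w[OF x(1) jj(1)] using w_nonzero[OF source_facts(1)[OF x(1)] jj(2)]
        by (metis divide_eq_0_iff one_neq_zero)
    qed
    then have "regular_on q (d - 1) (to_y ` X) (\<lambda>y. 1 / (\<Prod>l=j..d - 1. y l))"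
      by (intro regular_on_divide regular_on_const prod) auto
    then show ?thesis using 3 j by (simp add: from_y_def)
  qed
qed

abbreviation flag_variety :: "(nat \<Rightarrow> 'k) set \<Rightarrow> ('k flag_tuple, 'k) fq_variety"
  where "flag_variety X \<equiv> variety_via q (d - 1) (ycoords q d i) (flag_of ` X)"

lemma points_flag_variety: "points (flag_variety X) = flag_of ` X"
  by (simp add: variety_via_def)

text \<open>The adapted coordinates and the functions \<open>y\<close> are regular in terms of each other.\<close>

lemma flag_variety_regular:
  assumes X: "X \<subseteq> source"
  shows "f \<in> regular (flag_variety X) \<longleftrightarrow> f \<in> extensional (flag_of ` X) \<and> regular_on q (d - 1) X (\<lambda>x. f (flag_of x))"
proof -
  have img: "ycoords q d i ` flag_of ` X = to_y ` X"
    unfolding image_image using ycoords_flag_of X by (intro image_cong) auto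
  have yc: "ycoords q d i (flag_of x) = to_y x" "from_y (to_y x) = x" if "x \<in> X" for x
    using that X ycoords_flag_of from_to_y by auto
  have reg: "regular (flag_variety X) = (\<lambda>F. \<lambda>s\<in>flag_of ` X. F (ycoords q d i s)) `
      {F. F \<in> extensional (to_y ` X) \<and> regular_on q (d - 1) (to_y ` X) F}"
    unfolding variety_via_def img using regular_subvariety_iff[of _ q "d - 1" "to_y ` X"] by (auto simp: image_iff)
  show ?thesis
  proof
    assume "f \<in> regular (flag_variety X)"
    then obtain F where F: "regular_on q (d - 1) (to_y ` X) F" "f = (\<lambda>s\<in>flag_of ` X. F (ycoords q d i s))"
      unfolding reg by blast
    have "regular_on q (d - 1) X (\<lambda>x. F (to_y x))"
      by (rule regular_on_compose[where \<phi> = to_y, OF F(1) _ to_y_regular[OF X]]) auto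
    moreover have "f (flag_of x) = F (to_y x)" if "x \<in> X" for x
      using that yc(1) by (simp add: F(2))
    ultimately show "f \<in> extensional (flag_of ` X) \<and> regular_on q (d - 1) X (\<lambda>x. f (flag_of x))"
      using regular_on_cong[of X "\<lambda>x. f (flag_of x)" "\<lambda>x. F (to_y x)"] F(2) by simp
  next
    assume f: "f \<in> extensional (flag_of ` X) \<and> regular_on q (d - 1) X (\<lambda>x. f (flag_of x))"
    define F where "F = (\<lambda>y\<in>to_y ` X. f (flag_of (from_y y)))"
    have "regular_on q (d - 1) (to_y ` X) (\<lambda>y. f (flag_of (from_y y)))"
    proof (rule regular_on_compose[where \<phi> = from_y, OF conjunct2[OF f] _ from_y_regular[OF X]])
      show "from_y y \<in> X" if "y \<in> to_y ` X" for y
        using that yc(2) by auto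
    qed
    then have "F \<in> extensional (to_y ` X) \<and> regular_on q (d - 1) (to_y ` X) F"
      using regular_on_cong[of "to_y ` X" F "\<lambda>y. f (flag_of (from_y y))"] by (simp add: F_def)
    moreover have "f = (\<lambda>s\<in>flag_of ` X. F (ycoords q d i s))"
    proof (rule extensionalityI[of f "flag_of ` X"])
      fix c assume "c \<in> flag_of ` X"
      then obtain x where x: "x \<in> X" "c = flag_of x" by blast
      then show "f c = (\<lambda>s\<in>flag_of ` X. F (ycoords q d i s)) c"
        using yc[OF x(1)] by (simp add: F_def)
    qed (use f in auto)
    ultimately show "f \<in> regular (flag_variety X)"
      unfolding reg by blast
  qed
qed

lemma target_regular: "f \<in> regular (target q d i A) \<longleftrightarrow>
    f \<in> extensional (target_points q d i A) \<and> regular_on q (d - 1) (target_points q d i A) f"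
  by (simp add: target_def regular_subvariety_iff)

lemma points_target [simp]: "points (target q d i A) = target_points q d i A"
  by (simp add: target_def)

lemma rmap_target: "x \<in> source \<Longrightarrow> rmap x i \<in> A \<Longrightarrow> rmap x \<in> target_points q d i A"
  using rmap_in_target[of x] by (simp add: target_points_iff)

lemma rho_on_flag_of:
  assumes x: "x \<in> source" and S: "flag_of x \<in> S"
  shows "rho_on q d i S (flag_of x) = rmap x"
proof (rule extensionalityI[of _ "{1..d - 1}"])
  fix j assume "j \<in> {1..d - 1}"
  then show "rho_on q d i S (flag_of x) j = rmap x j"
    using S value_at_eq[OF rho_component_value[OF x]] by (simp add: rho_on_def ycoords_flag_of[OF x])
qed (use S in \<open>auto simp: rho_on_def rmap_def\<close>)

lemma flag_map_hom:
  assumes X: "X \<subseteq> source" and f: "f \<in> extensional (flag_of ` X)" "\<And>x. x \<in> X \<Longrightarrow> f (flag_of x) = rmap x"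
    and A: "\<And>x. x \<in> X \<Longrightarrow> rmap x i \<in> A"
  shows "f \<in> variety_hom (flag_variety X) (target q d i A)"
proof -
  have "f \<in> flag_of ` X \<rightarrow>\<^sub>E target_points q d i A"
    using f X A rmap_target by (auto simp: PiE_iff)
  moreover have "pullback (flag_variety X) f g \<in> regular (flag_variety X)" if g: "g \<in> regular (target q d i A)" for g
  proof -
    have "regular_on q (d - 1) X (\<lambda>x. g (rmap x))"
    proof (rule regular_on_compose[where f = g and \<phi> = rmap])
      show "regular_on q (d - 1) (target_points q d i A) g"
        using g by (simp add: target_regular)
      show "rmap x \<in> target_points q d i A" if "x \<in> X" for x
        using that X A rmap_target by blast
      show "regular_on q (d - 1) X (\<lambda>x. rmap x k)" if "k \<in> {1..d - 1}" for k
        by (rule regular_on_subset[OF regular_on_rmap[OF that] X])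
    qed
    moreover have "pullback (flag_variety X) f g (flag_of x) = g (rmap x)" if "x \<in> X" for x
      unfolding pullback_def points_flag_variety using that f(2) by simp
    ultimately show ?thesis
      unfolding flag_variety_regular[OF X]
      using regular_on_cong[of X "\<lambda>x. pullback (flag_variety X) f g (flag_of x)" "\<lambda>x. g (rmap x)"]
      by (simp add: pullback_def points_flag_variety[unfolded One_nat_def])
  qed
  ultimately show ?thesis
    by (simp add: variety_hom_def points_flag_variety[unfolded One_nat_def])
qed

section \<open>The boundary\<close>

abbreviation "boundary \<equiv> {x \<in> source. x i = 0}"

text \<open>On the boundary the map raises the first coordinates to the power \<open>N\<close>; following it by the
  power map in the last coordinates gives the Frobenius map.\<close>

definition complete_frob :: "(nat \<Rightarrow> 'k) \<Rightarrow> nat \<Rightarrow> 'k"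
  where "complete_frob z = (\<lambda>j\<in>{1..d - 1}. if j < i then z j else if j = i then 0 else z j ^ N)"

lemma complete_frob_in_boundary:
  assumes z: "z \<in> target_points q d i {0}"
  shows "complete_frob z \<in> boundary"
proof -
  have zf: "xi_off z" "w_independent z"
    using z by (auto simp: target_points_iff)
  have ci: "complete_frob z i = 0"
    using i_bounds by (simp add: complete_frob_def)
  have Xi: "\<Xi> (complete_frob z) j = \<Xi> z j" if "j \<in> {1..i}" for j
    using that i_bounds by (auto simp: xi_coord_def complete_frob_def)
  have Wz: "W (complete_frob z) l = W z l ^ N" if "l \<in> {i..<d}" for l
    using that by (auto simp: w_coord_def complete_frob_def)
  have "w_independent (complete_frob z)"
    unfolding w_independent_def
  proof (intro allI impI ballI)
    fix a l assume a: "\<forall>l. a l \<in> Fq q" "(\<Sum>l=i..<d. a l * W (complete_frob z) l) = 0" "l \<in> {i..<d}"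
    have "(\<Sum>l=i..<d. a l * W z l) ^ N = (\<Sum>l=i..<d. a l * W (complete_frob z) l)"
      unfolding frob_sum using a(1) Fq_frob Wz by (intro sum.cong) (auto simp: power_mult_distrib)
    then have "(\<Sum>l=i..<d. a l * W z l) = 0"
      using a(2) by simp
    then show "a l = 0"
      using w_independentD[OF zf(2), of a l] a by blast
  qed
  moreover have "xi_independent (complete_frob z)"
    unfolding xi_independent_def
  proof (intro allI impI ballI)
    fix a b j
    assume ab: "\<forall>l. a l \<in> Fq q" "\<forall>l. b l \<in> Fq q" "(\<Sum>j=1..i. a j * \<Xi> (complete_frob z) j)
      = complete_frob z i * (\<Sum>l=i..<d. b l * W (complete_frob z) l)" and j: "j \<in> {1..i}"
    have "(\<Sum>j=1..i. a j * \<Xi> z j) = (\<Sum>j=1..i. a j * \<Xi> (complete_frob z) j)"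
      by (intro sum.cong) (simp_all add: Xi)
    then show "a j = 0"
      using xi_offD[OF zf(1), of a j] ab j ci by simp
  qed
  ultimately show ?thesis
    using ci by (simp add: source_def) (simp add: complete_frob_def)
qed

lemma rmap_boundary:
  assumes x: "x \<in> boundary"
  shows "rmap x = (\<lambda>j\<in>{1..d - 1}. if j < i then x j ^ N else if j = i then 0 else x j)"
  using x q_gt_1 unfolding rmap_def by (intro restrict_ext) (simp add: lpoly_at_0 power_0_left)

lemma complete_frob_rmap:
  assumes x: "x \<in> boundary" and j: "j \<in> {1..d - 1}"
  shows "complete_frob (rmap x) j = x j ^ N"
  using x j N_gt_1 by (auto simp: rmap_boundary[OF x] complete_frob_def power_0_left)

lemma complete_frob_regular:
  assumes "j \<in> {1..d - 1}"
  shows "regular_on q (d - 1) S (\<lambda>z. complete_frob z j)"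
proof -
  consider "j < i" | "j = i" | "j > i" by linarith
  then show ?thesis
    using assms by cases (auto simp: complete_frob_def simp del: One_nat_def
        intro!: regular_on_coord regular_on_const regular_on_power)
qed

lemma boundary_frob_lift:
  assumes b: "b \<in> regular (flag_variety boundary)"
  shows "\<exists>b'\<in>regular (target q d i {0}). \<forall>x\<in>boundary. b' (rmap x) = b (flag_of x) ^ N"
proof -
  have sub: "boundary \<subseteq> source" by auto
  have rb: "regular_on q (d - 1) boundary (\<lambda>x. b (flag_of x))"
    using b flag_variety_regular[OF sub] by blast
  define b' where "b' = (\<lambda>z\<in>target_points q d i {0}. b (flag_of (complete_frob z)))"
  have "regular_on q (d - 1) (target_points q d i {0}) (\<lambda>z. b (flag_of (complete_frob z)))"
    by (rule regular_on_compose[where \<phi> = complete_frob, OF rb complete_frob_in_boundary complete_frob_regular])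
  then have "b' \<in> regular (target q d i {0})"
    unfolding target_regular
    using regular_on_cong[of "target_points q d i {0}" b' "\<lambda>z. b (flag_of (complete_frob z))"] by (simp add: b'_def)
  moreover have "b' (rmap x) = b (flag_of x) ^ N" if x: "x \<in> boundary" for x
  proof -
    have t: "rmap x \<in> target_points q d i {0}"
      using x rmap_zero_iff[of x] by (intro rmap_target) auto
    have "b (flag_of (complete_frob (rmap x))) = b (flag_of x) ^ N"
      by (rule regular_on_frob[OF rb x complete_frob_in_boundary[OF t] complete_frob_rmap[OF x]])
    then show ?thesis using t by (simp add: b'_def)
  qed
  ultimately show ?thesis by blast
qed

lemma prime_power_mem:
  fixes V :: "('x, 'k) fq_variety"
  assumes P: "primeideal P (coordinate_ring V)" and b: "b \<in> regular V" and n: "n \<ge> 1"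
  shows "(\<lambda>x\<in>points V. b x ^ n) \<in> P \<longleftrightarrow> b \<in> P"
proof -
  interpret primeideal P "coordinate_ring V" by (rule P)
  have carr: "carrier (coordinate_ring V) = regular V" by (simp add: coordinate_ring_def)
  have mult: "f \<otimes>\<^bsub>coordinate_ring V\<^esub> g = (\<lambda>x\<in>points V. f x * g x)" for f g
    by (simp add: coordinate_ring_def)
  have one: "(\<lambda>x\<in>points V. 1) \<in> regular V"
    using one_closed carr by (simp add: coordinate_ring_def)
  have ext: "(\<lambda>x\<in>points V. b x) = b"
  proof -
    have "\<one>\<^bsub>coordinate_ring V\<^esub> \<otimes>\<^bsub>coordinate_ring V\<^esub> b = b"
      using b carr by (intro l_one) simp
    then show ?thesis by (auto simp: mult coordinate_ring_def fun_eq_iff restrict_def split: if_splits)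
  qed
  have step: "(\<lambda>x\<in>points V. b x ^ Suc k) = b \<otimes>\<^bsub>coordinate_ring V\<^esub> (\<lambda>x\<in>points V. b x ^ k)" for k
    unfolding mult by (auto simp: fun_eq_iff)
  have reg: "(\<lambda>x\<in>points V. b x ^ k) \<in> regular V" for k
  proof (induction k)
    case (Suc k)
    then show ?case
      unfolding step using m_closed[of b "\<lambda>x\<in>points V. b x ^ k"] b unfolding carr by blast
  qed (simp only: power_0 one)
  show ?thesis
    using n
  proof (induction n rule: dec_induct)
    case base
    then show ?case using ext by simp
  next
    case (step n)
    note st = \<open>\<And>k. (\<lambda>x\<in>points V. b x ^ Suc k) = b \<otimes>\<^bsub>coordinate_ring V\<^esub> (\<lambda>x\<in>points V. b x ^ k)\<close>
    show ?case
      unfolding st using I_prime[of b "\<lambda>x\<in>points V. b x ^ n"] I_r_closed[of b "\<lambda>x\<in>points V. b x ^ n"]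
        step.IH b reg[of n] carr by auto
  qed
qed

text \<open>A prime is determined by the \<open>N\<close>-th powers in it, and these are pulled back; hence the map is
  injective on primes.  The same power \<open>N\<close>, a power of the characteristic, serves for all residue
  fields.\<close>

lemma boundary_radicial:
  assumes f: "\<And>x. x \<in> boundary \<Longrightarrow> f (flag_of x) = rmap x"
  shows "radicial (flag_variety boundary) (target q d i {0}) f"
proof -
  let ?V = "flag_variety boundary" and ?Z = "target q d i {0}"
  have N: "1 \<le> N" using N_gt_1 by simp
  have pb: "pullback ?V f b' = (\<lambda>c\<in>points ?V. b c ^ N)"
    if "\<forall>x\<in>boundary. b' (rmap x) = b (flag_of x) ^ N" for b b'
    unfolding pullback_def points_flag_variety using that f by (intro restrict_ext) auto
  have mem: "b' \<in> Spec_map ?V ?Z f P \<longleftrightarrow> b \<in> P"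
    if P: "P \<in> Spec ?V" and b: "b \<in> regular ?V" and b': "b' \<in> regular ?Z" "\<forall>x\<in>boundary. b' (rmap x) = b (flag_of x) ^ N"
    for P b b'
    using prime_power_mem[of P ?V b N] P b b' N pb[OF b'(2)] by (simp add: Spec_map_def Spec_def)
  have Psub: "P \<subseteq> regular ?V" if "P \<in> Spec ?V" for P
  proof -
    interpret primeideal P "coordinate_ring ?V" using that by (simp add: Spec_def)
    show ?thesis using a_subset by (simp add: coordinate_ring_def)
  qed
  have "inj_on (Spec_map ?V ?Z f) (Spec ?V)"
  proof (rule inj_onI)
    fix P Q assume PQ: "P \<in> Spec ?V" "Q \<in> Spec ?V" "Spec_map ?V ?Z f P = Spec_map ?V ?Z f Q"
    have "b \<in> P \<longleftrightarrow> b \<in> Q" if b: "b \<in> regular ?V" for b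
      using boundary_frob_lift[OF b] mem[OF PQ(1) b] mem[OF PQ(2) b] PQ(3) by blast
    then show "P = Q" using Psub[OF PQ(1)] Psub[OF PQ(2)] by blast
  qed
  moreover have "residue_purely_inseparable ?V ?Z f P" if P: "P \<in> Spec ?V" for P
    unfolding residue_purely_inseparable_def
  proof (intro ballI)
    fix b c assume b: "b \<in> regular ?V" and c: "c \<in> regular ?V - P"
    obtain b' where b': "b' \<in> regular ?Z" "\<forall>x\<in>boundary. b' (rmap x) = b (flag_of x) ^ N"
      using boundary_frob_lift[OF b] by blast
    obtain c' where c': "c' \<in> regular ?Z" "\<forall>x\<in>boundary. c' (rmap x) = c (flag_of x) ^ N"
      using boundary_frob_lift[of c] c by blast
    have c'P: "c' \<in> regular ?Z - Spec_map ?V ?Z f P"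
      using mem[OF P _ c'] c c'(1) by blast
    interpret primeideal P "coordinate_ring ?V" using P by (simp add: Spec_def)
    have "(\<lambda>x\<in>points ?V. c' (f x) * b x ^ N - b' (f x) * c x ^ N) = (\<lambda>x\<in>points ?V. 0)"
      unfolding points_flag_variety using b'(2) c'(2) f by (intro restrict_ext) auto
    also have "\<dots> \<in> P"
      using additive_subgroup.zero_closed[OF is_additive_subgroup] by (simp add: coordinate_ring_def)
    finally have "(\<lambda>x\<in>points ?V. c' (f x) * b x ^ (CHAR('k) ^ (e * m)) - b' (f x) * c x ^ (CHAR('k) ^ (e * m))) \<in> P"
      unfolding q_pow_eq[of m] .
    then show "\<exists>n::nat. \<exists>a\<in>regular ?Z. \<exists>s\<in>regular ?Z - Spec_map ?V ?Z f P.
        (\<lambda>x\<in>points ?V. s (f x) * b x ^ (CHAR('k) ^ n) - a (f x) * c x ^ (CHAR('k) ^ n)) \<in> P"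
      using b'(1) c'P by blast
  qed
  ultimately show ?thesis
    by (simp add: radicial_def)
qed

lemma boundary_formula:
  assumes x: "x \<in> boundary"
  shows "rmap x = (\<lambda>j\<in>{1..d - 1}. if j < i then (1 / (\<Prod>l=j..i - 1. to_y x l)) ^ N
     else if j = i then 0 else 1 / (\<Prod>l=j..d - 1. to_y x l))"
  unfolding rmap_boundary[OF x]
proof (rule restrict_ext)
  fix j assume j: "j \<in> {1..d - 1}"
  have xs: "x \<in> source" using x by simp
  have *: "{j..i - 1} = {j..<i}" using i_ge_1 by auto
  consider "j < i" | "j = i" | "j > i" by linarith
  then show "(if j < i then x j ^ N else if j = i then 0 else x j) =
    (if j < i then (1 / (\<Prod>l=j..i - 1. to_y x l)) ^ N else if j = i then 0 else 1 / (\<Prod>l=j..d - 1. to_y x l))"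
  proof cases
    case 1
    then show ?thesis using prod_xi[OF xs, of j] j unfolding * by (simp add: xi_coord_def)
  next
    case 3
    then show ?thesis using theta_w[OF xs, of j] j by (auto simp: w_coord_def)
  qed simp
qed

section \<open>The quotient\<close>

abbreviation "U \<equiv> unipotent_group q d i :: 'k mat monoid"
abbreviation "quot \<equiv> quotient_variety U (flag_action d) (flag_variety source)"
abbreviation "orb x \<equiv> orbit U (flag_action d) (flag_of x)"

lemma points_quot: "points quot = orb ` source"
  unfolding quotient_variety_def orbits_def points_flag_variety by auto

lemma orb_eq_iff:
  assumes "x \<in> source" "y \<in> source"
  shows "orb x = orb y \<longleftrightarrow> rmap x = rmap y"
proof
  assume "orb x = orb y"
  then have "flag_of x \<in> flag_of ` {z \<in> source. rmap z = rmap y}"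
    unfolding orbit_flag_of[OF assms(1)] orbit_flag_of[OF assms(2)] using assms(1) by blast
  then obtain z where z: "z \<in> source" "rmap z = rmap y" "flag_of x = flag_of z" by blast
  have "to_y x = to_y z"
    using ycoords_flag_of[OF assms(1)] ycoords_flag_of[OF z(1)] z(3) by simp
  then have "x = z"
    using from_to_y[OF assms(1)] from_to_y[OF z(1)] by metis
  then show "rmap x = rmap y" using z by simp
qed (simp add: orbit_flag_of[OF assms(1)] orbit_flag_of[OF assms(2)])

lemma quot_regular: "f \<in> regular quot \<longleftrightarrow>
    f \<in> extensional (orb ` source) \<and> regular_on q (d - 1) source (\<lambda>x. f (orb x))"
proof -
  have "regular_on q (d - 1) source (\<lambda>x. (\<lambda>c\<in>flag_of ` source. f (orbit U (flag_action d) c)) (flag_of x))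
      \<longleftrightarrow> regular_on q (d - 1) source (\<lambda>x. f (orb x))"
    by (rule regular_on_cong) simp
  moreover have "orbits U (flag_of ` source) (flag_action d) = orb ` source"
    by (auto simp: orbits_def)
  then have "f \<in> regular quot \<longleftrightarrow> f \<in> extensional (orb ` source) \<and>
      (\<lambda>c\<in>flag_of ` source. f (orbit U (flag_action d) c)) \<in> regular (flag_variety source)"
    unfolding quotient_variety_def points_flag_variety by (simp del: One_nat_def)
  ultimately show ?thesis
    unfolding flag_variety_regular[OF order_refl] by simp
qed

lemma quotient_isomorphism:
  "\<exists>\<psi>. isomorphism quot (target q d i UNIV) \<psi> \<and> (\<forall>x\<in>source. \<psi> (orb x) = rmap x)"
proof -
  define pick where "pick = (\<lambda>z. SOME x. x \<in> source \<and> rmap x = z)"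
  have pick: "pick z \<in> source" "rmap (pick z) = z" if "z \<in> T" for z
  proof -
    have "\<exists>x. x \<in> source \<and> rmap x = z" using rmap_surjective[OF that] by blast
    then have "pick z \<in> source \<and> rmap (pick z) = z" unfolding pick_def by (rule someI_ex)
    then show "pick z \<in> source" "rmap (pick z) = z" by auto
  qed
  define \<psi> where "\<psi> = (\<lambda>Y\<in>orb ` source. rmap (SOME x. x \<in> source \<and> orb x = Y))"
  have \<psi>: "\<psi> (orb x) = rmap x" if x: "x \<in> source" for x
  proof -
    have "\<exists>y. y \<in> source \<and> orb y = orb x" using x by blast
    then have "(SOME y. y \<in> source \<and> orb y = orb x) \<in> source \<and> orb (SOME y. y \<in> source \<and> orb y = orb x) = orb x"
      by (rule someI_ex)
    then have "rmap (SOME y. y \<in> source \<and> orb y = orb x) = rmap x"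
      using orb_eq_iff[OF _ x] by blast
    moreover have "orb x \<in> orb ` source" using x by (rule imageI)
    ultimately show ?thesis
      unfolding \<psi>_def by (simp only: restrict_apply if_True)
  qed
  define \<chi> where "\<chi> = (\<lambda>z\<in>T. orb (pick z))"
  have \<chi>: "\<chi> (rmap x) = orb x" if x: "x \<in> source" for x
    using pick[OF rmap_in_target[OF x]] orb_eq_iff[OF _ x] rmap_in_target[OF x] by (simp add: \<chi>_def)
  have "\<psi> \<in> variety_hom quot (target q d i UNIV)"
  proof -
    have "\<psi> \<in> points quot \<rightarrow>\<^sub>E T"
      unfolding points_quot using \<psi> rmap_in_target by (auto simp: PiE_iff \<psi>_def)
    moreover have "pullback quot \<psi> g \<in> regular quot" if g: "g \<in> regular (target q d i UNIV)" for g
    proof -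
      have "regular_on q (d - 1) source (\<lambda>x. g (rmap x))"
        using g by (intro pulled_back_regular) (simp add: target_regular)
      moreover have "pullback quot \<psi> g (orb x) = g (rmap x)" if "x \<in> source" for x
        unfolding pullback_def points_quot using that \<psi> by simp
      ultimately show ?thesis
        unfolding quot_regular
        using regular_on_cong[of source "\<lambda>x. pullback quot \<psi> g (orb x)" "\<lambda>x. g (rmap x)"]
        by (simp add: pullback_def points_quot[unfolded One_nat_def])
    qed
    ultimately show ?thesis by (simp add: variety_hom_def)
  qed
  moreover have "\<chi> \<in> variety_hom (target q d i UNIV) quot"
  proof -
    have "\<chi> \<in> T \<rightarrow>\<^sub>E points quot"
      unfolding points_quot using pick by (auto simp: PiE_iff \<chi>_def)
    moreover have "pullback (target q d i UNIV) \<chi> f \<in> regular (target q d i UNIV)" if f: "f \<in> regular quot" for f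
    proof -
      have "regular_on q (d - 1) T (\<lambda>z. f (\<chi> z))"
      proof (rule invariant_descends)
        show "regular_on q (d - 1) source (\<lambda>x. f (orb x))"
          using f unfolding quot_regular by simp
        show "f (orb (act A x)) = f (orb x)" if "x \<in> source" "A \<in> coeffs" for x A
          using orb_eq_iff[OF act_in_source[OF that] that(1)] rmap_act[OF that] by simp
        show "f (\<chi> (rmap x)) = f (orb x)" if "x \<in> source" for x
          using \<chi>[OF that] by simp
      qed
      moreover have "regular_on q (d - 1) T (pullback (target q d i UNIV) \<chi> f) \<longleftrightarrow> regular_on q (d - 1) T (\<lambda>z. f (\<chi> z))"
        by (rule regular_on_cong) (simp add: pullback_def)
      ultimately show ?thesis
        by (simp add: target_regular) (simp add: pullback_def)
    qed
    ultimately show ?thesis by (simp add: variety_hom_def)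
  qed
  moreover have "\<forall>Y\<in>points quot. \<chi> (\<psi> Y) = Y"
    unfolding points_quot using \<psi> \<chi> by auto
  moreover have "\<forall>z\<in>T. \<psi> (\<chi> z) = z"
    using \<psi> \<chi> pick by (metis)
  ultimately have "isomorphism quot (target q d i UNIV) \<psi>"
    unfolding isomorphism_def by auto
  then show ?thesis using \<psi> by blast
qed

lemma surjective_points: "rmap ` source = T"
  using rmap_in_target rmap_surjective by blast

end

section \<open>The extended morphism and its quotient\<close>

theorem mainTheorem3:
  fixes p e q d i :: nat
    and X :: "('k::alg_closed_field flag_tuple, 'k) fq_variety"
    and \<rho>' \<rho> :: "'k flag_tuple \<Rightarrow> nat \<Rightarrow> 'k"
  assumes p: "prime p" and char: "CHAR('k) = p" and q: "q = p ^ e" "e \<ge> 1"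
    and d: "d \<ge> 2" and i: "1 \<le> i" "i \<le> d - 1"
    and X: "X = Omega_I_variety q d i"
    and rho: "\<rho>' = rho q d i"
    and rho_bar: "\<rho> = rho_bar q d i"
  shows
    "\<rho>' \<in> variety_hom (Omega_variety q d i) (target q d i (UNIV - {0})) \<and>
     (\<forall>c\<in>points X. \<forall>j\<in>{1..d - 1}.
        regular_at q (d - 1) (rho_component q d i j) (ycoords q d i c)) \<and>
     \<rho> \<in> variety_hom X (target q d i UNIV) \<and>
     (\<forall>c\<in>Omega q d. \<rho> c = \<rho>' c) \<and>
     \<comment> \<open>(a)\<close>
     restrict \<rho> (C_I q d i) \<in> variety_hom (C_I_variety q d i) (target q d i {0}) \<and>
     radicial (C_I_variety q d i) (target q d i {0}) (restrict \<rho> (C_I q d i)) \<and>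
     (\<forall>c\<in>C_I q d i. let y = ycoords q d i c in
        \<rho> c = (\<lambda>j\<in>{1..d - 1}.
          if j < i then (1 / (\<Prod>l=j..i - 1. y l)) ^ (q ^ (d - i))
          else if j = i then 0
          else 1 / (\<Prod>l=j..d - 1. y l))) \<and>
     \<comment> \<open>(b)\<close>
     surjective_morphism X (target q d i UNIV) \<rho> \<and>
     (\<exists>\<psi>. isomorphism (quotient_variety (unipotent_group q d i) (flag_action d) X)
             (target q d i UNIV) \<psi> \<and>
          (\<forall>c\<in>points X. \<psi> (orbit (unipotent_group q d i) (flag_action d) c) = \<rho> c))"
proof -
  interpret rho_setup q e "TYPE('k)" d i
    by unfold_locales (use p char q d i in auto)
  have Xv: "X = flag_variety source"
    unfolding X Omega_I_variety_def Omega_I_eq ..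
  have Ov: "Omega_variety q d i = flag_variety {x \<in> source. x i \<noteq> 0}"
    unfolding Omega_variety_def Omega_eq ..
  have Cv: "C_I_variety q d i = flag_variety boundary"
    unfolding C_I_variety_def C_I_eq ..
  have pX: "points X = flag_of ` source"
    unfolding Xv points_flag_variety ..
  have \<rho>: "\<rho> (flag_of x) = rmap x" if "x \<in> source" for x
    unfolding rho_bar rho_bar_def using that Omega_I_eq by (intro rho_on_flag_of) auto
  have \<rho>': "\<rho>' (flag_of x) = rmap x" if "x \<in> source" "x i \<noteq> 0" for x
    unfolding rho rho_def using that flag_of_Omega by (intro rho_on_flag_of) auto
  have ext: "\<rho> \<in> extensional (flag_of ` source)" "\<rho>' \<in> extensional (flag_of ` {x \<in> source. x i \<noteq> 0})"
    unfolding rho_bar rho_bar_def rho rho_def rho_on_def Omega_I_eq Omega_eq by auto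
  have \<rho>C: "restrict \<rho> (C_I q d i) (flag_of x) = rmap x" if "x \<in> boundary" for x
    using that \<rho> flag_of_C_I by simp
  have "\<rho>' \<in> variety_hom (Omega_variety q d i) (target q d i (UNIV - {0}))"
    unfolding Ov by (rule flag_map_hom) (use ext \<rho>' rmap_zero_iff in auto)
  moreover have "regular_at q (d - 1) (rho_component q d i j) (ycoords q d i c)"
    if c: "c \<in> points X" and j: "j \<in> {1..d - 1}" for c j
  proof -
    obtain x where x: "x \<in> source" "c = flag_of x"
      using c unfolding pX by blast
    show ?thesis
      unfolding x(2) ycoords_flag_of[OF x(1)]
      by (rule takes_value_imp_regular_at[OF rho_component_value[OF x(1) j]])
  qed
  moreover have "\<rho> \<in> variety_hom X (target q d i UNIV)"
    unfolding Xv by (rule flag_map_hom) (use ext \<rho> in auto)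
  moreover have "\<forall>c\<in>Omega q d. \<rho> c = \<rho>' c"
    unfolding Omega_eq using \<rho> \<rho>' by auto
  moreover have "restrict \<rho> (C_I q d i) \<in> variety_hom (C_I_variety q d i) (target q d i {0})"
    unfolding Cv by (rule flag_map_hom) (use \<rho>C rmap_zero_iff C_I_eq in auto)
  moreover have "radicial (C_I_variety q d i) (target q d i {0}) (restrict \<rho> (C_I q d i))"
    unfolding Cv by (rule boundary_radicial[OF \<rho>C])
  moreover have "\<forall>c\<in>C_I q d i. let y = ycoords q d i c in
        \<rho> c = (\<lambda>j\<in>{1..d - 1}.
          if j < i then (1 / (\<Prod>l=j..i - 1. y l)) ^ (q ^ (d - i))
          else if j = i then 0
          else 1 / (\<Prod>l=j..d - 1. y l))"
  proof
    fix c :: "'k flag_tuple" assume "c \<in> C_I q d i"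
    then obtain x where x: "x \<in> boundary" "c = flag_of x"
      unfolding C_I_eq by blast
    then have xs: "x \<in> source" by simp
    show "let y = ycoords q d i c in
        \<rho> c = (\<lambda>j\<in>{1..d - 1}.
          if j < i then (1 / (\<Prod>l=j..i - 1. y l)) ^ (q ^ (d - i))
          else if j = i then 0
          else 1 / (\<Prod>l=j..d - 1. y l))"
      unfolding Let_def x(2) ycoords_flag_of[OF xs] \<rho>[OF xs] by (rule boundary_formula[OF x(1)])
  qed
  moreover have "surjective_morphism X (target q d i UNIV) \<rho>"
    unfolding surjective_morphism_def pX points_target surjective_points[symmetric] image_image
    using \<rho> by (intro image_cong) auto
  moreover have "\<exists>\<psi>. isomorphism (quotient_variety (unipotent_group q d i) (flag_action d) X)
             (target q d i UNIV) \<psi> \<and>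
          (\<forall>c\<in>points X. \<psi> (orbit (unipotent_group q d i) (flag_action d) c) = \<rho> c)"
    using quotient_isomorphism \<rho> unfolding pX unfolding Xv by auto
  ultimately show ?thesis by blast
qed

end
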